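(* \textsc{Maximum Happy Vertices} is $\mathsf{W}[2]$-hard when parameterized by the distance to graphs that are a disjoint union of stars.
   Context: All graphs are finite, simple and undirected; $[\ell]=\{1,\dots,\ell\}$. Given a graph $G$ and a coloring $c: V(G)\to[\ell]$, a vertex $v$ is happy if $c(u)=c(v)$ for every neighbour $u$ of $v$. \textsc{Maximum Happy Vertices}: given a graph $G$, a partial coloring $p: S\to[\ell]$ for some $S\subseteq V(G)$, and an integer $k$, decide whether there is a coloring $c:V(G)\to[\ell]$ extending $p$ with at least $k$ happy vertices. A star is a graph $K_{1,t}$ for some $t\ge 0$. The distance to a graph class $\mathcal{G}$ is the minimum number of vertices whose deletion yields a graph in $\mathcal{G}$. *)

theory Defs
  imports Main "HOL-Library.Disjoint_Sets"
begin

section \<open>Machine model\<close>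

text \<open>
  Instances are binary trees (S-expressions) and algorithms are programs of the WHILE language
  over trees with finitely many registers. An assignment is charged the size of the
  stored tree. Hence all trees occurring in a run have size polynomial in input size plus running time
  (with unit costs, iterating \<open>x := Pair x x\<close> would build exponentially large trees in linear
  time), and the model simulates, and is simulated by, Turing machines with polynomial overhead.
\<close>

datatype data = Leaf | Node data data

primrec dsize :: "data \<Rightarrow> nat" where
  "dsize Leaf = 1"
| "dsize (Node a b) = Suc (dsize a + dsize b)"

datatype expr = Reg nat | Nil_Expr | Pair_Expr expr expr | Left_Expr expr | Right_Expr expr

type_synonym store = "nat \<Rightarrow> data"

primrec left_of :: "data \<Rightarrow> data" where
  "left_of Leaf = Leaf"
| "left_of (Node a b) = a"

primrec right_of :: "data \<Rightarrow> data" where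
  "right_of Leaf = Leaf"
| "right_of (Node a b) = b"

primrec eval_expr :: "expr \<Rightarrow> store \<Rightarrow> data" where
  "eval_expr (Reg x) s = s x"
| "eval_expr Nil_Expr s = Leaf"
| "eval_expr (Pair_Expr e1 e2) s = Node (eval_expr e1 s) (eval_expr e2 s)"
| "eval_expr (Left_Expr e) s = left_of (eval_expr e s)"
| "eval_expr (Right_Expr e) s = right_of (eval_expr e s)"

datatype prog =
    Skip
  | Assign nat expr
  | Seq prog prog
  | Cond nat prog prog
  | Loop nat prog

text \<open>\<open>exec c s t s'\<close>: started in store \<open>s\<close>, program \<open>c\<close> halts in store \<open>s'\<close> after time \<open>t\<close>.\<close>

inductive exec :: "prog \<Rightarrow> store \<Rightarrow> nat \<Rightarrow> store \<Rightarrow> bool" where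
  Skip: "exec Skip s 1 s"
| Assign: "exec (Assign x e) s (Suc (dsize (eval_expr e s))) (s(x := eval_expr e s))"
| Seq: "exec c1 s t1 s1 \<Longrightarrow> exec c2 s1 t2 s2 \<Longrightarrow> exec (Seq c1 c2) s (t1 + t2) s2"
| Cond_True: "s x \<noteq> Leaf \<Longrightarrow> exec c1 s t s1 \<Longrightarrow> exec (Cond x c1 c2) s (Suc t) s1"
| Cond_False: "s x = Leaf \<Longrightarrow> exec c2 s t s1 \<Longrightarrow> exec (Cond x c1 c2) s (Suc t) s1"
| Loop_False: "s x = Leaf \<Longrightarrow> exec (Loop x c) s 1 s"
| Loop_True: "s x \<noteq> Leaf \<Longrightarrow> exec c s t1 s1 \<Longrightarrow> exec (Loop x c) s1 t2 s2 \<Longrightarrow>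
    exec (Loop x c) s (Suc (t1 + t2)) s2"

text \<open>Register 0 holds the input and, on termination, the output.\<close>

definition runs :: "prog \<Rightarrow> data \<Rightarrow> nat \<Rightarrow> data \<Rightarrow> bool" where
  "runs c x t y \<longleftrightarrow> (\<exists>s. exec c ((\<lambda>_. Leaf)(0 := x)) t s \<and> s 0 = y)"


section \<open>Encodings\<close>

primrec enc_nat :: "nat \<Rightarrow> data" where
  "enc_nat 0 = Leaf"
| "enc_nat (Suc n) = Node Leaf (enc_nat n)"

primrec enc_list :: "('a \<Rightarrow> data) \<Rightarrow> 'a list \<Rightarrow> data" where
  "enc_list f [] = Leaf"
| "enc_list f (x # xs) = Node (f x) (enc_list f xs)"

definition enc_pair :: "('a \<Rightarrow> data) \<Rightarrow> ('b \<Rightarrow> data) \<Rightarrow> 'a \<times> 'b \<Rightarrow> data" where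
  "enc_pair f g z = Node (f (fst z)) (g (snd z))"

lemma inj_enc_nat: "inj enc_nat"
proof (rule injI)
  fix m n show "enc_nat m = enc_nat n \<Longrightarrow> m = n"
  proof (induction m arbitrary: n)
    case 0 then show ?case by (cases n) auto
  next
    case (Suc m) then show ?case by (cases n) auto
  qed
qed

lemma inj_enc_list:
  assumes "inj f" shows "inj (enc_list f)"
proof (rule injI)
  fix xs ys show "enc_list f xs = enc_list f ys \<Longrightarrow> xs = ys"
  proof (induction xs arbitrary: ys)
    case Nil then show ?case by (cases ys) auto
  next
    case (Cons x xs) then show ?case using assms by (cases ys) (auto dest: injD)
  qed
qed

lemma inj_enc_pair: "inj f \<Longrightarrow> inj g \<Longrightarrow> inj (enc_pair f g)"
  by (auto simp: inj_def enc_pair_def)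

definition computable :: "(nat \<Rightarrow> nat) \<Rightarrow> bool" where
  "computable f \<longleftrightarrow> (\<exists>c. \<forall>n. \<exists>t. runs c (enc_nat n) t (enc_nat (f n)))"


section \<open>Parameterized problems and the W-hierarchy\<close>

text \<open>
  A parameterized problem \<open>(Q, \<kappa>)\<close> is a set of yes-instances together with a parameter function.
  Polynomial-time computability of \<open>\<kappa>\<close> is not required, since deletion distances need not have it;
  a problem given as a set of pairs (instance, number) is covered by letting \<open>\<kappa>\<close> be a projection.
\<close>

type_synonym param_problem = "data set \<times> (data \<Rightarrow> nat)"

definition fpt_reducible :: "param_problem \<Rightarrow> param_problem \<Rightarrow> bool" where
  "fpt_reducible A B \<longleftrightarrow>
     (\<exists>R c f g a. computable f \<and> computable g \<and>
        (\<forall>x. (\<exists>t \<le> f (snd A x) * dsize x ^ a. runs c x t (R x)) \<and>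
             (x \<in> fst A \<longleftrightarrow> R x \<in> fst B) \<and>
             snd B (R x) \<le> g (snd A x)))"

text \<open>
  The problem with instances \<open>I\<close>, yes-instances \<open>{i \<in> I. Y i}\<close> and parameter \<open>\<kappa>\<close>, presented
  through an injective encoding; trees encoding no instance are rejected and get parameter 0.
\<close>

definition encoded_problem ::
    "('i \<Rightarrow> data) \<Rightarrow> 'i set \<Rightarrow> ('i \<Rightarrow> bool) \<Rightarrow> ('i \<Rightarrow> nat) \<Rightarrow> param_problem" where
  "encoded_problem enc I Y \<kappa> =
     (enc ` {i \<in> I. Y i}, \<lambda>x. if x \<in> enc ` I then \<kappa> (inv_into I enc x) else 0)"

text \<open>
  A circuit is a directed acyclic graph, listed in topological order: the gate at position \<open>i\<close> refers
  to its in-neighbours by their positions, all smaller than \<open>i\<close>. The second component is the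
  position of the output node.
\<close>

datatype gate = InputG | NotG nat | AndG "nat list" | OrG "nat list"

type_synonym circuit = "gate list \<times> nat"

primrec preds :: "gate \<Rightarrow> nat list" where
  "preds InputG = []"
| "preds (NotG j) = [j]"
| "preds (AndG js) = js"
| "preds (OrG js) = js"

definition circuit_wf :: "circuit \<Rightarrow> bool" where
  "circuit_wf C \<longleftrightarrow> (case C of (gs, out) \<Rightarrow>
     (\<forall>i < length gs. distinct (preds (gs ! i)) \<and> (\<forall>j \<in> set (preds (gs ! i)). j < i)) \<and>
     (\<forall>js. AndG js \<in> set gs \<or> OrG js \<in> set gs \<longrightarrow> length js \<ge> 2) \<and>
     out < length gs \<and> (\<forall>g \<in> set gs. out \<notin> set (preds g)))"

primrec gate_val :: "gate \<Rightarrow> nat set \<Rightarrow> bool list \<Rightarrow> bool" where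
  "gate_val InputG S vs \<longleftrightarrow> length vs \<in> S"
| "gate_val (NotG j) S vs \<longleftrightarrow> \<not> vs ! j"
| "gate_val (AndG js) S vs \<longleftrightarrow> (\<forall>j \<in> set js. vs ! j)"
| "gate_val (OrG js) S vs \<longleftrightarrow> (\<exists>j \<in> set js. vs ! j)"

text \<open>Values of all nodes when exactly the input nodes in \<open>S\<close> are set to true.\<close>

definition node_vals :: "gate list \<Rightarrow> nat set \<Rightarrow> bool list" where
  "node_vals gs S = foldl (\<lambda>vs g. vs @ [gate_val g S vs]) [] gs"

definition inputs :: "circuit \<Rightarrow> nat set" where
  "inputs C = {i. i < length (fst C) \<and> fst C ! i = InputG}"

definition weighted_sat :: "circuit \<Rightarrow> nat \<Rightarrow> bool" where
  "weighted_sat C k \<longleftrightarrow>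
     (\<exists>S \<subseteq> inputs C. card S = k \<and> node_vals (fst C) S ! snd C)"

definition input_output_path :: "circuit \<Rightarrow> nat list \<Rightarrow> bool" where
  "input_output_path C p \<longleftrightarrow>
     p \<noteq> [] \<and> set p \<subseteq> {..<length (fst C)} \<and> hd p \<in> inputs C \<and> last p = snd C \<and>
     successively (\<lambda>u v. u \<in> set (preds (fst C ! v))) p"

definition depth_at_most :: "nat \<Rightarrow> circuit \<Rightarrow> bool" where
  "depth_at_most d C \<longleftrightarrow> (\<forall>p. input_output_path C p \<longrightarrow> length p - 1 \<le> d)"

text \<open>The weft counts large nodes, i.e. those with more than two in-neighbours.\<close>

definition weft_at_most :: "nat \<Rightarrow> circuit \<Rightarrow> bool" where
  "weft_at_most t C \<longleftrightarrow> (\<forall>p. input_output_path C p \<longrightarrow>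
     length (filter (\<lambda>v. length (preds (fst C ! v)) > 2) p) \<le> t)"

fun enc_gate :: "gate \<Rightarrow> data" where
  "enc_gate InputG = Node (enc_nat 0) Leaf"
| "enc_gate (NotG j) = Node (enc_nat 1) (enc_nat j)"
| "enc_gate (AndG js) = Node (enc_nat 2) (enc_list enc_nat js)"
| "enc_gate (OrG js) = Node (enc_nat 3) (enc_list enc_nat js)"

lemma inj_enc_gate: "inj enc_gate"
proof (rule injI)
  fix g h show "enc_gate g = enc_gate h \<Longrightarrow> g = h"
    by (cases g; cases h)
      (auto simp: numeral_eq_Suc dest: injD[OF inj_enc_nat] injD[OF inj_enc_list[OF inj_enc_nat]])
qed

definition enc_wcs :: "circuit \<times> nat \<Rightarrow> data" where
  "enc_wcs = enc_pair (enc_pair (enc_list enc_gate) enc_nat) enc_nat"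

lemma inj_enc_wcs: "inj enc_wcs"
  unfolding enc_wcs_def by (intro inj_enc_pair inj_enc_list inj_enc_gate inj_enc_nat)

text \<open>Weighted circuit satisfiability for circuits of weft at most \<open>t\<close> and depth at most \<open>d\<close>.\<close>

definition WCS :: "nat \<Rightarrow> nat \<Rightarrow> param_problem" where
  "WCS t d = encoded_problem enc_wcs
     {(C, k). circuit_wf C \<and> weft_at_most t C \<and> depth_at_most d C}
     (\<lambda>(C, k). weighted_sat C k) snd"

definition W :: "nat \<Rightarrow> param_problem set" where
  "W t = {A. \<exists>d \<ge> 1. fpt_reducible A (WCS t d)}"

definition W_hard :: "nat \<Rightarrow> param_problem \<Rightarrow> bool" where
  "W_hard t B \<longleftrightarrow> (\<forall>A \<in> W t. fpt_reducible A B)"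


section \<open>Graphs and deletion distance\<close>

type_synonym 'a graph = "'a set \<times> 'a set set"

definition simple_graph :: "'a graph \<Rightarrow> bool" where
  "simple_graph G \<longleftrightarrow> (case G of (V, E) \<Rightarrow>
     finite V \<and> (\<forall>e \<in> E. \<exists>u \<in> V. \<exists>v \<in> V. u \<noteq> v \<and> e = {u, v}))"

definition delete_vertices :: "'a graph \<Rightarrow> 'a set \<Rightarrow> 'a graph" where
  "delete_vertices G D = (fst G - D, {e \<in> snd G. e \<inter> D = {}})"

definition distance_to :: "('a graph \<Rightarrow> bool) \<Rightarrow> 'a graph \<Rightarrow> nat" where
  "distance_to \<G> G = (LEAST n. \<exists>D \<subseteq> fst G. card D = n \<and> \<G> (delete_vertices G D))"

definition star :: "'a graph \<Rightarrow> bool" where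
  "star G \<longleftrightarrow> (case G of (V, E) \<Rightarrow> finite V \<and> (\<exists>z \<in> V. E = (\<lambda>v. {z, v}) ` (V - {z})))"

definition disjoint_union_of_stars :: "'a graph \<Rightarrow> bool" where
  "disjoint_union_of_stars G \<longleftrightarrow> (case G of (V, E) \<Rightarrow>
     finite V \<and>
     (\<exists>P. partition_on V P \<and> (\<forall>e \<in> E. \<exists>X \<in> P. e \<subseteq> X) \<and>
          (\<forall>X \<in> P. star (X, {e \<in> E. e \<subseteq> X}))))"


section \<open>Maximum Happy Vertices\<close>

definition happy :: "'a graph \<Rightarrow> ('a \<Rightarrow> nat) \<Rightarrow> 'a \<Rightarrow> bool" where
  "happy G c v \<longleftrightarrow> (\<forall>u. {u, v} \<in> snd G \<longrightarrow> c u = c v)"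

definition max_happy_vertices :: "'a graph \<Rightarrow> nat \<Rightarrow> ('a \<Rightarrow> nat option) \<Rightarrow> nat \<Rightarrow> bool" where
  "max_happy_vertices G l p k \<longleftrightarrow>
     (\<exists>c. (\<forall>v \<in> fst G. c v \<in> {1..l}) \<and> (\<forall>v \<in> dom p. p v = Some (c v)) \<and>
          card {v \<in> fst G. happy G c v} \<ge> k)"

text \<open>
  An instance \<open>(n, es, l, ps, k)\<close> has vertex set \<open>{0, \<dots>, n - 1}\<close>, an edge list \<open>es\<close>, colours
  \<open>1, \<dots>, l\<close> (the number of colours is part of the input), and the partial colouring given
  by the association list \<open>ps\<close>.
\<close>

type_synonym mhv_instance = "nat \<times> (nat \<times> nat) list \<times> nat \<times> (nat \<times> nat) list \<times> nat"

definition mhv_graph :: "mhv_instance \<Rightarrow> nat graph" where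
  "mhv_graph = (\<lambda>(n, es, l, ps, k). ({..<n}, (\<lambda>(u, v). {u, v}) ` set es))"

definition mhv_wf :: "mhv_instance \<Rightarrow> bool" where
  "mhv_wf i \<longleftrightarrow> (case i of (n, es, l, ps, k) \<Rightarrow>
     simple_graph (mhv_graph i) \<and> distinct (map fst ps) \<and>
     dom (map_of ps) \<subseteq> {..<n} \<and> ran (map_of ps) \<subseteq> {1..l})"

definition mhv_yes :: "mhv_instance \<Rightarrow> bool" where
  "mhv_yes i \<longleftrightarrow> (case i of (n, es, l, ps, k) \<Rightarrow>
     max_happy_vertices (mhv_graph i) l (map_of ps) k)"

definition enc_mhv :: "mhv_instance \<Rightarrow> data" where
  "enc_mhv =
     enc_pair enc_nat (enc_pair (enc_list (enc_pair enc_nat enc_nat))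
       (enc_pair enc_nat (enc_pair (enc_list (enc_pair enc_nat enc_nat)) enc_nat)))"

lemma inj_enc_mhv: "inj enc_mhv"
  unfolding enc_mhv_def by (intro inj_enc_pair inj_enc_list inj_enc_nat)

definition MHV_parameterized_by :: "(nat graph \<Rightarrow> nat) \<Rightarrow> param_problem" where
  "MHV_parameterized_by \<kappa> =
     encoded_problem enc_mhv {i. mhv_wf i} mhv_yes (\<lambda>i. \<kappa> (mhv_graph i))"

end

theory Submission
  imports Defs
begin

text \<open>
  An assignment of weight \<open>k\<close> is described by the increasing sequence of its \<open>k\<close> true inputs. That an input is true,
  or that it is false, is then a disjunction of statements about one or two consecutive members of the
  sequence. Unfolding a circuit of bounded depth and weft two, and merging bounded conjunctions into
  statements about tuples of members, turns the circuit into a disjunction of conjunctions of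
  disjunctions of such statements. One more variable guesses the disjunct, and what remains is a set of clauses whose atoms fix
  the value of one of polynomially many (in \<open>k\<close>) variables over an unbounded domain.

  Each variable becomes an uncoloured vertex of the deletion set and each clause a star. The leaves of the star are precoloured,
  one colour for every atom of the clause, and a leaf is adjacent to the variable of its atom. Since the centre of the star has a
  single colour, at most one leaf per star is happy, and one is iff the clause can be
  satisfied by the colours of the variables.

  The reduction is polynomial in the instance, because \<open>k\<close> is given in unary.
\<close>


section \<open>Polynomial bounds\<close>

text \<open>The parameter bounds the number of vertices outside the stars, but not the number of
  colours. So whatever costs a variable may depend on \<open>k\<close> and the depth only, while
  whatever depends on the circuit has to go into domains and clauses. This decides the encoding.
  That an input is false would be a conjunction over all members of an unordered selection, which a
  clause cannot state; the order turns it into a disjunction over gaps, at the price of pairs. A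
  conjunction of fan-in two inside a clause costs one more level of pairing, so \<open>d\<close>
  levels of gates need pairs nested to depth \<open>d + 1\<close>. An unbounded conjunction inside a
  clause could not be absorbed in this way, and the two large nodes of a path are just what a
  conjunction of clauses and an outermost disjunction can take up.

  On the formal side a program for the whole map is needed, including the rejection of malformed
  trees. It is never written out: \<open>ptime\<close> is shown to be closed under composition, case
  distinction and bounded iteration, and because the depth is a constant of the target problem,
  recursion over it unfolds into finitely many compositions.\<close>

definition poly_bd :: "(nat \<Rightarrow> nat) \<Rightarrow> bool" where
  "poly_bd p \<longleftrightarrow> mono p \<and> (\<exists>a. \<forall>n. p n \<le> (n + 2) ^ a)"

lemma poly_bd_mono: "poly_bd p \<Longrightarrow> m \<le> n \<Longrightarrow> p m \<le> p n"
  by (auto simp: poly_bd_def mono_def)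

lemma poly_bdI: "(\<And>m n. m \<le> n \<Longrightarrow> p m \<le> p n) \<Longrightarrow> (\<And>n. p n \<le> (n + 2) ^ a) \<Longrightarrow> poly_bd p"
  unfolding poly_bd_def mono_def by blast

text \<open>The base \<open>n + 2\<close> is at least 2 even at \<open>n = 0\<close>. A constant can
  therefore serve as its own exponent, and the factor 2 of a sum is absorbed by one further
  power.\<close>

lemma le_two_power: "c \<le> (n + 2) ^ c" for c n :: nat
  by (rule order.trans[OF less_imp_le[OF less_exp]]) (simp add: power_mono)

lemma poly_bd_const: "poly_bd (\<lambda>_. c)"
  unfolding poly_bd_def by (intro conjI exI[of _ c] allI le_two_power) (simp add: mono_def)

lemma poly_bd_id: "poly_bd (\<lambda>n. n)"
  unfolding poly_bd_def by (auto simp: mono_def intro!: exI[of _ 1])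

lemma poly_bd_mult:
  assumes "poly_bd p" "poly_bd q"
  shows "poly_bd (\<lambda>n. p n * q n)"
proof -
  obtain a b where "\<forall>n. p n \<le> (n + 2) ^ a" "\<forall>n. q n \<le> (n + 2) ^ b"
    using assms by (auto simp: poly_bd_def)
  then have "\<forall>n. p n * q n \<le> (n + 2) ^ (a + b)"
    unfolding power_add by (blast intro: mult_le_mono)
  then show ?thesis
    using assms by (auto simp: poly_bd_def mono_def mult_le_mono)
qed

lemma poly_bd_add:
  assumes "poly_bd p" "poly_bd q"
  shows "poly_bd (\<lambda>n. p n + q n)"
proof -
  obtain a b where ab: "\<forall>n. p n \<le> (n + 2) ^ a" "\<forall>n. q n \<le> (n + 2) ^ b"
    using assms by (auto simp: poly_bd_def)
  have "p n + q n \<le> (n + 2) ^ Suc (max a b)" for n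
  proof -
    have "p n \<le> (n + 2) ^ max a b" "q n \<le> (n + 2) ^ max a b"
      using ab by (meson order.trans power_increasing max.cobounded1 max.cobounded2 le_add2 one_le_numeral)+
    then show ?thesis by simp
  qed
  then show ?thesis
    by (intro poly_bdI add_le_mono poly_bd_mono[OF assms(1)] poly_bd_mono[OF assms(2)])
qed

lemma poly_bd_Suc: "poly_bd p \<Longrightarrow> poly_bd (\<lambda>n. Suc (p n))"
  using poly_bd_add[of "\<lambda>_. 1" p] poly_bd_const by simp

lemma poly_bd_comp:
  assumes "poly_bd p" "poly_bd q"
  shows "poly_bd (\<lambda>n. p (q n))"
proof -
  obtain a b where ab: "\<forall>n. p n \<le> (n + 2) ^ a" "\<forall>n. q n \<le> (n + 2) ^ b"
    using assms by (auto simp: poly_bd_def)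
  have "p (q n) \<le> (n + 2) ^ ((b + 2) * a)" for n
  proof -
    \<comment> \<open>Two extra factors \<open>n + 2\<close> pay for the summand 2 in the base
      \<open>q n + 2\<close> at which \<open>p\<close> is bounded.\<close>
    have "4 \<le> (n + 2) * (n + 2)" using mult_le_mono[of 2 "n + 2" 2 "n + 2"] by simp
    moreover have "1 \<le> (n + 2) ^ b" by simp
    ultimately have "(n + 2) ^ b + 2 \<le> (n + 2) ^ b * ((n + 2) * (n + 2))"
      using mult_le_mono2[of 4 "(n + 2) * (n + 2)" "(n + 2) ^ b"] by linarith
    then have "q n + 2 \<le> (n + 2) ^ (b + 2)"
      using ab(2)[rule_format, of n] unfolding power_add power2_eq_square by linarith
    then have "(q n + 2) ^ a \<le> ((n + 2) ^ (b + 2)) ^ a" by (rule power_mono) simp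
    then show ?thesis
      using ab(1)[rule_format, of "q n"] by (simp only: power_mult)
  qed
  then show ?thesis
    by (intro poly_bdI poly_bd_mono[OF assms(1)] poly_bd_mono[OF assms(2)])
qed

lemmas poly_bd_intros = poly_bd_const poly_bd_id poly_bd_mult poly_bd_add poly_bd_Suc


section \<open>Programs\<close>

primrec rename_expr :: "(nat \<Rightarrow> nat) \<Rightarrow> expr \<Rightarrow> expr" where
  "rename_expr f (Reg x) = Reg (f x)"
| "rename_expr f Nil_Expr = Nil_Expr"
| "rename_expr f (Pair_Expr e1 e2) = Pair_Expr (rename_expr f e1) (rename_expr f e2)"
| "rename_expr f (Left_Expr e) = Left_Expr (rename_expr f e)"
| "rename_expr f (Right_Expr e) = Right_Expr (rename_expr f e)"

primrec rename :: "(nat \<Rightarrow> nat) \<Rightarrow> prog \<Rightarrow> prog" where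
  "rename f Skip = Skip"
| "rename f (Assign x e) = Assign (f x) (rename_expr f e)"
| "rename f (Seq c1 c2) = Seq (rename f c1) (rename f c2)"
| "rename f (Cond x c1 c2) = Cond (f x) (rename f c1) (rename f c2)"
| "rename f (Loop x c) = Loop (f x) (rename f c)"

primrec written :: "prog \<Rightarrow> nat set" where
  "written Skip = {}"
| "written (Assign x e) = {x}"
| "written (Seq c1 c2) = written c1 \<union> written c2"
| "written (Cond x c1 c2) = written c1 \<union> written c2"
| "written (Loop x c) = written c"

lemma finite_written: "finite (written c)"
  by (induction c) auto

lemma exec_unwritten: "exec c s t s' \<Longrightarrow> r \<notin> written c \<Longrightarrow> s' r = s r"
  by (induction rule: exec.induct) auto

text \<open>Only assignments change a register, and they are charged the size of the tree they
  store. Every bound on the size of an output rests on this.\<close>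

lemma exec_size: "exec c s t s' \<Longrightarrow> s' r = s r \<or> dsize (s' r) \<le> t"
proof (induction rule: exec.induct)
  case (Seq c1 s t1 s1 c2 t2 s2)
  then show ?case by (metis trans_le_add1 trans_le_add2)
next
  case (Loop_True s x c t1 s1 t2 s2)
  then show ?case by (metis trans_le_add1 trans_le_add2 le_SucI)
qed (auto simp: le_SucI)

lemma eval_rename: "(\<And>r. S (f r) = s r) \<Longrightarrow> eval_expr (rename_expr f e) S = eval_expr e s"
  by (induction e) auto

lemma exec_rename:
  "exec c s t s' \<Longrightarrow> inj f \<Longrightarrow> (\<And>r. S (f r) = s r) \<Longrightarrow>
    \<exists>S'. exec (rename f c) S t S' \<and> (\<forall>r. S' (f r) = s' r) \<and> (\<forall>r. r \<notin> range f \<longrightarrow> S' r = S r)"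
proof (induction arbitrary: S rule: exec.induct)
  case (Skip s)
  then show ?case using exec.Skip[of S] by (intro exI[of _ S]) simp
next
  case (Assign x e s)
  have "exec (rename f (Assign x e)) S (Suc (dsize (eval_expr e s))) (S(f x := eval_expr e s))"
    using exec.Assign[of "f x" "rename_expr f e" S] eval_rename[of S f s e] Assign by simp
  then show ?case
    using Assign.prems by (intro exI[of _ "S(f x := eval_expr e s)"] conjI allI impI)
      (assumption | simp add: inj_eq | auto)+
next
  case (Seq c1 s t1 s1 c2 t2 s2)
  from Seq.IH(1)[OF Seq.prems] obtain S1 where S1: "exec (rename f c1) S t1 S1"
    "\<forall>r. S1 (f r) = s1 r" "\<forall>r. r \<notin> range f \<longrightarrow> S1 r = S r" by blast
  from Seq.IH(2)[OF Seq.prems(1), of S1] S1(2) obtain S2 where S2: "exec (rename f c2) S1 t2 S2"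
    "\<forall>r. S2 (f r) = s2 r" "\<forall>r. r \<notin> range f \<longrightarrow> S2 r = S1 r" by blast
  show ?case using exec.Seq[OF S1(1) S2(1)] S1(3) S2(2,3) by (intro exI[of _ S2]) simp
next
  case (Cond_True s x c1 t s1 c2)
  from Cond_True.IH[OF Cond_True.prems] obtain S' where "exec (rename f c1) S t S'"
    "\<forall>r. S' (f r) = s1 r" "\<forall>r. r \<notin> range f \<longrightarrow> S' r = S r" by blast
  then show ?case
    using exec.Cond_True[of S "f x" "rename f c1" t S'] Cond_True by (intro exI[of _ S']) simp
next
  case (Cond_False s x c2 t s1 c1)
  from Cond_False.IH[OF Cond_False.prems] obtain S' where "exec (rename f c2) S t S'"
    "\<forall>r. S' (f r) = s1 r" "\<forall>r. r \<notin> range f \<longrightarrow> S' r = S r" by blast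
  then show ?case
    using exec.Cond_False[of S "f x" "rename f c2" t S'] Cond_False by (intro exI[of _ S']) simp
next
  case (Loop_False s x c)
  then show ?case using exec.Loop_False[of S "f x"] by (intro exI[of _ S]) simp
next
  case (Loop_True s x c t1 s1 t2 s2)
  from Loop_True.IH(1)[OF Loop_True.prems] obtain S1 where S1: "exec (rename f c) S t1 S1"
    "\<forall>r. S1 (f r) = s1 r" "\<forall>r. r \<notin> range f \<longrightarrow> S1 r = S r" by blast
  from Loop_True.IH(2)[OF Loop_True.prems(1), of S1] S1(2) obtain S2 where S2:
    "exec (rename f (Loop x c)) S1 t2 S2"
    "\<forall>r. S2 (f r) = s2 r" "\<forall>r. r \<notin> range f \<longrightarrow> S2 r = S1 r" by blast
  show ?case
    using exec.Loop_True[of S "f x" "rename f c" t1 S1 t2 S2] S1 S2 Loop_True.hyps(1) Loop_True.prems(2)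
    by (intro exI[of _ S2]) simp
qed

primrec clear_regs :: "nat list \<Rightarrow> prog" where
  "clear_regs [] = Skip"
| "clear_regs (r # rs) = Seq (Assign r Nil_Expr) (clear_regs rs)"

lemma exec_clear:
  "exec (clear_regs rs) s (2 * length rs + 1) (\<lambda>r. if r \<in> set rs then Leaf else s r)"
proof (induction rs arbitrary: s)
  case Nil
  then show ?case using exec.Skip[of s] by simp
next
  case (Cons r rs)
  have "exec (Assign r Nil_Expr) s 2 (s(r := Leaf))"
    using exec.Assign[of r Nil_Expr s] by (simp add: numeral_2_eq_2)
  moreover have "(\<lambda>x. if x \<in> set rs then Leaf else (s(r := Leaf)) x) = (\<lambda>x. if x \<in> set (r # rs) then Leaf else s x)"
    by auto
  ultimately show ?case using exec.Seq[OF _ Cons[of "s(r := Leaf)"], of "Assign r Nil_Expr" s 2] by (simp del: fun_upd_apply)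
qed

text \<open>Programs supplied by a hypothesis start in an otherwise empty store and leave garbage
  behind. Shifting their registers by \<open>m\<close> and clearing the finitely many written ones
  makes them composable, at an extra cost \<open>K\<close> that depends on \<open>c\<close>
  only.\<close>

lemma runs_frame:
  "\<exists>P K. \<forall>x t y m S. runs c x t y \<and> S m = x \<and> (\<forall>r>m. S r = Leaf) \<longrightarrow> exec (P m) S (t + K) (S(m := y))"
proof -
  obtain rs where rs: "set rs = written c" using finite_written finite_list by metis
  \<comment> \<open>Register 0 is exempt from clearing because it holds the output.\<close>
  define rs' where "rs' = filter (\<lambda>r. r \<noteq> 0) rs"
  define P where "P m = Seq (rename (\<lambda>r. m + r) c) (clear_regs (map (\<lambda>r. m + r) rs'))" for m
  have "exec (P m) S (t + (2 * length rs' + 1)) (S(m := y))"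
    if H: "runs c x t y" "S m = x" "\<forall>r>m. S r = Leaf" for x t y m S
  proof -
    obtain s' where s': "exec c ((\<lambda>_. Leaf)(0 := x)) t s'" "s' 0 = y"
      using \<open>runs c x t y\<close> by (auto simp: runs_def)
    obtain S' where S': "exec (rename (\<lambda>r. m + r) c) S t S'" "\<forall>r. S' (m + r) = s' r"
      "\<forall>r. r \<notin> range (\<lambda>r. m + r) \<longrightarrow> S' r = S r"
    proof -
      have "S (m + r) = ((\<lambda>_. Leaf)(0 := x)) r" for r using H(2,3) by (cases r) auto
      then show ?thesis using exec_rename[OF s'(1), of "\<lambda>r. m + r" S] by (auto simp: inj_def intro: that)
    qed
    have "(\<lambda>r. if r \<in> set (map (\<lambda>r. m + r) rs') then Leaf else S' r) = S(m := y)"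
    proof
      fix r
      consider "r < m" | "r = m" | k where "r = m + k" "k > 0"
        by (metis less_imp_add_positive linorder_neqE_nat)
      then show "(if r \<in> set (map (\<lambda>r. m + r) rs') then Leaf else S' r) = (S(m := y)) r"
      proof cases
        case 1
        then show ?thesis using S'(3) by auto
      next
        case 2
        then show ?thesis using S'(2)[rule_format, of 0] s'(2) by (auto simp: rs'_def)
      next
        case 3
        then show ?thesis
          using S'(2) exec_unwritten[OF s'(1), of k] rs H by (auto simp: rs'_def)
      qed
    qed
    with exec.Seq[OF S'(1) exec_clear[of "map (\<lambda>r. m + r) rs'" S']] show ?thesis
      by (simp add: P_def)
  qed
  then show ?thesis by blast
qed


section \<open>Polynomial-time functions between encoded types\<close>

class tree_enc =
  fixes encode :: "'a \<Rightarrow> data"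
  assumes inj_encode: "inj encode"

lemma encode_eq_iff: "encode x = encode y \<longleftrightarrow> x = y"
  using inj_encode by (auto dest: injD)

abbreviation esize :: "'a::tree_enc \<Rightarrow> nat" where
  "esize x \<equiv> dsize (encode x)"

lemma dsize_pos: "0 < dsize x"
  by (cases x) auto

text \<open>A program family \<open>P\<close> working in the frame of registers \<open>m, m + 1, \<dots>\<close>: it replaces the
  value in register \<open>m\<close> and leaves all registers above it empty.\<close>

definition computes :: "(nat \<Rightarrow> prog) \<Rightarrow> (nat \<Rightarrow> nat) \<Rightarrow> ('a::tree_enc \<Rightarrow> 'b::tree_enc) \<Rightarrow> bool" where
  "computes P p f \<longleftrightarrow> (\<forall>m S x. S m = encode x \<longrightarrow> (\<forall>r>m. S r = Leaf) \<longrightarrow>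
     (\<exists>t \<le> p (esize x). exec (P m) S t (S(m := encode (f x)))))"

definition ptime :: "('a::tree_enc \<Rightarrow> 'b::tree_enc) \<Rightarrow> bool" where
  "ptime f \<longleftrightarrow> (\<exists>P p. poly_bd p \<and> computes P p f)"

lemma computesI:
  "(\<And>m S x. S m = encode x \<Longrightarrow> \<forall>r>m. S r = Leaf \<Longrightarrow>
     \<exists>t \<le> p (esize x). exec (P m) S t (S(m := encode (f x)))) \<Longrightarrow> computes P p f"
  by (auto simp: computes_def)

lemma computesD:
  assumes "computes P p f" "S m = encode x" "\<forall>r>m. S r = Leaf"
  obtains t where "t \<le> p (esize x)" "exec (P m) S t (S(m := encode (f x)))"
  using assms unfolding computes_def by blast

lemma ptimeE:
  assumes "ptime f"
  obtains P p where "poly_bd p" "computes P p f"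
  using assms by (auto simp: ptime_def)

text \<open>The result is either the unchanged input or was stored during the run, and then the
  running time bounds its size.\<close>

lemma ptime_size:
  fixes f :: "'a::tree_enc \<Rightarrow> 'b::tree_enc"
  assumes "ptime f"
  obtains p where "poly_bd p" "\<forall>x. esize (f x) \<le> p (esize x)"
proof -
  obtain P p where P: "poly_bd p" "computes P p f" using assms by (rule ptimeE)
  have "esize (f x) \<le> esize x + p (esize x)" for x
  proof -
    obtain t where "t \<le> p (esize x)"
      "exec (P 0) ((\<lambda>_. Leaf)(0 := encode x)) t (((\<lambda>_. Leaf)(0 := encode x))(0 := encode (f x)))"
      using computesD[OF P(2), of "(\<lambda>_. Leaf)(0 := encode x)" 0 x] by auto
    from this(1) exec_size[OF this(2), of 0] show ?thesis by auto
  qed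
  with that show ?thesis using P poly_bd_add[OF poly_bd_id, of p] by blast
qed

text \<open>A program sees only trees, so functions with equal encoded results share their program
  even if their result types differ. Changes of representation are free in this sense.\<close>

lemma ptime_cast:
  assumes "ptime f" "\<And>x. encode (g x) = encode (f x)"
  shows "ptime g"
  using assms by (auto simp: ptime_def computes_def)

lemma ptime_cast_id:
  fixes g :: "'a::tree_enc \<Rightarrow> 'b::tree_enc"
  assumes "\<And>x. encode (g x) = encode x"
  shows "ptime g"
proof -
  have "computes (\<lambda>_. Skip) (\<lambda>_. 1) g"
  proof (rule computesI)
    fix m :: nat and S :: store and x :: 'a assume "S m = encode x"
    then have "S(m := encode (g x)) = S" using assms by (auto simp: fun_eq_iff)
    then show "\<exists>t\<le>1. exec Skip S t (S(m := encode (g x)))" using exec.Skip[of S] by auto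
  qed
  then show ?thesis using poly_bd_const ptime_def by blast
qed

lemma ptime_id: "ptime (\<lambda>x. x)"
  by (rule ptime_cast_id) simp

lemma exec_Assign_eq:
  "v = eval_expr e S \<Longrightarrow> t = Suc (dsize v) \<Longrightarrow> S' = S(x := v) \<Longrightarrow> exec (Assign x e) S t S'"
  using exec.Assign by simp

lemma ptime_expr:
  fixes f :: "'a::tree_enc \<Rightarrow> 'b::tree_enc"
  assumes "\<And>m S x. S m = encode x \<Longrightarrow> eval_expr (e m) S = encode (f x)"
    and "poly_bd p" "\<And>x. esize (f x) \<le> p (esize x)"
  shows "ptime f"
proof -
  have "computes (\<lambda>m. Assign m (e m)) (\<lambda>n. Suc (p n)) f"
  proof (rule computesI)
    fix m :: nat and S :: store and x :: 'a assume "S m = encode x"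
    then show "\<exists>t\<le>Suc (p (esize x)). exec (Assign m (e m)) S t (S(m := encode (f x)))"
      using assms(1,3) by (intro exI[of _ "Suc (esize (f x))"]) (auto intro!: exec_Assign_eq)
  qed
  then show ?thesis using assms(2) poly_bd_Suc ptime_def by blast
qed

primrec const_expr :: "data \<Rightarrow> expr" where
  "const_expr Leaf = Nil_Expr"
| "const_expr (Node a b) = Pair_Expr (const_expr a) (const_expr b)"

lemma eval_const_expr: "eval_expr (const_expr d) S = d"
  by (induction d) auto

lemma ptime_const: "ptime (\<lambda>_. c)"
  by (rule ptime_expr[of "\<lambda>_. const_expr (encode c)" _ "\<lambda>_. esize c"])
    (auto simp: eval_const_expr poly_bd_const)

lemma ptime_comp:
  fixes f :: "'a::tree_enc \<Rightarrow> 'b::tree_enc"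
  assumes "ptime g" "ptime f"
  shows "ptime (\<lambda>x. g (f x))"
proof -
  obtain P p where P: "poly_bd p" "computes P p f" using assms(2) by (rule ptimeE)
  obtain Q q where Q: "poly_bd q" "computes Q q g" using assms(1) by (rule ptimeE)
  obtain r where r: "poly_bd r" "\<forall>x. esize (f x) \<le> r (esize x)" using assms(2) by (rule ptime_size)
  have "computes (\<lambda>m. Seq (P m) (Q m)) (\<lambda>n. p n + q (r n)) (\<lambda>x. g (f x))"
  proof (rule computesI)
    fix m :: nat and S :: store and x :: 'a assume S: "S m = encode x" "\<forall>r>m. S r = Leaf"
    obtain t1 where t1: "t1 \<le> p (esize x)" "exec (P m) S t1 (S(m := encode (f x)))"
      using computesD[OF P(2) S] .
    obtain t2 where t2: "t2 \<le> q (esize (f x))" "exec (Q m) (S(m := encode (f x))) t2 (S(m := encode (g (f x))))"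
      using computesD[OF Q(2), of "S(m := encode (f x))" m "f x"] S by auto
    have "t2 \<le> q (r (esize x))" using t2(1) poly_bd_mono[OF Q(1) r(2)[rule_format]] order.trans by blast
    then show "\<exists>t\<le>p (esize x) + q (r (esize x)). exec (Seq (P m) (Q m)) S t (S(m := encode (g (f x))))"
      using exec.Seq[OF t1(2) t2(2)] t1(1) add_le_mono by blast
  qed
  moreover have "poly_bd (\<lambda>n. p n + q (r n))"
    using P(1) Q(1) r(1) by (intro poly_bd_intros poly_bd_comp[of q r])
  ultimately show ?thesis using ptime_def by blast
qed

instantiation data :: tree_enc begin
definition encode_data :: "data \<Rightarrow> data" where "encode_data x = x"
instance by standard (simp add: encode_data_def inj_def)
end

instantiation bool :: tree_enc begin
definition encode_bool :: "bool \<Rightarrow> data" where "encode_bool b = (if b then Node Leaf Leaf else Leaf)"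
instance by standard (auto simp: encode_bool_def inj_def)
end

instantiation nat :: tree_enc begin
definition encode_nat :: "nat \<Rightarrow> data" where "encode_nat = enc_nat"
instance by standard (simp add: encode_nat_def inj_enc_nat)
end

instantiation prod :: (tree_enc, tree_enc) tree_enc begin
definition encode_prod :: "'a \<times> 'b \<Rightarrow> data" where "encode_prod = enc_pair encode encode"
instance by standard (simp add: encode_prod_def inj_enc_pair inj_encode)
end

instantiation list :: (tree_enc) tree_enc begin
definition encode_list :: "'a list \<Rightarrow> data" where "encode_list = enc_list encode"
instance by standard (simp add: encode_list_def inj_enc_list inj_encode)
end

instantiation gate :: tree_enc begin
definition encode_gate :: "gate \<Rightarrow> data" where "encode_gate = enc_gate"
instance by standard (simp add: encode_gate_def inj_enc_gate)
end

lemma encode_simps [simp]: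
  "encode (a, b) = Node (encode a) (encode b)"
  "encode ([] :: 'a::tree_enc list) = Leaf"
  "encode (x # xs) = Node (encode x) (encode xs)"
  "encode (0::nat) = Leaf"
  "encode (Suc n) = Node Leaf (encode n)"
  "encode True = Node Leaf Leaf"
  "encode False = Leaf"
  "encode (d::data) = d"
  by (simp_all add: encode_data_def encode_prod_def enc_pair_def encode_list_def encode_nat_def encode_bool_def)

lemma ptime_Pair:
  fixes f :: "'a::tree_enc \<Rightarrow> 'b::tree_enc"
  assumes "ptime f" "ptime g"
  shows "ptime (\<lambda>x. (f x, g x))"
proof -
  obtain P p where P: "poly_bd p" "computes P p f" using assms(1) by (rule ptimeE)
  obtain Q q where Q: "poly_bd q" "computes Q q g" using assms(2) by (rule ptimeE)
  obtain r where r: "poly_bd r" "\<forall>x. esize (f x, g x) \<le> r (esize x)"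
  proof -
    obtain r1 where "poly_bd r1" "\<forall>x. esize (f x) \<le> r1 (esize x)" using assms(1) by (rule ptime_size)
    moreover obtain r2 where "poly_bd r2" "\<forall>x. esize (g x) \<le> r2 (esize x)" using assms(2) by (rule ptime_size)
    ultimately show ?thesis
      by (intro that[of "\<lambda>n. Suc (r1 n + r2 n)"] poly_bd_intros allI) (simp_all add: add_le_mono)
  qed
  \<comment> \<open>Register \<open>m\<close> keeps the input until both components exist.
    \<open>Q\<close> works above the result of \<open>P\<close>, and the two auxiliary registers are
    emptied at the end to restore the frame condition.\<close>
  let ?prog = "\<lambda>m. Seq (Assign (m + 1) (Reg m)) (Seq (P (m + 1)) (Seq (Assign (m + 2) (Reg m)) (Seq (Q (m + 2))
    (Seq (Assign m (Pair_Expr (Reg (m + 1)) (Reg (m + 2))))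
      (Seq (Assign (m + 1) Nil_Expr) (Assign (m + 2) Nil_Expr))))))"
  have "computes ?prog (\<lambda>n. Suc n + (p n + (Suc n + (q n + (Suc (r n) + (2 + 2)))))) (\<lambda>x. (f x, g x))"
  proof (rule computesI)
    fix m :: nat and S :: store and x :: 'a assume S: "S m = encode x" "\<forall>r>m. S r = Leaf"
    let ?S1 = "S(m + 1 := encode x)" and ?S2 = "S(m + 1 := encode (f x))"
    let ?S3 = "?S2(m + 2 := encode x)" and ?S4 = "?S2(m + 2 := encode (g x))"
    let ?S5 = "?S4(m := encode (f x, g x))"
    obtain t1 where t1: "t1 \<le> p (esize x)" "exec (P (m + 1)) ?S1 t1 ?S2"
      using computesD[OF P(2), of ?S1 "m + 1" x] S by auto
    obtain t2 where t2: "t2 \<le> q (esize x)" "exec (Q (m + 2)) ?S3 t2 ?S4"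
      using computesD[OF Q(2), of ?S3 "m + 2" x] S by auto
    have "exec (?prog m) S (Suc (esize x) + (t1 + (Suc (esize x) + (t2 + (Suc (esize (f x, g x)) + (2 + 2))))))
        (S(m := encode (f x, g x)))"
      apply (rule exec.Seq[of _ _ _ ?S1])
       apply (rule exec_Assign_eq; simp add: S)
      apply (rule exec.Seq[OF t1(2)])
      apply (rule exec.Seq[of _ _ _ ?S3])
       apply (rule exec_Assign_eq; simp add: S)
      apply (rule exec.Seq[OF t2(2)])
      apply (rule exec.Seq[of _ _ _ ?S5])
       apply (rule exec_Assign_eq; simp)
      apply (rule exec.Seq[of _ _ _ "?S5(m + 1 := Leaf)"])
       apply (rule exec_Assign_eq; simp)
      apply (rule exec_Assign_eq; use S in \<open>auto simp: fun_eq_iff\<close>)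
      done
    moreover have "Suc (esize x) + (t1 + (Suc (esize x) + (t2 + (Suc (esize (f x, g x)) + (2 + 2))))) \<le>
        Suc (esize x) + (p (esize x) + (Suc (esize x) + (q (esize x) + (Suc (r (esize x)) + (2 + 2)))))"
      using t1(1) t2(1) r(2)[rule_format, of x] by linarith
    ultimately show "\<exists>t\<le>Suc (esize x) + (p (esize x) + (Suc (esize x) + (q (esize x) + (Suc (r (esize x)) + (2 + 2))))).
        exec (?prog m) S t (S(m := encode (f x, g x)))" by blast
  qed
  moreover have "poly_bd (\<lambda>n. Suc n + (p n + (Suc n + (q n + (Suc (r n) + (2 + 2))))))"
    using P(1) Q(1) r(1) by (intro poly_bd_intros)
  ultimately show ?thesis using ptime_def by blast
qed

lemma ptime_If:
  fixes f :: "'a::tree_enc \<Rightarrow> 'b::tree_enc"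
  assumes "ptime b" "ptime f" "ptime g"
  shows "ptime (\<lambda>x. if b x then f x else g x)"
proof -
  obtain B p0 where B: "poly_bd p0" "computes B p0 b" using assms(1) by (rule ptimeE)
  obtain P p where P: "poly_bd p" "computes P p f" using assms(2) by (rule ptimeE)
  obtain Q q where Q: "poly_bd q" "computes Q q g" using assms(3) by (rule ptimeE)
  \<comment> \<open>The test runs on a copy. Before the first branch its nonempty result has to be
    erased, since \<open>P m\<close> expects empty registers above \<open>m\<close>; in the other
    branch it is already \<open>Leaf\<close>.\<close>
  let ?prog = "\<lambda>m. Seq (Assign (m + 1) (Reg m)) (Seq (B (m + 1))
    (Cond (m + 1) (Seq (Assign (m + 1) Nil_Expr) (P m)) (Q m)))"
  let ?h = "\<lambda>x. if b x then f x else g x"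
  have "computes ?prog (\<lambda>n. Suc n + (p0 n + (3 + p n + q n))) ?h"
  proof (rule computesI)
    fix m :: nat and S :: store and x :: 'a assume S: "S m = encode x" "\<forall>r>m. S r = Leaf"
    let ?S1 = "S(m + 1 := encode x)" and ?S2 = "S(m + 1 := encode (b x))"
    obtain t0 where t0: "t0 \<le> p0 (esize x)" "exec (B (m + 1)) ?S1 t0 ?S2"
      using computesD[OF B(2), of ?S1 "m + 1" x] S by auto
    obtain t1 where t1: "t1 \<le> p (esize x)" "exec (P m) S t1 (S(m := encode (f x)))"
      using computesD[OF P(2) S] .
    obtain t2 where t2: "t2 \<le> q (esize x)" "exec (Q m) S t2 (S(m := encode (g x)))"
      using computesD[OF Q(2) S] .
    have c: "\<exists>t\<le>3 + p (esize x) + q (esize x).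
      exec (Cond (m + 1) (Seq (Assign (m + 1) Nil_Expr) (P m)) (Q m)) ?S2 t (S(m := encode (?h x)))"
    proof (cases "b x")
      case True
      have "exec (Assign (m + 1) Nil_Expr) ?S2 2 S"
        using S by (intro exec_Assign_eq) (auto simp: fun_eq_iff)
      from exec.Cond_True[OF _ exec.Seq[OF this t1(2)], of "m + 1"] True t1(1) show ?thesis
        by (intro exI[of _ "Suc (2 + t1)"]) auto
    next
      case False
      then have "?S2 = S" using S by (auto simp: fun_eq_iff)
      with exec.Cond_False[OF _ t2(2), of "m + 1"] False t2(1) S show ?thesis
        by (intro exI[of _ "Suc t2"]) auto
    qed
    then obtain t3 where t3: "t3 \<le> 3 + p (esize x) + q (esize x)"
      "exec (Cond (m + 1) (Seq (Assign (m + 1) Nil_Expr) (P m)) (Q m)) ?S2 t3 (S(m := encode (?h x)))"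
      by blast
    have "exec (Assign (m + 1) (Reg m)) S (Suc (esize x)) ?S1"
      by (rule exec_Assign_eq; simp add: S)
    from exec.Seq[OF this exec.Seq[OF t0(2) t3(2)]] t0(1) t3(1)
    show "\<exists>t\<le>Suc (esize x) + (p0 (esize x) + (3 + p (esize x) + q (esize x))). exec (?prog m) S t (S(m := encode (?h x)))"
      by (meson add_le_mono order_refl)
  qed
  moreover have "poly_bd (\<lambda>n. Suc n + (p0 n + (3 + p n + q n)))"
    using B(1) P(1) Q(1) by (intro poly_bd_intros)
  ultimately show ?thesis using ptime_def by blast
qed

text \<open>Polynomial steps alone do not suffice, because sizes could square in every round. Hence
  \<open>q\<close> bounds both the number of rounds and the size of every intermediate
  state.\<close>

lemma ptime_while:
  fixes init :: "'a::tree_enc \<Rightarrow> 'b::tree_enc" and step :: "'b \<Rightarrow> 'b"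
  assumes "ptime init" "ptime b" "ptime step" "poly_bd q"
    and iter: "\<And>x. \<exists>n\<le>q (esize x). (\<forall>i<n. b ((step ^^ i) (init x))) \<and> \<not> b ((step ^^ n) (init x)) \<and>
      (\<forall>i\<le>n. esize ((step ^^ i) (init x)) \<le> q (esize x)) \<and> f x = (step ^^ n) (init x)"
  shows "ptime f"
proof -
  obtain B p0 where B: "poly_bd p0" "computes B p0 b" using assms(2) by (rule ptimeE)
  obtain P p where P: "poly_bd p" "computes P p step" using assms(3) by (rule ptimeE)
  obtain I p1 where I: "poly_bd p1" "computes I p1 init" using assms(1) by (rule ptimeE)
  let ?test = "\<lambda>m. Seq (Assign (m + 1) (Reg m)) (B (m + 1))"
  let ?body = "\<lambda>m. Seq (Assign (m + 1) Nil_Expr) (Seq (P m) (?test m))"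
  let ?prog = "\<lambda>m. Seq (I m) (Seq (?test m) (Loop (m + 1) (?body m)))"
  \<comment> \<open>\<open>c\<close> bounds one evaluation of the test on a copy of the state,
    \<open>d\<close> one full round: clearing the old test result, one step, the next test, and the
    unit charged by the loop.\<close>
  define c where "c n = Suc (q n) + p0 (q n)" for n
  define d where "d n = 3 + p (q n) + c n" for n
  have "computes ?prog (\<lambda>n. p1 n + (c n + (q n * d n + 1))) f"
  proof (rule computesI)
    fix m :: nat and S :: store and x :: 'a assume S: "S m = encode x" "\<forall>r>m. S r = Leaf"
    obtain n where n: "n \<le> q (esize x)" "\<forall>i<n. b ((step ^^ i) (init x))" "\<not> b ((step ^^ n) (init x))"
      "\<forall>i\<le>n. esize ((step ^^ i) (init x)) \<le> q (esize x)" "f x = (step ^^ n) (init x)"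
      using iter[of x] by blast
    define y where "y i = (step ^^ i) (init x)" for i
    let ?T = "\<lambda>i. S(m := encode (y i))"
    let ?U = "\<lambda>i. (?T i)(m + 1 := encode (b (y i)))"
    have test: "\<exists>t\<le>c (esize x). exec (?test m) (?T i) t (?U i)" if "i \<le> n" for i
    proof -
      have sz: "esize (y i) \<le> q (esize x)" using n(4) that by (simp add: y_def)
      obtain t where t: "t \<le> p0 (esize (y i))" "exec (B (m + 1)) ((?T i)(m + 1 := encode (y i))) t (?U i)"
        using computesD[OF B(2), of "(?T i)(m + 1 := encode (y i))" "m + 1" "y i"] S by auto
      have "exec (Assign (m + 1) (Reg m)) (?T i) (Suc (esize (y i))) ((?T i)(m + 1 := encode (y i)))"
        by (rule exec_Assign_eq; simp)
      moreover have "Suc (esize (y i)) + t \<le> c (esize x)"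
        using sz t(1) poly_bd_mono[OF B(1) sz] by (simp add: c_def)
      ultimately show ?thesis using exec.Seq t(2) by blast
    qed
    have loop: "\<exists>t\<le>(n - i) * d (esize x) + 1. exec (Loop (m + 1) (?body m)) (?U i) t (S(m := encode (f x)))"
      if "i \<le> n" for i
      using that
    proof (induction i rule: inc_induct)
      case base
      have "S(m := encode (f x)) = ?U n" using n(3,5) S by (auto simp: fun_eq_iff y_def)
      moreover have "exec (Loop (m + 1) (?body m)) (?U n) 1 (?U n)"
        using n(3) by (intro exec.Loop_False) (simp add: y_def)
      ultimately have "exec (Loop (m + 1) (?body m)) (?U n) 1 (S(m := encode (f x)))" by (simp only:)
      then show ?case by (meson le_add2)
    next
      case (step i)
      have bi: "b (y i)" using n(2) step(2) by (simp add: y_def)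
      obtain t where t: "t \<le> p (esize (y i))" "exec (P m) (?T i) t ((?T i)(m := encode (step (y i))))"
        using computesD[OF P(2), of "?T i" m "y i"] S by auto
      have ti: "t \<le> p (q (esize x))"
        using t(1) poly_bd_mono[OF P(1)] n(4) step(2) order.trans unfolding y_def by (meson less_imp_le_nat)
      have e1: "exec (P m) (?T i) t (?T (Suc i))" using t(2) by (simp add: y_def)
      have e0: "exec (Assign (m + 1) Nil_Expr) (?U i) 2 (?T i)"
        using S by (intro exec_Assign_eq) (auto simp: fun_eq_iff)
      obtain t' where t': "t' \<le> c (esize x)" "exec (?test m) (?T (Suc i)) t' (?U (Suc i))"
        using test[of "Suc i"] step(2) by auto
      obtain u where u: "u \<le> (n - Suc i) * d (esize x) + 1"
        "exec (Loop (m + 1) (?body m)) (?U (Suc i)) u (S(m := encode (f x)))"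
        using step by blast
      have "exec (Loop (m + 1) (?body m)) (?U i) (Suc ((2 + (t + t')) + u)) (S(m := encode (f x)))"
        using exec.Loop_True[OF _ exec.Seq[OF e0 exec.Seq[OF e1 t'(2)]] u(2)] bi by simp
      moreover have "Suc ((2 + (t + t')) + u) \<le> (n - i) * d (esize x) + 1"
      proof -
        have "n - i = Suc (n - Suc i)" using step(2) by simp
        then show ?thesis using ti t'(1) u(1) by (simp add: d_def)
      qed
      ultimately show ?case by blast
    qed
    obtain t0 where t0: "t0 \<le> p1 (esize x)" "exec (I m) S t0 (?T 0)"
      using computesD[OF I(2) S] by (auto simp: y_def)
    obtain t1 where t1: "t1 \<le> c (esize x)" "exec (?test m) (?T 0) t1 (?U 0)"
      using test[of 0] by auto
    obtain t2 where t2: "t2 \<le> n * d (esize x) + 1" "exec (Loop (m + 1) (?body m)) (?U 0) t2 (S(m := encode (f x)))"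
      using loop[of 0] by auto
    have "t0 + (t1 + t2) \<le> p1 (esize x) + (c (esize x) + (q (esize x) * d (esize x) + 1))"
      using t0(1) t1(1) t2(1) mult_le_mono1[OF n(1), of "d (esize x)"] by linarith
    then show "\<exists>t\<le>p1 (esize x) + (c (esize x) + (q (esize x) * d (esize x) + 1)). exec (?prog m) S t (S(m := encode (f x)))"
      using exec.Seq[OF t0(2) exec.Seq[OF t1(2) t2(2)]] by blast
  qed
  moreover have "poly_bd (\<lambda>n. p1 n + (c n + (q n * d n + 1)))"
    unfolding c_def d_def
    using I(1) B(1) P(1) assms(4) by (intro poly_bd_intros poly_bd_comp[of p q] poly_bd_comp[of p0 q])
  ultimately show ?thesis using ptime_def by blast
qed


section \<open>Closure properties of polynomial time\<close>

named_theorems ptime_intros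

lemma ptime_cong:
  assumes "ptime f" "\<And>x. g x = f x"
  shows "ptime g"
proof -
  have "g = f" using assms(2) by blast
  then show ?thesis using assms(1) by simp
qed

text \<open>Functions of several arguments are certified in uncurried form, in the lemmas ending in
  \<open>0\<close>. These rules turn them into introduction rules that match a function applied to
  arbitrary argument expressions.\<close>

lemma ptime_comp2:
  assumes "ptime (\<lambda>z. g (fst z) (snd z))" "ptime a" "ptime b"
  shows "ptime (\<lambda>x. g (a x) (b x))"
  using ptime_comp[OF assms(1) ptime_Pair[OF assms(2,3)]] by simp

lemma ptime_comp3:
  assumes "ptime (\<lambda>z. g (fst z) (fst (snd z)) (snd (snd z)))" "ptime a" "ptime b" "ptime c"
  shows "ptime (\<lambda>x. g (a x) (b x) (c x))"
  using ptime_comp2[OF assms(1,2) ptime_Pair[OF assms(3,4)]] by simp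

declare ptime_const[ptime_intros] ptime_id[ptime_intros] ptime_Pair[ptime_intros] ptime_If[ptime_intros]

lemma dsize_left: "dsize (left_of d) \<le> dsize d"
  and dsize_right: "dsize (right_of d) \<le> dsize d"
  by (cases d; simp)+

lemma ptime_left:
  fixes g :: "'a::tree_enc \<Rightarrow> 'b::tree_enc"
  assumes "\<And>x. encode (g x) = left_of (encode x)" shows "ptime g"
  by (rule ptime_expr[of "\<lambda>m. Left_Expr (Reg m)" _ "\<lambda>n. n"]) (simp_all add: assms poly_bd_id dsize_left)

lemma ptime_right:
  fixes g :: "'a::tree_enc \<Rightarrow> 'b::tree_enc"
  assumes "\<And>x. encode (g x) = right_of (encode x)" shows "ptime g"
  by (rule ptime_expr[of "\<lambda>m. Right_Expr (Reg m)" _ "\<lambda>n. n"]) (simp_all add: assms poly_bd_id dsize_right)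

lemma ptime_leaf_test:
  fixes f :: "'a::tree_enc \<Rightarrow> 'b::tree_enc"
  assumes "\<And>m S x. S m = encode x \<Longrightarrow> encode x \<noteq> Leaf \<Longrightarrow> eval_expr (e1 m) S = encode (f x)"
    and "\<And>m S x. S m = encode x \<Longrightarrow> encode x = Leaf \<Longrightarrow> eval_expr (e2 m) S = encode (f x)"
    and "poly_bd p" "\<And>x. esize (f x) \<le> p (esize x)"
  shows "ptime f"
proof -
  let ?P = "\<lambda>m. Cond m (Assign m (e1 m)) (Assign m (e2 m))"
  have "computes ?P (\<lambda>n. Suc (Suc (p n))) f"
  proof (rule computesI)
    fix m :: nat and S :: store and x :: 'a assume S: "S m = encode x"
    have "exec (?P m) S (Suc (Suc (esize (f x)))) (S(m := encode (f x)))"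
    proof (cases "encode x = Leaf")
      case True
      show ?thesis
        by (rule exec.Cond_False) (use True S in simp, rule exec_Assign_eq, use True S assms(2) in simp_all)
    next
      case False
      show ?thesis
        by (rule exec.Cond_True) (use False S in simp, rule exec_Assign_eq, use False S assms(1) in simp_all)
    qed
    then show "\<exists>t\<le>Suc (Suc (p (esize x))). exec (?P m) S t (S(m := encode (f x)))"
      using assms(4) by (meson Suc_le_mono)
  qed
  then show ?thesis using assms(3) poly_bd_Suc ptime_def by blast
qed

lemma ptime_is_leaf: "ptime (\<lambda>d::data. d = Leaf)"
  by (rule ptime_leaf_test[of "\<lambda>_. Nil_Expr" _ "\<lambda>_. Pair_Expr Nil_Expr Nil_Expr" "\<lambda>_. 3"])
    (auto simp: poly_bd_const encode_bool_def)

lemma ptime_encode0: "ptime (encode :: 'a::tree_enc \<Rightarrow> data)"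
  by (rule ptime_cast_id) simp

lemmas ptime_encode [ptime_intros] = ptime_comp[OF ptime_encode0]

lemma ptime_fst0: "ptime fst" and ptime_snd0: "ptime snd"
  by (rule ptime_left ptime_right; auto)+
lemmas ptime_fst [ptime_intros] = ptime_comp[OF ptime_fst0]
lemmas ptime_snd [ptime_intros] = ptime_comp[OF ptime_snd0]

lemma ptime_left_of0: "ptime left_of" and ptime_right_of0: "ptime right_of"
  by (rule ptime_left ptime_right; simp)+
lemmas ptime_left_of [ptime_intros] = ptime_comp[OF ptime_left_of0]
lemmas ptime_right_of [ptime_intros] = ptime_comp[OF ptime_right_of0]

lemma ptime_Node0: "ptime (\<lambda>z. Node (fst z) (snd z))"
  by (rule ptime_cast_id) auto
lemmas ptime_Node [ptime_intros] = ptime_comp2[OF ptime_Node0]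

lemma ptime_Cons0: "ptime (\<lambda>z. fst z # snd z)"
  by (rule ptime_cast_id) auto
lemmas ptime_Cons [ptime_intros] = ptime_comp2[OF ptime_Cons0]

lemma ptime_Suc0: "ptime Suc"
  by (rule ptime_expr[of "\<lambda>m. Pair_Expr Nil_Expr (Reg m)" _ "\<lambda>n. n + 2"]) (auto intro!: poly_bd_intros)
lemmas ptime_Suc [ptime_intros] = ptime_comp[OF ptime_Suc0]

lemma ptime_pred0: "ptime (\<lambda>n::nat. n - 1)"
proof (rule ptime_right)
  show "encode (n - 1) = right_of (encode n)" for n :: nat by (cases n) auto
qed
lemmas ptime_pred = ptime_comp[OF ptime_pred0]

lemma ptime_tl0: "ptime tl"
proof (rule ptime_right)
  show "encode (tl xs) = right_of (encode xs)" for xs :: "'a list" by (cases xs) auto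
qed
lemmas ptime_tl [ptime_intros] = ptime_comp[OF ptime_tl0]

lemma encode_list_eq_Leaf: "encode xs = Leaf \<longleftrightarrow> xs = []" for xs :: "'a::tree_enc list"
  by (cases xs) auto

lemma ptime_is_Nil0: "ptime (\<lambda>xs. xs = [])"
  by (rule ptime_cong[OF ptime_comp[OF ptime_is_leaf ptime_encode0]]) (simp add: encode_list_eq_Leaf)
lemmas ptime_is_Nil [ptime_intros] = ptime_comp[OF ptime_is_Nil0]

lemma ptime_not [ptime_intros]: "ptime b \<Longrightarrow> ptime (\<lambda>x. \<not> b x)"
  by (rule ptime_cong[OF ptime_If[of b "\<lambda>_. False" "\<lambda>_. True"]]) (simp_all add: ptime_const)

lemma ptime_conj [ptime_intros]:
  assumes "ptime b" "ptime c" shows "ptime (\<lambda>x. b x \<and> c x)"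
proof -
  have "(\<lambda>x. b x \<and> c x) = (\<lambda>x. if b x then c x else False)" by auto
  then show ?thesis using ptime_If[OF assms ptime_const[of False]] by simp
qed

lemma ptime_disj [ptime_intros]:
  assumes "ptime b" "ptime c" shows "ptime (\<lambda>x. b x \<or> c x)"
proof -
  have "(\<lambda>x. b x \<or> c x) = (\<lambda>x. if b x then True else c x)" by auto
  then show ?thesis using ptime_If[OF assms(1) ptime_const[of True] assms(2)] by simp
qed

lemma ptime_uncons: "ptime (\<lambda>xs. case xs of [] \<Rightarrow> c | x # xs' \<Rightarrow> (x, xs'))"
  by (rule ptime_leaf_test[of "\<lambda>m. Reg m" _ "\<lambda>_. const_expr (encode c)" "\<lambda>n. n + esize c"])
    (auto simp: eval_const_expr encode_list_eq_Leaf split: list.splits intro!: poly_bd_intros)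

lemma ptime_case_list [ptime_intros]:
  assumes "ptime l" "ptime n" "ptime (\<lambda>z. c (fst z) (fst (snd z)) (snd (snd z)))"
  shows "ptime (\<lambda>e. case l e of [] \<Rightarrow> n e | x # xs \<Rightarrow> c x xs e)"
proof -
  \<comment> \<open>The value \<open>undefined\<close> only makes \<open>u\<close> total; the test
    for the empty list below guards every use of it.\<close>
  define u where "u xs = (case xs of [] \<Rightarrow> undefined | x # xs' \<Rightarrow> (x, xs'))" for xs :: "'b list"
  have u: "ptime u" unfolding u_def by (rule ptime_uncons)
  have "ptime (\<lambda>e. c (fst (u (l e))) (snd (u (l e))) e)"
    by (rule ptime_comp3[OF assms(3)]) (intro ptime_intros ptime_comp[OF u assms(1)])+
  then have "ptime (\<lambda>e. if l e = [] then n e else c (fst (u (l e))) (snd (u (l e))) e)"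
    by (intro ptime_intros assms)
  moreover have "(\<lambda>e. if l e = [] then n e else c (fst (u (l e))) (snd (u (l e))) e) =
      (\<lambda>e. case l e of [] \<Rightarrow> n e | x # xs \<Rightarrow> c x xs e)"
    by (auto simp: fun_eq_iff u_def split: list.split)
  ultimately show ?thesis by (simp only:)
qed

lemma length_le_esize: "length xs < esize xs" for xs :: "'a::tree_enc list"
  by (induction xs) auto

lemma esize_drop: "esize (drop n xs) \<le> esize xs" for xs :: "'a::tree_enc list"
proof (induction n)
  case (Suc n)
  have "esize (drop (Suc n) xs) \<le> esize (drop n xs)"
    by (cases "drop n xs") (auto simp: drop_Suc drop_tl)
  with Suc show ?case by simp
qed simp

lemma esize_mem: "x \<in> set xs \<Longrightarrow> esize x < esize xs" for xs :: "'a::tree_enc list"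
  by (induction xs) auto

text \<open>The loop state consists of the remaining list, the accumulator and the environment
  \<open>e\<close>, which travels along because programs have no closures. The assumption
  \<open>bd\<close> speaks about prefixes, as all intermediate accumulators have to stay
  small.\<close>

lemma ptime_fold_bd:
  fixes l :: "'e::tree_enc \<Rightarrow> 'x::tree_enc list" and i :: "'e \<Rightarrow> 'a::tree_enc"
  assumes "ptime l" "ptime i" "ptime (\<lambda>z. h (fst z) (fst (snd z)) (snd (snd z)))" "poly_bd q"
    and bd: "\<And>e ys zs. l e = ys @ zs \<Longrightarrow> esize (fold (\<lambda>x a. h x a e) ys (i e)) \<le> q (esize e)"
  shows "ptime (\<lambda>e. fold (\<lambda>x a. h x a e) (l e) (i e))"
proof -
  define step where "step s = (case fst s of [] \<Rightarrow> s
    | x # xs \<Rightarrow> (xs, (h x (fst (snd s)) (snd (snd s)), snd (snd s))))" for s :: "'x list \<times> 'a \<times> 'e"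
  define init where "init e = (l e, (i e, e))" for e
  have iter: "(step ^^ k) (init e) = (drop k (l e), (fold (\<lambda>x a. h x a e) (take k (l e)) (i e), e))"
    if "k \<le> length (l e)" for k e
    using that
  proof (induction k)
    case (Suc k)
    then have "take (Suc k) (l e) = take k (l e) @ [l e ! k]" "drop k (l e) = l e ! k # drop (Suc k) (l e)"
      by (auto simp: take_Suc_conv_app_nth Cons_nth_drop_Suc)
    with Suc show ?case by (simp add: step_def)
  qed (simp add: init_def)
  obtain r where r: "poly_bd r" "\<forall>e. esize (l e) \<le> r (esize e)" using assms(1) by (rule ptime_size)
  have "ptime (\<lambda>e. (step ^^ length (l e)) (init e))"
  proof (rule ptime_while[of init "\<lambda>s. fst s \<noteq> []" step "\<lambda>n. Suc (r n + Suc (q n + n))"])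
    show "ptime init" unfolding init_def by (intro ptime_intros assms)
    show "ptime (\<lambda>s::'x list \<times> 'a \<times> 'e. fst s \<noteq> [])" by (intro ptime_intros)
    have "ptime (\<lambda>z. h (fst z) (fst (snd (snd (snd z)))) (snd (snd (snd (snd z)))))"
      by (rule ptime_comp3[OF assms(3)]) (intro ptime_intros)+
    then show "ptime step" unfolding step_def by (intro ptime_intros)
    show "poly_bd (\<lambda>n. Suc (r n + Suc (q n + n)))" using r(1) assms(4) by (intro poly_bd_intros)
    fix e :: 'e
    let ?B = "Suc (r (esize e) + Suc (q (esize e) + esize e))"
    have "esize ((step ^^ k) (init e)) \<le> ?B" if "k \<le> length (l e)" for k
    proof -
      have "esize (drop k (l e)) \<le> r (esize e)" using esize_drop r(2) order.trans by blast
      moreover have "esize (fold (\<lambda>x a. h x a e) (take k (l e)) (i e)) \<le> q (esize e)"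
        by (rule bd[of e _ "drop k (l e)"]) simp
      ultimately show ?thesis by (simp add: iter[OF that])
    qed
    moreover have "length (l e) \<le> ?B" using length_le_esize[of "l e"] r(2)[rule_format, of e] by linarith
    ultimately show "\<exists>n\<le>?B. (\<forall>i<n. fst ((step ^^ i) (init e)) \<noteq> []) \<and> \<not> fst ((step ^^ n) (init e)) \<noteq> [] \<and>
        (\<forall>i\<le>n. esize ((step ^^ i) (init e)) \<le> ?B) \<and> (step ^^ length (l e)) (init e) = (step ^^ n) (init e)"
      by (intro exI[of _ "length (l e)"]) (auto simp: iter)
  qed
  then have "ptime (\<lambda>e. fst (snd ((step ^^ length (l e)) (init e))))" by (intro ptime_intros)
  then show ?thesis by (rule ptime_cong) (simp add: iter)
qed

text \<open>If every step enlarges the accumulator by an amount not depending on the accumulator, the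
  intermediate results stay polynomial.\<close>

lemma ptime_fold:
  fixes l :: "'e::tree_enc \<Rightarrow> 'x::tree_enc list" and i :: "'e \<Rightarrow> 'a::tree_enc"
  assumes "ptime l" "ptime i" "ptime (\<lambda>z. h (fst z) (fst (snd z)) (snd (snd z)))" "poly_bd q"
    and bd: "\<And>x a e. esize (h x a e) \<le> esize a + q (esize x + esize e)"
  shows "ptime (\<lambda>e. fold (\<lambda>x a. h x a e) (l e) (i e))"
proof -
  obtain r where r: "poly_bd r" "\<forall>e. esize (l e) \<le> r (esize e)" using assms(1) by (rule ptime_size)
  obtain r' where r': "poly_bd r'" "\<forall>e. esize (i e) \<le> r' (esize e)" using assms(2) by (rule ptime_size)
  show ?thesis
  proof (rule ptime_fold_bd[OF assms(1-3)])
    show "poly_bd (\<lambda>n. r' n + r n * q (r n + n))"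
      using r(1) r'(1) by (intro poly_bd_intros poly_bd_comp[OF assms(4)])
    fix e :: 'e and ys zs :: "'x list" assume ys: "l e = ys @ zs"
    have step: "esize (h x a e) \<le> esize a + q (r (esize e) + esize e)" if "x \<in> set ys" for x a
    proof -
      have "esize x \<le> r (esize e)"
        using esize_mem[of x "l e"] that ys r(2)[rule_format, of e] by auto
      then have "q (esize x + esize e) \<le> q (r (esize e) + esize e)"
        using poly_bd_mono[OF assms(4)] by simp
      then show ?thesis using bd[of x a e] by linarith
    qed
    then have "esize (fold (\<lambda>x a. h x a e) ys a) \<le> esize a + length ys * q (r (esize e) + esize e)" for a
    proof (induction ys arbitrary: a)
      case (Cons y ys)
      have "esize (fold (\<lambda>x a. h x a e) ys (h y a e)) \<le> esize (h y a e) + length ys * q (r (esize e) + esize e)"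
        using Cons.prems by (intro Cons.IH) auto
      also have "\<dots> \<le> esize a + q (r (esize e) + esize e) + length ys * q (r (esize e) + esize e)"
        using Cons.prems[of y a] by simp
      finally show ?case by (simp add: algebra_simps)
    qed simp
    from this[of "i e"] r'(2)[rule_format, of e]
    have "esize (fold (\<lambda>x a. h x a e) ys (i e)) \<le> r' (esize e) + length ys * q (r (esize e) + esize e)"
      by linarith
    also have "length ys \<le> r (esize e)"
      using length_le_esize[of "l e"] r(2)[rule_format, of e] ys by auto
    finally show "esize (fold (\<lambda>x a. h x a e) ys (i e)) \<le> r' (esize e) + r (esize e) * q (r (esize e) + esize e)"
      by simp
  qed
qed

section \<open>List operations\<close>

lemma ptime_rev0: "ptime rev"
proof -
  have "ptime (\<lambda>e::'a list. fold (\<lambda>x a. x # a) e [])"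
    by (rule ptime_fold[of _ _ _ "\<lambda>n. Suc n"]) (auto intro!: ptime_intros poly_bd_intros)
  then show ?thesis by (rule ptime_cong) (simp add: rev_conv_fold)
qed
lemmas ptime_rev [ptime_intros] = ptime_comp[OF ptime_rev0]

lemma ptime_append0: "ptime (\<lambda>z. fst z @ snd z)"
proof -
  have "ptime (\<lambda>e. fold (\<lambda>x a. x # a) (rev (fst e)) (snd e :: 'a list))"
    by (rule ptime_fold[of _ _ _ "\<lambda>n. Suc n"]) (auto intro!: ptime_intros poly_bd_intros)
  then show ?thesis by (rule ptime_cong) (simp add: fold_Cons_rev)
qed
lemmas ptime_append [ptime_intros] = ptime_comp2[OF ptime_append0]

lemma esize_append: "esize (xs @ ys) = esize xs + esize ys - 1" for xs ys :: "'a::tree_enc list"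
  using dsize_pos[of "encode ys"] by (induction xs) auto

lemma ptime_map [ptime_intros]:
  fixes l :: "'e::tree_enc \<Rightarrow> 'x::tree_enc list" and g :: "'x \<Rightarrow> 'e \<Rightarrow> 'y::tree_enc"
  assumes "ptime l" "ptime (\<lambda>z. g (fst z) (snd z))"
  shows "ptime (\<lambda>e. map (\<lambda>x. g x e) (l e))"
proof -
  obtain p where p: "poly_bd p" "\<forall>z. esize (g (fst z) (snd z)) \<le> p (esize z)"
    using assms(2) by (rule ptime_size)
  have g: "ptime (\<lambda>z. g (fst z) (snd (snd z)))"
    by (rule ptime_comp2[OF assms(2)]) (intro ptime_intros)+
  have "ptime (\<lambda>e. fold (\<lambda>x a. g x e # a) (l e) [])"
  proof (rule ptime_fold[OF assms(1), of _ _ "\<lambda>n. Suc (p (Suc n))"])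
    show "ptime (\<lambda>z. g (fst z) (snd (snd z)) # fst (snd z))" by (intro ptime_intros g)
    show "poly_bd (\<lambda>n. Suc (p (Suc n)))" by (intro poly_bd_intros poly_bd_comp[OF p(1)])
    show "esize (g x e # a) \<le> esize a + Suc (p (Suc (esize x + esize e)))" for x a e
      using p(2)[rule_format, of "(x, e)"] by simp
  qed (intro ptime_intros)
  then have "ptime (\<lambda>e. rev (fold (\<lambda>x a. g x e # a) (l e) []))" by (intro ptime_intros)
  moreover have "rev (fold (\<lambda>x a. f x # a) xs b) = rev b @ map f xs" for f :: "'x \<Rightarrow> 'y" and xs b
    by (induction xs arbitrary: b) auto
  ultimately show ?thesis by (elim ptime_cong) simp
qed

lemma ptime_filter [ptime_intros]:
  fixes l :: "'e::tree_enc \<Rightarrow> 'x::tree_enc list"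
  assumes "ptime l" "ptime (\<lambda>z. P (fst z) (snd z))"
  shows "ptime (\<lambda>e. filter (\<lambda>x. P x e) (l e))"
proof -
  have P: "ptime (\<lambda>z. P (fst z) (snd (snd z)))"
    by (rule ptime_comp2[OF assms(2)]) (intro ptime_intros)+
  have "ptime (\<lambda>e. fold (\<lambda>x a. if P x e then x # a else a) (l e) [])"
    by (rule ptime_fold[OF assms(1), of _ _ "\<lambda>n. Suc n"])
      (intro ptime_intros P poly_bd_intros | simp)+
  then have "ptime (\<lambda>e. rev (fold (\<lambda>x a. if P x e then x # a else a) (l e) []))" by (intro ptime_intros)
  moreover have "rev (fold (\<lambda>x a. if f x then x # a else a) xs b) = rev b @ filter f xs" for f :: "'x \<Rightarrow> bool" and xs b
    by (induction xs arbitrary: b) auto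
  ultimately show ?thesis by (elim ptime_cong) simp
qed

lemma ptime_concat0: "ptime concat"
proof -
  have "ptime (\<lambda>e::'a list list. fold (\<lambda>x a. x @ a) (rev e) [])"
    by (rule ptime_fold[of _ _ _ "\<lambda>n. n"]) (auto intro!: ptime_intros poly_bd_intros simp: esize_append)
  moreover have "fold (\<lambda>x a. x @ a) (rev xs) [] = concat xs" for xs :: "'a list list"
    by (simp add: concat_conv_foldr foldr_conv_fold)
  ultimately show ?thesis by (elim ptime_cong) simp
qed
lemmas ptime_concat [ptime_intros] = ptime_comp[OF ptime_concat0]

lemma ptime_Ball [ptime_intros]:
  fixes l :: "'e::tree_enc \<Rightarrow> 'x::tree_enc list"
  assumes "ptime l" "ptime (\<lambda>z. P (fst z) (snd z))"
  shows "ptime (\<lambda>e. \<forall>x\<in>set (l e). P x e)"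
proof -
  have "ptime (\<lambda>e. filter (\<lambda>x. \<not> P x e) (l e) = [])" by (intro ptime_intros assms)
  then show ?thesis by (simp add: filter_empty_conv)
qed

lemma ptime_Bex [ptime_intros]:
  fixes l :: "'e::tree_enc \<Rightarrow> 'x::tree_enc list"
  assumes "ptime l" "ptime (\<lambda>z. P (fst z) (snd z))"
  shows "ptime (\<lambda>e. \<exists>x\<in>set (l e). P x e)"
proof -
  have "ptime (\<lambda>e. \<not> (\<forall>x\<in>set (l e). \<not> P x e))" by (intro ptime_intros assms)
  then show ?thesis by simp
qed

text \<open>Equality of trees is decided with a worklist of pairs still to be compared.\<close>

definition eq_step :: "(data \<times> data) list \<times> bool \<Rightarrow> (data \<times> data) list \<times> bool" where
  "eq_step s = (case fst s of [] \<Rightarrow> s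
     | p # w \<Rightarrow>
       if fst p = Leaf then (if snd p = Leaf then (w, snd s) else ([], False))
       else if snd p = Leaf then ([], False)
       else ((left_of (fst p), left_of (snd p)) # (right_of (fst p), right_of (snd p)) # w, snd s))"

text \<open>Every round strictly decreases the total size of the first components. Splitting a pair
  of nodes keeps the encoded size of the worklist, because the new list cell and pair node replace
  the two removed nodes; the 4 pays for the pairing with the flag.\<close>

lemma eq_step_iter:
  "\<exists>n\<le>(\<Sum>p\<leftarrow>w. dsize (fst p)). (\<forall>i<n. fst ((eq_step ^^ i) (w, b)) \<noteq> []) \<and>
    (eq_step ^^ n) (w, b) = ([], b \<and> (\<forall>p\<in>set w. fst p = snd p)) \<and>
    (\<forall>i\<le>n. esize ((eq_step ^^ i) (w, b)) \<le> esize w + 4)"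
proof (induction "\<Sum>p\<leftarrow>w. dsize (fst p)" arbitrary: w b rule: less_induct)
  case less
  show ?case
  proof (cases w)
    case Nil
    then show ?thesis by (intro exI[of _ 0]) (auto simp: encode_bool_def)
  next
    case (Cons p w0)
    obtain w' b' where s: "eq_step (w, b) = (w', b')" by fastforce
    have d: "(\<Sum>p\<leftarrow>w'. dsize (fst p)) < (\<Sum>p\<leftarrow>w. dsize (fst p))"
      and e: "esize w' \<le> esize w"
      and q: "(b' \<and> (\<forall>p\<in>set w'. fst p = snd p)) = (b \<and> (\<forall>p\<in>set w. fst p = snd p))"
      using s Cons dsize_pos
      by (cases "fst p"; cases "snd p"; cases p; force simp: eq_step_def)+
    obtain n where n: "n \<le> (\<Sum>p\<leftarrow>w'. dsize (fst p))" "\<forall>i<n. fst ((eq_step ^^ i) (w', b')) \<noteq> []"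
      "(eq_step ^^ n) (w', b') = ([], b' \<and> (\<forall>p\<in>set w'. fst p = snd p))"
      "\<forall>i\<le>n. esize ((eq_step ^^ i) (w', b')) \<le> esize w' + 4"
      using less(1)[OF d, of b'] by blast
    have S: "(eq_step ^^ Suc i) (w, b) = (eq_step ^^ i) (w', b')" for i
      using s by (simp add: funpow_Suc_right del: funpow.simps)
    show ?thesis
    proof (intro exI[of _ "Suc n"] conjI allI impI)
      show "Suc n \<le> (\<Sum>p\<leftarrow>w. dsize (fst p))" using n(1) d by simp
      show "fst ((eq_step ^^ i) (w, b)) \<noteq> []" if "i < Suc n" for i
        using that n(2) S Cons by (cases i) (auto simp del: funpow.simps(2))
      show "(eq_step ^^ Suc n) (w, b) = ([], b \<and> (\<forall>p\<in>set w. fst p = snd p))"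
        using n(3) S q by simp
      show "esize ((eq_step ^^ i) (w, b)) \<le> esize w + 4" if "i \<le> Suc n" for i
      proof (cases i)
        case 0
        then show ?thesis by (auto simp: encode_bool_def)
      next
        case (Suc j)
        then show ?thesis using n(4)[rule_format, of j] that e unfolding Suc S by linarith
      qed
    qed
  qed
qed

lemma ptime_eq_data: "ptime (\<lambda>z::data \<times> data. fst z = snd z)"
proof -
  have "ptime (\<lambda>z::data \<times> data. ([] :: (data \<times> data) list, fst z = snd z))"
  proof (rule ptime_while[of "\<lambda>z. ([z], True)" "\<lambda>s. fst s \<noteq> []" eq_step "\<lambda>n. n + 8"])
    have leaf: "ptime f \<Longrightarrow> ptime (\<lambda>x. f x = Leaf)" for f :: "'e::tree_enc \<Rightarrow> data"
      by (rule ptime_comp[OF ptime_is_leaf])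
    show "ptime (\<lambda>z::data \<times> data. ([z], True))" by (intro ptime_intros)
    show "ptime (\<lambda>s::(data \<times> data) list \<times> bool. fst s \<noteq> [])" by (intro ptime_intros)
    show "ptime eq_step" unfolding eq_step_def by (intro ptime_intros leaf)
    show "poly_bd (\<lambda>n. n + 8)" by (intro poly_bd_intros)
    fix z :: "data \<times> data"
    obtain n where n: "n \<le> dsize (fst z)" "\<forall>i<n. fst ((eq_step ^^ i) ([z], True)) \<noteq> []"
      "(eq_step ^^ n) ([z], True) = ([], fst z = snd z)"
      "\<forall>i\<le>n. esize ((eq_step ^^ i) ([z], True)) \<le> esize [z] + 4"
      using eq_step_iter[of "[z]" True] by auto
    then show "\<exists>n\<le>esize z + 8. (\<forall>i<n. fst ((eq_step ^^ i) ([z], True)) \<noteq> []) \<and>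
        \<not> fst ((eq_step ^^ n) ([z], True)) \<noteq> [] \<and>
        (\<forall>i\<le>n. esize ((eq_step ^^ i) ([z], True)) \<le> esize z + 8) \<and>
        ([] :: (data \<times> data) list, fst z = snd z) = (eq_step ^^ n) ([z], True)"
      by (intro exI[of _ n]) (cases z, force)
  qed
  from ptime_snd[OF this] show ?thesis by simp
qed

lemma ptime_eq [ptime_intros]:
  fixes f g :: "'a::tree_enc \<Rightarrow> 'b::tree_enc"
  assumes "ptime f" "ptime g"
  shows "ptime (\<lambda>x. f x = g x)"
  using ptime_comp2[OF ptime_eq_data, of "\<lambda>x. encode (f x)" "\<lambda>x. encode (g x)"] assms
  by (simp add: ptime_encode encode_eq_iff)

lemma ptime_member [ptime_intros]:
  assumes "ptime f" "ptime l"
  shows "ptime (\<lambda>x. f x \<in> set (l x))"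
proof -
  have "ptime (\<lambda>x. \<exists>y\<in>set (l x). y = f x)"
    by (intro ptime_intros assms(2) ptime_comp[OF assms(1)])
  then show ?thesis by simp
qed

lemma ptime_remdups0: "ptime remdups"
proof -
  have "ptime (\<lambda>e::'a list. fold (\<lambda>x a. if x \<in> set a then a else x # a) (rev e) [])"
    by (rule ptime_fold[of _ _ _ "\<lambda>n. Suc n"]) (intro ptime_intros poly_bd_intros | simp)+
  moreover have "foldr (\<lambda>x a. if x \<in> set a then a else x # a) xs [] = remdups xs" for xs :: "'a list"
    by (induction xs) auto
  ultimately show ?thesis by (elim ptime_cong) (simp add: foldr_conv_fold)
qed
lemmas ptime_remdups [ptime_intros] = ptime_comp[OF ptime_remdups0]

lemma ptime_length0: "ptime (length :: 'a::tree_enc list \<Rightarrow> nat)"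
proof -
  have "ptime (\<lambda>e::'a list. fold (\<lambda>x a. Suc a) e 0)"
    by (rule ptime_fold[of _ _ _ "\<lambda>n. 2"]) (intro ptime_intros poly_bd_intros | simp)+
  moreover have "fold (\<lambda>x a. Suc a) xs b = length xs + b" for xs :: "'a list" and b
    by (induction xs arbitrary: b) auto
  ultimately show ?thesis by (elim ptime_cong) simp
qed
lemmas ptime_length [ptime_intros] = ptime_comp[OF ptime_length0]

lemma ptime_distinct [ptime_intros]:
  assumes "ptime f" shows "ptime (\<lambda>x. distinct (f x))"
proof -
  have "ptime (\<lambda>x. length (remdups (f x)) = length (f x))" by (intro ptime_intros assms)
  moreover have "length (remdups xs) = length xs \<longleftrightarrow> distinct xs" for xs :: "'b list"
    by (metis card_distinct distinct_card distinct_remdups length_remdups_card_conv)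
  ultimately show ?thesis by (elim ptime_cong) simp
qed

section \<open>Arithmetic on unary numbers\<close>

text \<open>A number is encoded like the list of that many leaves.\<close>

definition units :: "nat \<Rightarrow> data list" where "units n = replicate n Leaf"

lemma ptime_units0: "ptime units"
proof (rule ptime_cast_id)
  show "encode (units n) = encode n" for n by (induction n) (auto simp: units_def)
qed
lemmas ptime_units [ptime_intros] = ptime_comp[OF ptime_units0]

lemma esize_nat: "esize n = Suc (2 * n)"
  by (induction n) auto

lemma fold_units: "fold (\<lambda>_. g) (units n) a = (g ^^ n) a"
  by (induction n arbitrary: a) (auto simp: units_def funpow_swap1)

lemma ptime_add0: "ptime (\<lambda>z::nat \<times> nat. fst z + snd z)"
proof -
  have "ptime (\<lambda>z::nat \<times> nat. fold (\<lambda>_ a. Suc a) (units (fst z)) (snd z))"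
    by (rule ptime_fold[of _ _ _ "\<lambda>n. 2"]) (intro ptime_intros poly_bd_intros | simp)+
  moreover have "(Suc ^^ n) m = n + m" for n m by (induction n) auto
  ultimately show ?thesis by (elim ptime_cong) (simp add: fold_units)
qed
lemmas ptime_add [ptime_intros] = ptime_comp2[OF ptime_add0]

lemma ptime_mult0: "ptime (\<lambda>z::nat \<times> nat. fst z * snd z)"
proof -
  have "ptime (\<lambda>z::nat \<times> nat. fold (\<lambda>_ a. snd z + a) (units (fst z)) 0)"
    by (rule ptime_fold[of _ _ _ "\<lambda>n. n"]) (intro ptime_intros poly_bd_intros | clarsimp simp: esize_nat)+
  moreover have "((+) m ^^ n) 0 = n * m" for n m :: nat by (induction n) auto
  ultimately show ?thesis by (elim ptime_cong) (simp add: fold_units)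
qed
lemmas ptime_mult [ptime_intros] = ptime_comp2[OF ptime_mult0]

lemma ptime_minus0: "ptime (\<lambda>z::nat \<times> nat. fst z - snd z)"
proof -
  have "ptime (\<lambda>z::nat \<times> nat. fold (\<lambda>_ a. a - 1) (units (snd z)) (fst z))"
    by (rule ptime_fold[of _ _ _ "\<lambda>n. n"])
      (intro ptime_intros ptime_pred poly_bd_intros | simp add: esize_nat)+
  moreover have "((\<lambda>a. a - 1) ^^ n) m = m - n" for n m :: nat by (induction n) auto
  ultimately show ?thesis by (elim ptime_cong) (simp add: fold_units)
qed
lemmas ptime_minus [ptime_intros] = ptime_comp2[OF ptime_minus0]

lemma ptime_less [ptime_intros]:
  assumes "ptime f" "ptime g" shows "ptime (\<lambda>x. f x < (g x :: nat))"
proof -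
  have "ptime (\<lambda>x. g x - f x \<noteq> 0)" by (intro ptime_intros assms)
  then show ?thesis by (rule ptime_cong) auto
qed

lemma ptime_le [ptime_intros]:
  assumes "ptime f" "ptime g" shows "ptime (\<lambda>x. f x \<le> (g x :: nat))"
proof -
  have "ptime (\<lambda>x. \<not> g x < f x)" by (intro ptime_intros assms)
  then show ?thesis by (rule ptime_cong) auto
qed

text \<open>The number prepended in each step is as large as the accumulator is long, so
  \<open>ptime_fold\<close> does not apply, and a quadratic size bound is proved directly.\<close>

lemma ptime_upt0: "ptime (\<lambda>n. [0..<n])"
proof -
  have iter: "fold (\<lambda>_ a. length a # a) (units n) [] = rev [0..<n]" for n
    unfolding fold_units by (induction n) auto
  have sz: "esize (rev [0..<n]) \<le> Suc (n * Suc (Suc (2 * n)))" for n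
  proof (induction n)
    case (Suc n)
    have "n * Suc (Suc (2 * n)) \<le> n * Suc (Suc (2 * Suc n))" by simp
    with Suc show ?case by (simp add: esize_nat)
  qed simp
  have "ptime (\<lambda>n. fold (\<lambda>_ a. length a # a) (units n) [])"
  proof (rule ptime_fold_bd[of _ _ _ "\<lambda>n. Suc (n * Suc (Suc (2 * n)))"])
    show "poly_bd (\<lambda>n. Suc (n * Suc (Suc (2 * n))))" by (intro poly_bd_intros)
    fix n ys zs assume "units n = ys @ zs"
    then have eq: "ys @ zs = replicate n Leaf" by (simp add: units_def)
    have len: "length ys \<le> n" using arg_cong[OF eq, of length] by simp
    have "\<forall>y\<in>set ys. y = Leaf" using arg_cong[OF eq, of set] by (cases "n = 0") auto
    then have ys: "ys = units (length ys)" unfolding units_def by (rule replicate_length_same[symmetric])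
    have "esize (fold (\<lambda>_ a. length a # a) ys []) \<le> Suc (length ys * Suc (Suc (2 * length ys)))"
      using iter[of "length ys"] sz[of "length ys"] arg_cong[OF ys, of "\<lambda>u. fold (\<lambda>_ a. length a # a) u []"]
      by presburger
    also have "\<dots> \<le> Suc (esize n * Suc (Suc (2 * esize n)))"
      using len by (intro Suc_le_mono[THEN iffD2] mult_le_mono) (auto simp: esize_nat)
    finally show "esize (fold (\<lambda>_ a. length a # a) ys []) \<le> Suc (esize n * Suc (Suc (2 * esize n)))" .
  qed (intro ptime_intros)+
  then have "ptime (\<lambda>n. rev (fold (\<lambda>_ a. length a # a) (units n) []))" by (intro ptime_intros)
  then show ?thesis by (rule ptime_cong) (simp add: iter)
qed
lemmas ptime_upt [ptime_intros] = ptime_comp[OF ptime_upt0]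


lemma esize_tl: "esize (tl xs) \<le> esize xs" for xs :: "'a::tree_enc list"
  by (cases xs) auto

text \<open>Unlike \<open>!\<close>, this has a known value beyond the end of the list and can
  therefore be computed on every input.\<close>

definition nth_or :: "'a \<Rightarrow> 'a list \<Rightarrow> nat \<Rightarrow> 'a" where
  "nth_or c xs i = (case drop i xs of [] \<Rightarrow> c | x # _ \<Rightarrow> x)"

lemma nth_or_nth [simp]: "i < length xs \<Longrightarrow> nth_or c xs i = xs ! i"
  by (simp add: nth_or_def Cons_nth_drop_Suc[symmetric])

lemma funpow_tl: "(tl ^^ n) xs = drop n xs"
proof (induction n)
  case (Suc n)
  show ?case unfolding funpow.simps comp_apply Suc tl_drop drop_Suc ..
qed simp

lemma ptime_drop0: "ptime (\<lambda>z. drop (snd z) (fst z))"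
proof -
  have "ptime (\<lambda>z. fold (\<lambda>_ a. tl a) (units (snd z)) (fst z :: 'a list))"
    by (rule ptime_fold[of _ _ _ "\<lambda>n. n"])
      (intro ptime_intros poly_bd_intros | rule trans_le_add1[OF esize_tl])+
  then show ?thesis by (rule ptime_cong) (simp add: fold_units funpow_tl)
qed
lemmas ptime_drop = ptime_comp2[OF ptime_drop0]

lemma ptime_nth_or [ptime_intros]:
  assumes "ptime f" "ptime g"
  shows "ptime (\<lambda>x. nth_or c (f x) (g x))"
  unfolding nth_or_def
  by (rule ptime_case_list) (intro ptime_intros ptime_drop assms)+


section \<open>Evaluating circuits\<close>

text \<open>The numbers are those that \<open>enc_gate\<close> stores in the left subtree, so
  \<open>left_of\<close> computes them.\<close>

primrec tag :: "gate \<Rightarrow> nat" where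
  "tag InputG = 0"
| "tag (NotG j) = 1"
| "tag (AndG js) = 2"
| "tag (OrG js) = 3"

definition wf_gates :: "gate list \<Rightarrow> bool" where
  "wf_gates gs \<longleftrightarrow> (\<forall>i < length gs. distinct (preds (gs ! i)) \<and> (\<forall>j \<in> set (preds (gs ! i)). j < i)) \<and>
     (\<forall>g \<in> set gs. tag g \<ge> 2 \<longrightarrow> length (preds g) \<ge> 2)"

text \<open>The quantifier over all \<open>js\<close> is replaced by quantifiers over the elements
  of lists, which the closure rules of \<open>ptime\<close> can handle.\<close>

lemma circuit_wf_iff:
  "circuit_wf C \<longleftrightarrow> wf_gates (fst C) \<and> snd C < length (fst C) \<and> (\<forall>g \<in> set (fst C). snd C \<notin> set (preds g))"
proof -
  have "(\<forall>js. AndG js \<in> set gs \<or> OrG js \<in> set gs \<longrightarrow> length js \<ge> 2) \<longleftrightarrow>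
      (\<forall>g \<in> set gs. tag g \<ge> 2 \<longrightarrow> length (preds g) \<ge> 2)" for gs :: "gate list"
  proof (intro iffI ballI impI allI)
    fix g assume "\<forall>js. AndG js \<in> set gs \<or> OrG js \<in> set gs \<longrightarrow> length js \<ge> 2" "g \<in> set gs" "2 \<le> tag g"
    then show "2 \<le> length (preds g)" by (cases g) auto
  qed auto
  then show ?thesis by (cases C) (simp add: circuit_wf_def wf_gates_def)
qed

lemma length_node_vals: "length (node_vals gs S) = length gs"
  by (induction gs rule: rev_induct) (auto simp: node_vals_def)

lemma node_vals_snoc: "node_vals (gs @ [g]) S = node_vals gs S @ [gate_val g S (node_vals gs S)]"
  by (simp add: node_vals_def)

lemma node_vals_nth:
  "i < length gs \<Longrightarrow> node_vals gs S ! i = gate_val (gs ! i) S (take i (node_vals gs S))"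
proof (induction gs rule: rev_induct)
  case (snoc g gs)
  then show ?case
    by (cases "i < length gs") (auto simp: node_vals_snoc nth_append length_node_vals less_Suc_eq)
qed simp

text \<open>In-neighbours precede their gate, so the prefix of values on which a gate was evaluated
  agrees with the final values at all positions it reads.\<close>

lemma node_val_cases:
  fixes S :: "nat set"
  assumes "wf_gates gs" "i < length gs"
  defines "val \<equiv> \<lambda>i. node_vals gs S ! i"
  shows "gs ! i = InputG \<Longrightarrow> val i \<longleftrightarrow> i \<in> S"
    and "gs ! i = NotG j \<Longrightarrow> val i \<longleftrightarrow> \<not> val j"
    and "gs ! i = AndG js \<Longrightarrow> val i \<longleftrightarrow> (\<forall>j\<in>set js. val j)"
    and "gs ! i = OrG js \<Longrightarrow> val i \<longleftrightarrow> (\<exists>j\<in>set js. val j)"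
proof -
  have "\<forall>j\<in>set (preds (gs ! i)). j < i" using assms by (auto simp: wf_gates_def)
  then show "gs ! i = InputG \<Longrightarrow> val i \<longleftrightarrow> i \<in> S" "gs ! i = NotG j \<Longrightarrow> val i \<longleftrightarrow> \<not> val j"
    "gs ! i = AndG js \<Longrightarrow> val i \<longleftrightarrow> (\<forall>j\<in>set js. val j)"
    "gs ! i = OrG js \<Longrightarrow> val i \<longleftrightarrow> (\<exists>j\<in>set js. val j)"
    unfolding val_def node_vals_nth[OF assms(2)] using assms(2)
    by (auto simp: length_node_vals)
qed


section \<open>Deciding depth and weft\<close>

definition gate_at :: "gate list \<Rightarrow> nat \<Rightarrow> gate" where
  "gate_at gs i = nth_or InputG gs i"

lemma gate_at_nth: "i < length gs \<Longrightarrow> gate_at gs i = gs ! i"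
  by (simp add: gate_at_def)

text \<open>Instead of enumerating paths, the check descends from a node with two budgets:
  \<open>d\<close> edges and \<open>l\<close> large nodes. The recursion is on \<open>d\<close>, a
  constant of the problem, so the check is polynomial.\<close>

primrec chk :: "gate list \<Rightarrow> nat \<Rightarrow> nat \<Rightarrow> nat \<Rightarrow> bool" where
  "chk gs 0 l i \<longleftrightarrow> tag (gate_at gs i) = 0"
| "chk gs (Suc d) l i \<longleftrightarrow> tag (gate_at gs i) = 0 \<or>
     (if 2 < length (preds (gate_at gs i))
      then 0 < l \<and> (\<forall>j\<in>set (preds (gate_at gs i)). chk gs d (l - 1) j)
      else (\<forall>j\<in>set (preds (gate_at gs i)). chk gs d l j))"

definition in_path :: "gate list \<Rightarrow> nat \<Rightarrow> nat list \<Rightarrow> bool" where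
  "in_path gs i p \<longleftrightarrow> p \<noteq> [] \<and> set p \<subseteq> {..<length gs} \<and> gs ! hd p = InputG \<and> last p = i \<and>
     successively (\<lambda>u v. u \<in> set (preds (gs ! v))) p"

definition weft_count :: "gate list \<Rightarrow> nat list \<Rightarrow> nat" where
  "weft_count gs p = length (filter (\<lambda>v. 2 < length (preds (gs ! v))) p)"

lemma input_output_path_iff: "input_output_path C p \<longleftrightarrow> in_path (fst C) (snd C) p"
  by (cases p) (auto simp: input_output_path_def in_path_def inputs_def)

lemma in_path_input:
  "i < length gs \<Longrightarrow> gs ! i = InputG \<Longrightarrow> in_path gs i p \<longleftrightarrow> p = [i]"
proof
  assume i: "i < length gs" "gs ! i = InputG" and p: "in_path gs i p"
  then obtain q where q: "p = q @ [i]"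
    unfolding in_path_def by (metis append_butlast_last_id)
  have "q = []"
  proof (rule ccontr)
    assume "q \<noteq> []"
    then show False using p i(2) unfolding q in_path_def by (auto simp: successively_append_iff)
  qed
  then show "p = [i]" using q by simp
qed (auto simp: in_path_def)

lemma in_path_gate:
  assumes "i < length gs" "gs ! i \<noteq> InputG"
  shows "in_path gs i p \<longleftrightarrow> (\<exists>q. \<exists>j\<in>set (preds (gs ! i)). p = q @ [i] \<and> in_path gs j q)"
proof
  assume p: "in_path gs i p"
  then obtain q where q: "p = q @ [i]"
    unfolding in_path_def by (metis append_butlast_last_id)
  have ne: "q \<noteq> []" using p assms(2) unfolding q in_path_def by auto
  with p have "last q \<in> set (preds (gs ! i))" "in_path gs (last q) q"
    unfolding q in_path_def by (auto simp: successively_append_iff)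
  with q show "\<exists>q. \<exists>j\<in>set (preds (gs ! i)). p = q @ [i] \<and> in_path gs j q" by blast
next
  assume "\<exists>q. \<exists>j\<in>set (preds (gs ! i)). p = q @ [i] \<and> in_path gs j q"
  with assms(1) show "in_path gs i p" by (auto simp: in_path_def successively_append_iff)
qed

lemma preds_nonempty: "wf_gates gs \<Longrightarrow> i < length gs \<Longrightarrow> gs ! i \<noteq> InputG \<Longrightarrow> preds (gs ! i) \<noteq> []"
  by (cases "gs ! i") (auto simp: wf_gates_def all_set_conv_all_nth)

lemma preds_less: "wf_gates gs \<Longrightarrow> i < length gs \<Longrightarrow> j \<in> set (preds (gs ! i)) \<Longrightarrow> j < length gs"
  by (auto simp: wf_gates_def dest: less_trans)

text \<open>Every gate that is not an input has an in-neighbour with a smaller position, so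
  descending ends at an input. This keeps the conditions on all paths from holding vacuously where
  \<open>chk\<close> fails.\<close>

lemma ex_in_path: "wf_gates gs \<Longrightarrow> i < length gs \<Longrightarrow> \<exists>p. in_path gs i p"
proof (induction i rule: less_induct)
  case (less i)
  show ?case
  proof (cases "gs ! i = InputG")
    case True
    then show ?thesis using in_path_input less.prems by blast
  next
    case False
    then obtain j where j: "j \<in> set (preds (gs ! i))"
      using preds_nonempty less.prems by (meson last_in_set)
    then have "j < i" using less.prems by (auto simp: wf_gates_def)
    then have "\<exists>p. in_path gs j p" using less.IH[of j] less.prems by simp
    then show ?thesis using j in_path_gate[OF less.prems(2) False] by blast
  qed
qed

lemma tag_0_iff: "tag g = 0 \<longleftrightarrow> g = InputG"
  by (cases g) auto

lemma chk_iff: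
  assumes "wf_gates gs"
  shows "i < length gs \<Longrightarrow> chk gs d l i \<longleftrightarrow> (\<forall>p. in_path gs i p \<longrightarrow> length p - 1 \<le> d \<and> weft_count gs p \<le> l)"
proof (induction d arbitrary: l i)
  case 0
  show ?case
  proof (cases "gs ! i = InputG")
    case True
    then show ?thesis using 0 in_path_input[OF 0 True] by (simp add: gate_at_nth weft_count_def)
  next
    case False
    obtain p where p: "in_path gs i p" using ex_in_path assms 0 by blast
    then obtain q j where "p = q @ [i]" "in_path gs j q" using in_path_gate[OF 0 False] by blast
    then have "\<not> length p - 1 \<le> 0" by (auto simp: in_path_def)
    then show ?thesis using p False 0 by (auto simp: gate_at_nth tag_0_iff)
  qed
next
  case (Suc d)
  show ?case
  proof (cases "gs ! i = InputG")
    case True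
    then show ?thesis
      using in_path_input[OF Suc.prems True] Suc.prems by (simp add: gate_at_nth weft_count_def)
  next
    case False
    let ?P = "set (preds (gs ! i))" and ?big = "2 < length (preds (gs ! i))"
    have len: "in_path gs j q \<Longrightarrow> 0 < length q" for j q by (simp add: in_path_def)
    have "(\<forall>p. in_path gs i p \<longrightarrow> length p - 1 \<le> Suc d \<and> weft_count gs p \<le> l) \<longleftrightarrow>
        (\<forall>j\<in>?P. \<forall>q. in_path gs j q \<longrightarrow> length q - 1 \<le> d \<and> weft_count gs q + (if ?big then 1 else 0) \<le> l)"
      using len by (fastforce simp: in_path_gate[OF Suc.prems False] weft_count_def)
    also have "\<dots> \<longleftrightarrow> chk gs (Suc d) l i"
    proof (cases ?big)
      case True
      \<comment> \<open>Some path exists, and it has to leave room for the large node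
        \<open>i\<close>. This yields \<open>0 < l\<close>, which in turn makes the truncated
        \<open>l - 1\<close> a true predecessor.\<close>
      have *: "(\<forall>j\<in>?P. \<forall>q. in_path gs j q \<longrightarrow> length q - 1 \<le> d \<and> weft_count gs q + 1 \<le> l) \<longleftrightarrow>
          0 < l \<and> (\<forall>j\<in>?P. \<forall>q. in_path gs j q \<longrightarrow> length q - 1 \<le> d \<and> weft_count gs q \<le> l - 1)"
      proof
        assume L: "\<forall>j\<in>?P. \<forall>q. in_path gs j q \<longrightarrow> length q - 1 \<le> d \<and> weft_count gs q + 1 \<le> l"
        obtain j where "j \<in> ?P" using preds_nonempty[OF assms Suc.prems False] by (meson last_in_set)
        moreover obtain q where "in_path gs j q"
          using ex_in_path[OF assms preds_less[OF assms Suc.prems \<open>j \<in> ?P\<close>]] by blast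
        ultimately have "0 < l" using L by fastforce
        with L show "0 < l \<and> (\<forall>j\<in>?P. \<forall>q. in_path gs j q \<longrightarrow> length q - 1 \<le> d \<and> weft_count gs q \<le> l - 1)"
          by fastforce
      qed fastforce
      have ch: "(\<forall>j\<in>?P. chk gs d (l - 1) j) \<longleftrightarrow>
          (\<forall>j\<in>?P. \<forall>q. in_path gs j q \<longrightarrow> length q - 1 \<le> d \<and> weft_count gs q \<le> l - 1)"
        using Suc.IH preds_less[OF assms Suc.prems] by simp
      show ?thesis
        unfolding chk.simps gate_at_nth[OF Suc.prems] tag_0_iff ch using True False * by simp
    next
      case nb: False
      have ch: "(\<forall>j\<in>?P. chk gs d l j) \<longleftrightarrow>
          (\<forall>j\<in>?P. \<forall>q. in_path gs j q \<longrightarrow> length q - 1 \<le> d \<and> weft_count gs q \<le> l)"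
        using Suc.IH preds_less[OF assms Suc.prems] by simp
      show ?thesis
        unfolding chk.simps gate_at_nth[OF Suc.prems] tag_0_iff ch using nb False by simp
    qed
    finally show ?thesis ..
  qed
qed

lemma chk_circuit:
  assumes "circuit_wf C"
  shows "chk (fst C) d l (snd C) \<longleftrightarrow> weft_at_most l C \<and> depth_at_most d C"
  using assms chk_iff[of "fst C" "snd C" d l]
  by (auto simp: circuit_wf_iff weft_at_most_def depth_at_most_def input_output_path_iff weft_count_def)


section \<open>Many-valued clauses\<close>

text \<open>An atom \<open>(v, c)\<close> states that the variable \<open>v\<close> has the value \<open>c\<close>; both are trees. A clause is a
  disjunction of atoms.\<close>

type_synonym atom = "data \<times> data"

definition sat_clause :: "(data \<Rightarrow> data) \<Rightarrow> atom list \<Rightarrow> bool" where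
  "sat_clause f D \<longleftrightarrow> (\<exists>p\<in>set D. f (fst p) = snd p)"

definition sat_cnf :: "(data \<Rightarrow> data) \<Rightarrow> atom list list \<Rightarrow> bool" where
  "sat_cnf f X \<longleftrightarrow> (\<forall>D\<in>set X. sat_clause f D)"

definition sat_dcnf :: "(data \<Rightarrow> data) \<Rightarrow> atom list list list \<Rightarrow> bool" where
  "sat_dcnf f Y \<longleftrightarrow> (\<exists>X\<in>set Y. sat_cnf f X)"

definition pair_up :: "data list \<Rightarrow> data list" where
  "pair_up X = concat (map (\<lambda>v. map (\<lambda>w. Node v w) X) X)"

text \<open>Pairs over \<open>X\<close> of nesting depth at most \<open>j\<close>. The closure is
  used for variables and for values alike, since the variable \<open>Node v w\<close> is meant to
  hold the pair of the values of \<open>v\<close> and \<open>w\<close>.\<close>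

primrec lvl :: "nat \<Rightarrow> data list \<Rightarrow> data list" where
  "lvl 0 X = X"
| "lvl (Suc j) X = lvl j X @ pair_up (lvl j X)"

lemma set_lvl_Suc:
  "set (lvl (Suc j) X) = set (lvl j X) \<union> {Node v w | v w. v \<in> set (lvl j X) \<and> w \<in> set (lvl j X)}"
  by (auto simp: pair_up_def)

lemma lvl_mono: "j \<le> k \<Longrightarrow> set (lvl j X) \<subseteq> set (lvl k X)"
  by (induction k rule: dec_induct) auto

declare lvl.simps(2) [simp del]

text \<open>The conjunction of two disjunctions is the disjunction of all conjunctions of an atom of
  one with an atom of the other, and each such conjunction is a single atom about a pair
  variable.\<close>

definition clause_prod :: "atom list \<Rightarrow> atom list \<Rightarrow> atom list" where
  "clause_prod D E = concat (map (\<lambda>p. map (\<lambda>q. (Node (fst p) (fst q), Node (snd p) (snd q))) E) D)"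

text \<open>The distributive law, for two readings: on lists of clauses it forms the disjunction of
  two conjunctions, on lists of conjunctions of clauses the conjunction of two disjunctions.\<close>

definition cross_append :: "'a list list \<Rightarrow> 'a list list \<Rightarrow> 'a list list" where
  "cross_append X Y = concat (map (\<lambda>A. map (\<lambda>B. A @ B) Y) X)"

lemma sat_clause_append: "sat_clause f (D @ E) \<longleftrightarrow> sat_clause f D \<or> sat_clause f E"
  by (auto simp: sat_clause_def)

lemma sat_clause_concat: "sat_clause f (concat Ds) \<longleftrightarrow> (\<exists>D\<in>set Ds. sat_clause f D)"
  by (auto simp: sat_clause_def)

lemma sat_clause_prod:
  assumes "\<And>v w. v \<in> fst ` set D \<Longrightarrow> w \<in> fst ` set E \<Longrightarrow> f (Node v w) = Node (f v) (f w)"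
  shows "sat_clause f (clause_prod D E) \<longleftrightarrow> sat_clause f D \<and> sat_clause f E"
  using assms by (force simp: sat_clause_def clause_prod_def)

lemma sat_cnf_append: "sat_cnf f (X @ Y) \<longleftrightarrow> sat_cnf f X \<and> sat_cnf f Y"
  by (auto simp: sat_cnf_def)

lemma sat_cnf_concat: "sat_cnf f (concat Xs) \<longleftrightarrow> (\<forall>X\<in>set Xs. sat_cnf f X)"
  by (auto simp: sat_cnf_def)

lemma sat_cnf_cross: "sat_cnf f (cross_append X Y) \<longleftrightarrow> sat_cnf f X \<or> sat_cnf f Y"
  by (auto simp: sat_cnf_def cross_append_def sat_clause_append)

lemma sat_dcnf_append: "sat_dcnf f (X @ Y) \<longleftrightarrow> sat_dcnf f X \<or> sat_dcnf f Y"
  by (auto simp: sat_dcnf_def)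

lemma sat_dcnf_cross: "sat_dcnf f (cross_append X Y) \<longleftrightarrow> sat_dcnf f X \<and> sat_dcnf f Y"
  by (auto simp: sat_dcnf_def cross_append_def sat_cnf_append)


section \<open>From circuits to many-valued clauses\<close>

definition var :: "nat \<Rightarrow> data" where "var i = Node Leaf (encode i)"

text \<open>A set of \<open>k\<close> input nodes is described by the increasing sequence of its elements, shifted by one and
  enclosed by the sentinels \<open>0\<close> and \<open>N + 1\<close>: the variables \<open>var 0, \<dots>, var (k + 1)\<close> hold these
  numbers, which come from the list \<open>U\<close>. A node is absent from the set iff it lies strictly inside a gap
  of the sequence. This makes absence a disjunction of atoms over pairs of variables.\<close>

definition lit :: "nat \<Rightarrow> nat list \<Rightarrow> bool \<Rightarrow> nat \<Rightarrow> atom list" where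
  "lit k U b x =
     (if b then map (\<lambda>i. (var i, encode (Suc x))) [0..<k + 2]
      else concat (map (\<lambda>i. concat (map (\<lambda>a. map (\<lambda>c. (Node (var i) (var (Suc i)), Node (encode a) (encode c)))
        (filter (\<lambda>c. a < Suc x \<and> Suc x < c) U)) U)) [0..<Suc k]))"

text \<open>\<open>rep0\<close>, \<open>rep1\<close> and \<open>rep2\<close> express that a node has the value \<open>b\<close> by a clause, by a conjunction of
  clauses and by a disjunction of those, when no, one and two large nodes occur on every path
  below it.\<close>

type_synonym ctx = "nat \<times> nat list \<times> gate list"

abbreviation ctx_lit :: "ctx \<Rightarrow> bool \<Rightarrow> nat \<Rightarrow> atom list" where
  "ctx_lit c b i \<equiv> lit (fst c) (fst (snd c)) b i"

abbreviation ctx_gate :: "ctx \<Rightarrow> nat \<Rightarrow> gate" where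
  "ctx_gate c i \<equiv> gate_at (snd (snd c)) i"

abbreviation pred0 :: "gate \<Rightarrow> nat" where "pred0 g \<equiv> nth_or 0 (preds g) 0"
abbreviation pred1 :: "gate \<Rightarrow> nat" where "pred1 g \<equiv> nth_or 0 (preds g) 1"

text \<open>Negation only flips the wanted value \<open>b\<close>. By De Morgan,
  \<open>(tag g = 2) = b\<close> singles out the conjunctive cases: AND wanted true and OR wanted
  false. Where no large node is allowed, AND and OR gates have exactly the in-neighbours
  \<open>pred0\<close> and \<open>pred1\<close>.\<close>

primrec rep0 :: "nat \<Rightarrow> ctx \<Rightarrow> bool \<Rightarrow> nat \<Rightarrow> atom list" where
  "rep0 0 c b i = ctx_lit c b i"
| "rep0 (Suc d) c b i =
     (if tag (ctx_gate c i) = 0 then ctx_lit c b i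
      else if tag (ctx_gate c i) = 1 then rep0 d c (\<not> b) (pred0 (ctx_gate c i))
      else if (tag (ctx_gate c i) = 2) = b
      then clause_prod (rep0 d c b (pred0 (ctx_gate c i))) (rep0 d c b (pred1 (ctx_gate c i)))
      else rep0 d c b (pred0 (ctx_gate c i)) @ rep0 d c b (pred1 (ctx_gate c i)))"

primrec rep1 :: "nat \<Rightarrow> ctx \<Rightarrow> bool \<Rightarrow> nat \<Rightarrow> atom list list" where
  "rep1 0 c b i = [ctx_lit c b i]"
| "rep1 (Suc d) c b i =
     (if tag (ctx_gate c i) = 0 then [ctx_lit c b i]
      else if tag (ctx_gate c i) = 1 then rep1 d c (\<not> b) (pred0 (ctx_gate c i))
      else if length (preds (ctx_gate c i)) = 2 then
        (if (tag (ctx_gate c i) = 2) = b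
         then rep1 d c b (pred0 (ctx_gate c i)) @ rep1 d c b (pred1 (ctx_gate c i))
         else cross_append (rep1 d c b (pred0 (ctx_gate c i))) (rep1 d c b (pred1 (ctx_gate c i))))
      else if (tag (ctx_gate c i) = 2) = b then map (\<lambda>j. rep0 d c b j) (preds (ctx_gate c i))
      else [concat (map (\<lambda>j. rep0 d c b j) (preds (ctx_gate c i)))])"

primrec rep2 :: "nat \<Rightarrow> ctx \<Rightarrow> bool \<Rightarrow> nat \<Rightarrow> atom list list list" where
  "rep2 0 c b i = [[ctx_lit c b i]]"
| "rep2 (Suc d) c b i =
     (if tag (ctx_gate c i) = 0 then [[ctx_lit c b i]]
      else if tag (ctx_gate c i) = 1 then rep2 d c (\<not> b) (pred0 (ctx_gate c i))
      else if length (preds (ctx_gate c i)) = 2 then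
        (if (tag (ctx_gate c i) = 2) = b
         then cross_append (rep2 d c b (pred0 (ctx_gate c i))) (rep2 d c b (pred1 (ctx_gate c i)))
         else rep2 d c b (pred0 (ctx_gate c i)) @ rep2 d c b (pred1 (ctx_gate c i)))
      else if (tag (ctx_gate c i) = 2) = b then [concat (map (\<lambda>j. rep1 d c b j) (preds (ctx_gate c i)))]
      else map (\<lambda>j. rep1 d c b j) (preds (ctx_gate c i)))"

definition base_vars :: "nat \<Rightarrow> data list" where
  "base_vars k = map var [0..<k + 2]"

lemma lit_vars: "fst ` set (lit k U b x) \<subseteq> set (lvl (Suc 0) (base_vars k))"
proof -
  have "var i \<in> set (base_vars k)" if "i < k + 2" for i
    using that by (auto simp: base_vars_def simp del: upt_Suc)
  then show ?thesis by (auto simp: lit_def set_lvl_Suc simp del: upt_Suc)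
qed

text \<open>Absence literals already use pairs, which is level 1, and every level of gates adds at
  most one further pairing.\<close>

lemma rep0_vars: "fst ` set (rep0 d (k, U, gs) b i) \<subseteq> set (lvl (Suc d) (base_vars k))"
proof (induction d arbitrary: b i)
  case 0
  then show ?case using lit_vars by simp
next
  case (Suc d)
  have up: "set (lvl (Suc d) (base_vars k)) \<subseteq> set (lvl (Suc (Suc d)) (base_vars k))"
    by (rule lvl_mono) simp
  have l: "fst ` set (lit k U b i) \<subseteq> set (lvl (Suc (Suc d)) (base_vars k))"
    by (rule order.trans[OF lit_vars lvl_mono]) simp
  have p: "fst ` set (clause_prod (rep0 d (k, U, gs) b x) (rep0 d (k, U, gs) b y)) \<subseteq>
      set (lvl (Suc (Suc d)) (base_vars k))" for x y
    using Suc[of b x] Suc[of b y] unfolding set_lvl_Suc[of "Suc d"] by (fastforce simp: clause_prod_def)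
  have IH: "fst ` set (rep0 d (k, U, gs) b x) \<subseteq> set (lvl (Suc (Suc d)) (base_vars k))" for b x
    using Suc[of b x] up by blast
  show ?case using l p IH by (simp add: image_Un)
qed

text \<open>This set does not depend on the circuit. Its size is what finally bounds the deletion
  distance in terms of \<open>d\<close> and \<open>k\<close>.\<close>

definition small_vars :: "nat \<Rightarrow> nat \<Rightarrow> data set" where
  "small_vars d k = set (lvl (Suc d) (base_vars k))"

lemma small_vars_mono: "d \<le> e \<Longrightarrow> small_vars d k \<subseteq> small_vars e k"
  unfolding small_vars_def by (rule lvl_mono) simp

lemma lit_small_vars: "fst ` set (lit k U b i) \<subseteq> small_vars d k"
  unfolding small_vars_def by (rule order.trans[OF lit_vars lvl_mono]) simp

lemma rep1_vars: "D \<in> set (rep1 d (k, U, gs) b i) \<Longrightarrow> fst ` set D \<subseteq> small_vars d k"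
proof (induction d arbitrary: D b i)
  case 0
  then show ?case using lit_small_vars by simp
next
  case (Suc d)
  have up: "small_vars d k \<subseteq> small_vars (Suc d) k" by (rule small_vars_mono) simp
  note l = lit_small_vars[of k U _ _ "Suc d"]
  have r0: "fst ` set (rep0 d (k, U, gs) b i) \<subseteq> small_vars (Suc d) k" for b i
    by (rule order.trans[OF rep0_vars[folded small_vars_def] up])
  have IH: "D \<in> set (rep1 d (k, U, gs) b i) \<Longrightarrow> fst ` set D \<subseteq> small_vars (Suc d) k" for D b i
    using Suc.IH up by blast
  have a: "D \<in> set (cross_append (rep1 d (k, U, gs) b x) (rep1 d (k, U, gs) b y)) \<Longrightarrow>
      fst ` set D \<subseteq> small_vars (Suc d) k" for x y
    using IH[of _ b x] IH[of _ b y] by (force simp: cross_append_def image_Un)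
  have c: "fst ` set (concat (map (\<lambda>j. rep0 d (k, U, gs) b j) js)) \<subseteq> small_vars (Suc d) k" for js
    using r0 by (simp add: image_UN UN_subset_iff)
  \<comment> \<open>All branches of the recursion produce one of five shapes, and each shape is
    covered by one of the facts above.\<close>
  have "D = lit k U b i \<or> (\<exists>b' x. D \<in> set (rep1 d (k, U, gs) b' x)) \<or>
      (\<exists>x y. D \<in> set (cross_append (rep1 d (k, U, gs) b x) (rep1 d (k, U, gs) b y))) \<or>
      (\<exists>j. D = rep0 d (k, U, gs) b j) \<or> (\<exists>js. D = concat (map (\<lambda>j. rep0 d (k, U, gs) b j) js))"
    using Suc.prems unfolding rep1.simps fst_conv snd_conv
    by (simp del: set_concat split: if_split_asm) blast+
  then show ?case using l r0 IH a c by (elim disjE exE) simp_all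
qed

lemma rep2_vars:
  "X \<in> set (rep2 d (k, U, gs) b i) \<Longrightarrow> D \<in> set X \<Longrightarrow> fst ` set D \<subseteq> small_vars d k"
proof (induction d arbitrary: X D b i)
  case 0
  then show ?case using lit_small_vars by simp
next
  case (Suc d)
  have up: "small_vars d k \<subseteq> small_vars (Suc d) k" by (rule small_vars_mono) simp
  note l = lit_small_vars[of k U _ _ "Suc d"]
  have r1: "D \<in> set (rep1 d (k, U, gs) b i) \<Longrightarrow> fst ` set D \<subseteq> small_vars (Suc d) k" for D b i
    using rep1_vars up by blast
  have IH: "X \<in> set (rep2 d (k, U, gs) b i) \<Longrightarrow> D \<in> set X \<Longrightarrow> fst ` set D \<subseteq> small_vars (Suc d) k" for X D b i
    using Suc.IH up by blast
  have a: "X \<in> set (cross_append (rep2 d (k, U, gs) b x) (rep2 d (k, U, gs) b y)) \<Longrightarrow> D \<in> set X \<Longrightarrow>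
      fst ` set D \<subseteq> small_vars (Suc d) k" for x y
    using IH[of _ b x] IH[of _ b y] by (force simp: cross_append_def)
  have c: "fst ` set D \<subseteq> small_vars (Suc d) k"
    if D: "D \<in> set (concat (map (\<lambda>j. rep1 d (k, U, gs) b j) js))" for D js
  proof -
    from D obtain j where "D \<in> set (rep1 d (k, U, gs) b j)" by auto
    then show ?thesis by (rule r1)
  qed
  have "X = [lit k U b i] \<or> (\<exists>b' x. X \<in> set (rep2 d (k, U, gs) b' x)) \<or>
      (\<exists>x y. X \<in> set (cross_append (rep2 d (k, U, gs) b x) (rep2 d (k, U, gs) b y))) \<or>
      (\<exists>j. X = rep1 d (k, U, gs) b j) \<or> (\<exists>js. X = concat (map (\<lambda>j. rep1 d (k, U, gs) b j) js))"
    using Suc.prems(1) unfolding rep2.simps fst_conv snd_conv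
    by (simp del: set_concat split: if_split_asm) blast+
  then show ?case using Suc.prems(2) l r1 IH a c by (elim disjE exE) (simp_all del: set_concat)
qed

lemma length_2_set: "length xs = 2 \<Longrightarrow> set xs = {nth_or a xs 0, nth_or a xs 1}"
  by (auto simp: numeral_2_eq_2 length_Suc_conv nth_or_def)

text \<open>Both directions of the equivalence evaluate the representations: soundness under an
  arbitrary satisfying assignment, completeness under a constructed one. The locale isolates what
  both provide: pairs are respected up to level \<open>d0\<close>, and literals are correct.\<close>

locale circuit_reps =
  fixes gs :: "gate list" and S :: "nat set" and f :: "data \<Rightarrow> data" and k :: nat and U :: "nat list" and d0 :: nat
  assumes wf: "wf_gates gs"
    and hom: "\<And>v w. v \<in> set (lvl d0 (base_vars k)) \<Longrightarrow> w \<in> set (lvl d0 (base_vars k)) \<Longrightarrow> f (Node v w) = Node (f v) (f w)"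
    and lit: "\<And>x b. x < length gs \<Longrightarrow> gs ! x = InputG \<Longrightarrow> sat_clause f (lit k U b x) \<longleftrightarrow> (x \<in> S) = b"
begin

abbreviation "c \<equiv> (k, U, gs)"
abbreviation "val i \<equiv> node_vals gs S ! i"

lemma lit_val: "i < length gs \<Longrightarrow> gs ! i = InputG \<Longrightarrow> sat_clause f (lit k U b i) \<longleftrightarrow> val i = b"
  using lit node_val_cases(1)[OF wf] by simp

lemma not_val: "i < length gs \<Longrightarrow> gs ! i = NotG j \<Longrightarrow> j < length gs \<and> (val i = b \<longleftrightarrow> val j = (\<not> b))"
  using node_val_cases(2)[OF wf] preds_less[OF wf] by fastforce

lemma and_or_val:
  assumes "i < length gs" "2 \<le> tag (gs ! i)"
  shows "val i = b \<longleftrightarrow> (if (tag (gs ! i) = 2) = b then \<forall>j\<in>set (preds (gs ! i)). val j = b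
    else \<exists>j\<in>set (preds (gs ! i)). val j = b)"
  using assms node_val_cases(3,4)[OF wf assms(1)] by (cases "gs ! i"; cases b) auto

lemma pred_vals:
  assumes "i < length gs" "length (preds (gs ! i)) = 2"
  shows "set (preds (gs ! i)) = {pred0 (gs ! i), pred1 (gs ! i)}"
    "pred0 (gs ! i) < length gs" "pred1 (gs ! i) < length gs"
  using length_2_set[OF assms(2), of 0] preds_less[OF wf assms(1)] by auto

lemma tag_cases:
  assumes "i < length gs"
  obtains "tag (gs ! i) = 0" "gs ! i = InputG" | j where "tag (gs ! i) = 1" "gs ! i = NotG j" "pred0 (gs ! i) = j"
  | "2 \<le> tag (gs ! i)" "length (preds (gs ! i)) = 2" | "2 \<le> tag (gs ! i)" "2 < length (preds (gs ! i))"
proof (cases "2 \<le> tag (gs ! i)")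
  case True
  then have "2 \<le> length (preds (gs ! i))" using wf assms by (auto simp: wf_gates_def)
  with True that show ?thesis by fastforce
next
  case False
  with that show ?thesis by (cases "gs ! i") (auto simp: nth_or_def)
qed

lemma rep0_val:
  "i < length gs \<Longrightarrow> chk gs d 0 i \<Longrightarrow> d \<le> d0 \<Longrightarrow> sat_clause f (rep0 d c b i) \<longleftrightarrow> val i = b"
proof (induction d arbitrary: b i)
  case 0
  then show ?case using lit_val by (simp add: gate_at_nth tag_0_iff)
next
  case (Suc d)
  note g = gate_at_nth[OF Suc.prems(1)]
  from Suc.prems(1) show ?case
  proof (cases rule: tag_cases)
    case 1
    then show ?thesis using lit_val Suc.prems by (simp add: g)
  next
    case (2 j)
    then have "chk gs d 0 j" using Suc.prems by (simp add: g)
    then show ?thesis using 2 Suc not_val[OF Suc.prems(1) 2(2)] by (simp add: g)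
  next
    case 3
    let ?x = "pred0 (gs ! i)" and ?y = "pred1 (gs ! i)"
    note pv = pred_vals[OF Suc.prems(1) 3(2)]
    have "chk gs d 0 ?x" "chk gs d 0 ?y" using Suc.prems(2) 3 pv(1) by (auto simp: g)
    then have IH: "sat_clause f (rep0 d c b ?x) \<longleftrightarrow> val ?x = b" "sat_clause f (rep0 d c b ?y) \<longleftrightarrow> val ?y = b"
      using Suc pv by auto
    \<comment> \<open>The two factors use variables of level at most \<open>Suc d\<close>, where
      \<open>hom\<close> is still available.\<close>
    have "set (lvl (Suc d) (base_vars k)) \<subseteq> set (lvl d0 (base_vars k))"
      using Suc.prems(3) by (intro lvl_mono)
    then have "sat_clause f (clause_prod (rep0 d c b ?x) (rep0 d c b ?y)) \<longleftrightarrow>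
        sat_clause f (rep0 d c b ?x) \<and> sat_clause f (rep0 d c b ?y)"
      using rep0_vars[of d k U gs b ?x] rep0_vars[of d k U gs b ?y] by (intro sat_clause_prod hom) blast+
    then show ?thesis
      using 3 and_or_val[OF Suc.prems(1) 3(1), of b] IH pv(1) by (auto simp: g sat_clause_append)
  next
    case 4
    \<comment> \<open>A large node contradicts the weft budget 0.\<close>
    then show ?thesis using Suc.prems(2) by (auto simp: g)
  qed
qed

lemma rep1_val:
  "i < length gs \<Longrightarrow> chk gs d (Suc 0) i \<Longrightarrow> d \<le> d0 \<Longrightarrow> sat_cnf f (rep1 d c b i) \<longleftrightarrow> val i = b"
proof (induction d arbitrary: b i)
  case 0
  then show ?case using lit_val by (simp add: gate_at_nth tag_0_iff sat_cnf_def)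
next
  case (Suc d)
  note g = gate_at_nth[OF Suc.prems(1)]
  from Suc.prems(1) show ?case
  proof (cases rule: tag_cases)
    case 1
    then show ?thesis using lit_val Suc.prems by (simp add: g sat_cnf_def)
  next
    case (2 j)
    then have "chk gs d (Suc 0) j" using Suc.prems by (simp add: g)
    then show ?thesis using 2 Suc not_val[OF Suc.prems(1) 2(2)] by (simp add: g)
  next
    case 3
    let ?x = "pred0 (gs ! i)" and ?y = "pred1 (gs ! i)"
    note pv = pred_vals[OF Suc.prems(1) 3(2)]
    have "chk gs d (Suc 0) ?x" "chk gs d (Suc 0) ?y" using Suc.prems(2) 3 pv(1) by (auto simp: g)
    then have IH: "sat_cnf f (rep1 d c b ?x) \<longleftrightarrow> val ?x = b" "sat_cnf f (rep1 d c b ?y) \<longleftrightarrow> val ?y = b"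
      using Suc pv by auto
    then show ?thesis
      using 3 and_or_val[OF Suc.prems(1) 3(1), of b] IH pv(1) by (auto simp: g sat_cnf_append sat_cnf_cross)
  next
    case 4
    \<comment> \<open>The large node uses up the weft budget, so a single clause suffices for each
      of its in-neighbours.\<close>
    have "j < length gs \<and> chk gs d 0 j" if "j \<in> set (preds (gs ! i))" for j
      using that Suc.prems 4 preds_less[OF wf Suc.prems(1)] by (auto simp: g)
    then have IH: "sat_clause f (rep0 d c b j) \<longleftrightarrow> val j = b" if "j \<in> set (preds (gs ! i))" for j
      using that rep0_val Suc.prems(3) by simp
    then have "(\<forall>j\<in>set (preds (gs ! i)). sat_clause f (rep0 d c b j)) \<longleftrightarrow> (\<forall>j\<in>set (preds (gs ! i)). val j = b)"
      "(\<exists>j\<in>set (preds (gs ! i)). sat_clause f (rep0 d c b j)) \<longleftrightarrow> (\<exists>j\<in>set (preds (gs ! i)). val j = b)"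
      by auto
    then show ?thesis
      using 4 and_or_val[OF Suc.prems(1) 4(1), of b] by (simp add: g sat_cnf_def sat_clause_concat)
  qed
qed

lemma rep2_val:
  "i < length gs \<Longrightarrow> chk gs d 2 i \<Longrightarrow> d \<le> d0 \<Longrightarrow> sat_dcnf f (rep2 d c b i) \<longleftrightarrow> val i = b"
proof (induction d arbitrary: b i)
  case 0
  then show ?case using lit_val by (simp add: gate_at_nth tag_0_iff sat_cnf_def sat_dcnf_def)
next
  case (Suc d)
  note g = gate_at_nth[OF Suc.prems(1)]
  from Suc.prems(1) show ?case
  proof (cases rule: tag_cases)
    case 1
    then show ?thesis using lit_val Suc.prems by (simp add: g sat_cnf_def sat_dcnf_def)
  next
    case (2 j)
    then have "chk gs d 2 j" using Suc.prems by (simp add: g)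
    then show ?thesis using 2 Suc not_val[OF Suc.prems(1) 2(2)] by (simp add: g)
  next
    case 3
    let ?x = "pred0 (gs ! i)" and ?y = "pred1 (gs ! i)"
    note pv = pred_vals[OF Suc.prems(1) 3(2)]
    have "chk gs d 2 ?x" "chk gs d 2 ?y" using Suc.prems(2) 3 pv(1) by (auto simp: g)
    then have IH: "sat_dcnf f (rep2 d c b ?x) \<longleftrightarrow> val ?x = b" "sat_dcnf f (rep2 d c b ?y) \<longleftrightarrow> val ?y = b"
      using Suc pv by auto
    then show ?thesis
      using 3 and_or_val[OF Suc.prems(1) 3(1), of b] IH pv(1) by (auto simp: g sat_dcnf_append sat_dcnf_cross)
  next
    case 4
    have "j < length gs \<and> chk gs d (Suc 0) j" if "j \<in> set (preds (gs ! i))" for j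
      using that Suc.prems 4 preds_less[OF wf Suc.prems(1)] by (auto simp: g)
    then have IH: "sat_cnf f (rep1 d c b j) \<longleftrightarrow> val j = b" if "j \<in> set (preds (gs ! i))" for j
      using that rep1_val Suc.prems(3) by simp
    then have "(\<forall>j\<in>set (preds (gs ! i)). sat_cnf f (rep1 d c b j)) \<longleftrightarrow> (\<forall>j\<in>set (preds (gs ! i)). val j = b)"
      "(\<exists>j\<in>set (preds (gs ! i)). sat_cnf f (rep1 d c b j)) \<longleftrightarrow> (\<exists>j\<in>set (preds (gs ! i)). val j = b)"
      by auto
    then show ?thesis
      using 4 and_or_val[OF Suc.prems(1) 4(1), of b] by (simp add: g sat_dcnf_def sat_cnf_concat)
  qed
qed

end


section \<open>The clause system of a circuit\<close>

definition base_vals :: "gate list \<Rightarrow> nat list" where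
  "base_vals gs = 0 # Suc (length gs) # map Suc (filter (\<lambda>i. tag (gate_at gs i) = 0) [0..<length gs])"

definition dom_clauses :: "nat \<Rightarrow> nat list \<Rightarrow> atom list list" where
  "dom_clauses k U = map (\<lambda>i. map (\<lambda>a. (var i, encode a)) U) [0..<k + 2]"

definition end_clauses :: "nat \<Rightarrow> nat \<Rightarrow> atom list list" where
  "end_clauses k N = [[(var 0, encode (0::nat))], [(var (Suc k), encode (Suc N))]]"

text \<open>A clause cannot compare two variables, so the comparison is made by listing the
  admissible values of their pair. Strictness makes the members distinct, which gives a set of
  exactly \<open>k\<close> inputs.\<close>

definition ord_clauses :: "nat \<Rightarrow> nat list \<Rightarrow> atom list list" where
  "ord_clauses k U = map (\<lambda>i. concat (map (\<lambda>a. map (\<lambda>c. (Node (var i) (var (Suc i)), Node (encode a) (encode c)))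
     (filter (\<lambda>c. a < c) U)) U)) [0..<Suc k]"

text \<open>These clauses force the variable \<open>Node v w\<close> to hold the pair of the values of \<open>v\<close> and \<open>w\<close>.\<close>

definition hom_clauses :: "data list \<Rightarrow> data list \<Rightarrow> atom list list" where
  "hom_clauses V X = concat (map (\<lambda>v. concat (map (\<lambda>w. concat (map (\<lambda>a.
     [map (\<lambda>u. (Node v w, Node a u)) X @ map (\<lambda>u. (v, u)) (filter (\<lambda>u. u \<noteq> a) X),
      map (\<lambda>u. (Node v w, Node u a)) X @ map (\<lambda>u. (w, u)) (filter (\<lambda>u. u \<noteq> a) X)]) X)) V)) V)"

text \<open>The variable \<open>Leaf\<close> selects the disjunct that is to be satisfied.\<close>

definition guess_clauses :: "atom list list list \<Rightarrow> atom list list" where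
  "guess_clauses R = map (\<lambda>q. (Leaf, encode q)) [0..<length R] #
     concat (map (\<lambda>q. map (\<lambda>D. D @ map (\<lambda>q'. (Leaf, encode q')) (filter (\<lambda>q'. q' \<noteq> q) [0..<length R]))
       (nth_or [] R q)) [0..<length R])"

text \<open>The pairing clauses over level \<open>d\<close> govern the pair variables up to level
  \<open>Suc d\<close>, which is the range that \<open>rep2 d\<close> draws its variables
  from.\<close>

definition clauses :: "nat \<Rightarrow> gate list \<Rightarrow> nat \<Rightarrow> nat \<Rightarrow> atom list list" where
  "clauses d gs out k =
     dom_clauses k (base_vals gs) @ end_clauses k (length gs) @ ord_clauses k (base_vals gs) @
     hom_clauses (lvl d (base_vars k)) (lvl d (map encode (base_vals gs))) @
     guess_clauses (rep2 d (k, base_vals gs, gs) True out)"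

lemma sat_clause_map: "sat_clause f (map h xs) \<longleftrightarrow> (\<exists>x\<in>set xs. f (fst (h x)) = snd (h x))"
  by (auto simp: sat_clause_def)

lemma bex_upt_Suc: "(\<exists>i\<in>{0..<Suc k}. P i) \<longleftrightarrow> (\<exists>i\<le>k. P i)"
  by (auto simp: less_Suc_eq_le)

lemma ball_upt_Suc: "(\<forall>i\<in>{0..<Suc k}. P i) \<longleftrightarrow> (\<forall>i\<le>k. P i)"
  by (auto simp: less_Suc_eq_le)

text \<open>If \<open>Leaf\<close> holds \<open>q\<close>, the atoms appended to the clauses of
  disjunct \<open>q\<close> are all false, since they name only other indices.\<close>

lemma guess_sound: "sat_cnf f (guess_clauses R) \<Longrightarrow> sat_dcnf f R"
proof -
  assume f: "sat_cnf f (guess_clauses R)"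
  then obtain q where q: "q < length R" "f Leaf = encode q"
    by (auto simp: guess_clauses_def sat_cnf_def sat_clause_def)
  have "sat_clause f D" if "D \<in> set (R ! q)" for D
  proof -
    have "sat_clause f (D @ map (\<lambda>q'. (Leaf, encode q')) (filter (\<lambda>q'. q' \<noteq> q) [0..<length R]))"
      using f that q(1) unfolding sat_cnf_def guess_clauses_def by auto
    then show ?thesis using q(2) by (auto simp: sat_clause_def encode_eq_iff)
  qed
  then have "sat_cnf f (R ! q)" by (simp add: sat_cnf_def)
  then show ?thesis using q(1) nth_mem unfolding sat_dcnf_def by blast
qed

lemma guess_vars:
  assumes "\<And>X D. X \<in> set R \<Longrightarrow> D \<in> set X \<Longrightarrow> fst ` set D \<subseteq> B" "D \<in> set (guess_clauses R)"
  shows "fst ` set D \<subseteq> insert Leaf B"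
proof -
  let ?g = "\<lambda>qs. map (\<lambda>q'. (Leaf, encode (q' :: nat))) qs :: atom list"
  have g: "fst ` set (?g qs) \<subseteq> {Leaf}" for qs by auto
  consider "D = ?g [0..<length R]" | q D' where "q < length R" "D' \<in> set (nth_or [] R q)"
    "D = D' @ ?g (filter (\<lambda>q'. q' \<noteq> q) [0..<length R])"
    using assms(2) unfolding guess_clauses_def by fastforce
  then show ?thesis
  proof cases
    case 1
    then show ?thesis using g[of "[0..<length R]"] by blast
  next
    case 2
    then have "fst ` set D' \<subseteq> B" by (intro assms(1)[of "R ! q"]) simp_all
    then show ?thesis using g unfolding 2(3) set_append image_Un by blast
  qed
qed

text \<open>Clauses of disjunct \<open>q\<close> hold by themselves, and those of every other
  disjunct through their appended atom for \<open>q\<close>.\<close>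

lemma guess_complete:
  "q < length R \<Longrightarrow> sat_cnf f (R ! q) \<Longrightarrow> f Leaf = encode q \<Longrightarrow> sat_cnf f (guess_clauses R)"
  unfolding guess_clauses_def sat_cnf_def by (force simp: sat_clause_append sat_clause_def)

lemma hom_complete:
  assumes "\<And>v. v \<in> set V \<Longrightarrow> f v \<in> set X"
    and "\<And>v w. v \<in> set V \<Longrightarrow> w \<in> set V \<Longrightarrow> f (Node v w) = Node (f v) (f w)"
  shows "sat_cnf f (hom_clauses V X)"
proof -
  have "sat_clause f (map (\<lambda>u. (Node v w, Node a u)) X @ map (\<lambda>u. (v, u)) (filter (\<lambda>u. u \<noteq> a) X))"
    "sat_clause f (map (\<lambda>u. (Node v w, Node u a)) X @ map (\<lambda>u. (w, u)) (filter (\<lambda>u. u \<noteq> a) X))"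
    if "v \<in> set V" "w \<in> set V" for v w a
    using assms(1)[OF that(1)] assms(1)[OF that(2)] assms(2)[OF that]
    by (auto simp: sat_clause_append sat_clause_map)
  then show ?thesis by (auto simp: hom_clauses_def sat_cnf_def)
qed

lemma hom_sound1:
  assumes "sat_cnf f (hom_clauses V X)" "v \<in> set V" "w \<in> set V" "f v \<in> set X" "f w \<in> set X"
  shows "f (Node v w) = Node (f v) (f w)"
proof -
  have "sat_clause f (map (\<lambda>u. (Node v w, Node a u)) X @ map (\<lambda>u. (v, u)) (filter (\<lambda>u. u \<noteq> a) X))"
    "sat_clause f (map (\<lambda>u. (Node v w, Node u a)) X @ map (\<lambda>u. (w, u)) (filter (\<lambda>u. u \<noteq> a) X))"
    if "a \<in> set X" for a
    using assms(1-3) that by (auto simp: hom_clauses_def sat_cnf_def)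
  \<comment> \<open>Each pairing clause reads as an implication. With \<open>a\<close> the value of
    \<open>v\<close>, respectively of \<open>w\<close>, its alternatives about a different value
    fail, and the corresponding component of the pair is forced.\<close>
  from this(1)[OF assms(4)] this(2)[OF assms(5)] show ?thesis by (auto simp: sat_clause_def)
qed

text \<open>The pairing clauses say something only about values in their list, so membership in that
  list has to be propagated from level to level, starting with the domain of the base
  variables.\<close>

lemma hom_sound:
  assumes hom: "sat_cnf f (hom_clauses (lvl d V) (lvl d X))" and "\<And>v. v \<in> set V \<Longrightarrow> f v \<in> set X"
  shows "j \<le> d \<Longrightarrow> v \<in> set (lvl j V) \<Longrightarrow> f v \<in> set (lvl j X)"
proof (induction j arbitrary: v)
  case 0
  then show ?case using assms(2) by simp
next
  case (Suc j)
  have sub: "set (lvl j V) \<subseteq> set (lvl d V)" "set (lvl j X) \<subseteq> set (lvl d X)"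
    using Suc.prems(1) by (simp_all add: lvl_mono)
  show ?case
  proof (cases "v \<in> set (lvl j V)")
    case True
    then show ?thesis using Suc by (simp add: set_lvl_Suc)
  next
    case False
    then obtain a b where v: "v = Node a b" "a \<in> set (lvl j V)" "b \<in> set (lvl j V)"
      using Suc.prems(2) by (auto simp: set_lvl_Suc)
    then have ab: "f a \<in> set (lvl j X)" "f b \<in> set (lvl j X)" using Suc by simp_all
    then have "f v = Node (f a) (f b)"
      unfolding v(1) using v(2,3) sub by (intro hom_sound1[OF hom]) blast+
    then show ?thesis using ab by (auto simp: set_lvl_Suc)
  qed
qed

section \<open>Increasing sequences describing sets of inputs\<close>

locale input_sequence =
  fixes f :: "data \<Rightarrow> data" and s :: "nat \<Rightarrow> nat" and k N :: nat and U :: "nat list"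
  assumes val: "i \<le> Suc k \<Longrightarrow> f (var i) = encode (s i)"
    and pair: "i \<le> k \<Longrightarrow> f (Node (var i) (var (Suc i))) = Node (encode (s i)) (encode (s (Suc i)))"
    and dom: "i \<le> Suc k \<Longrightarrow> s i \<in> set U"
    and first: "s 0 = 0" and last: "s (Suc k) = Suc N"
    and step: "i \<le> k \<Longrightarrow> s i < s (Suc i)"
begin

text \<open>Values are shifted by one: \<open>Suc x\<close> excludes the sentinel 0, and
  \<open>x < N\<close> excludes the sentinel \<open>Suc N\<close>.\<close>

definition elems :: "nat set" where "elems = {x. \<exists>i\<le>Suc k. x < N \<and> s i = Suc x}"

lemma less: "i < j \<Longrightarrow> j \<le> Suc k \<Longrightarrow> s i < s j"
proof (induction j)
  case (Suc j)
  then show ?case using step[of j] by (cases "i = j") auto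
qed simp

lemma lit:
  assumes "x < N"
  shows "sat_clause f (lit k U b x) \<longleftrightarrow> (x \<in> elems) = b"
proof -
  have T: "sat_clause f (lit k U True x) \<longleftrightarrow> x \<in> elems"
  proof -
    have "sat_clause f (lit k U True x) \<longleftrightarrow> (\<exists>i<k + 2. f (var i) = encode (Suc x))"
      by (simp add: lit_def sat_clause_map Bex_def del: upt_Suc)
    also have "\<dots> \<longleftrightarrow> (\<exists>i\<le>Suc k. f (var i) = encode (Suc x))"
      by (simp add: less_Suc_eq_le)
    also have "\<dots> \<longleftrightarrow> x \<in> elems" using val assms by (auto simp: elems_def encode_eq_iff simp del: encode_simps)
    finally show ?thesis .
  qed
  have F: "sat_clause f (lit k U False x) \<longleftrightarrow> x \<notin> elems"
  proof -
    have "sat_clause f (lit k U False x) \<longleftrightarrow>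
        (\<exists>i\<le>k. \<exists>a\<in>set U. \<exists>c\<in>set U. a < Suc x \<and> Suc x < c \<and>
          f (Node (var i) (var (Suc i))) = Node (encode a) (encode c))"
      by (simp add: lit_def sat_clause_concat sat_clause_map bex_upt_Suc del: upt_Suc) blast
    also have "\<dots> \<longleftrightarrow> (\<exists>i\<le>k. s i < Suc x \<and> Suc x < s (Suc i))"
      using pair dom by (auto simp: encode_eq_iff)
    also have "\<dots> \<longleftrightarrow> x \<notin> elems"
    proof
      assume "\<exists>i\<le>k. s i < Suc x \<and> Suc x < s (Suc i)"
      then obtain i where i: "i \<le> k" "s i < Suc x" "Suc x < s (Suc i)" by blast
      have "s j \<noteq> Suc x" if "j \<le> Suc k" for j
      proof (cases "j \<le> i")
        case True
        then have "s j \<le> s i" using less[of j i] i(1) by (cases "j = i") auto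
        then show ?thesis using i by simp
      next
        case False
        then have "s (Suc i) \<le> s j" using less[of "Suc i" j] that by (cases "j = Suc i") auto
        then show ?thesis using i by simp
      qed
      then show "x \<notin> elems" by (auto simp: elems_def)
    next
      assume x: "x \<notin> elems"
      \<comment> \<open>The gap around \<open>Suc x\<close> begins at the last member below it. The
        sentinel 0 guarantees such a member, and the sentinel \<open>Suc N\<close> guarantees that
        another one follows.\<close>
      define P where "P i \<longleftrightarrow> i \<le> Suc k \<and> s i < Suc x" for i
      define m where "m = Max {i. P i}"
      have fin: "finite {i. P i}" by (rule finite_subset[of _ "{..Suc k}"]) (auto simp: P_def)
      have "P 0" using first by (simp add: P_def)
      then have "{i. P i} \<noteq> {}" by blast
      then have "m \<in> {i. P i}" unfolding m_def using fin by (rule Max_in[rotated])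
      then have m: "m \<le> Suc k" "s m < Suc x" by (auto simp: P_def)
      have "m \<noteq> Suc k" using m(2) last assms by auto
      then have mk: "m \<le> k" using m(1) by simp
      have "\<not> P (Suc m)" using Max_ge[OF fin, of "Suc m"] by (auto simp: m_def)
      then have "\<not> s (Suc m) < Suc x" using mk by (simp add: P_def)
      moreover have "s (Suc m) \<noteq> Suc x" using x mk assms by (auto simp: elems_def)
      ultimately show "\<exists>i\<le>k. s i < Suc x \<and> Suc x < s (Suc i)" using m(2) mk by (intro exI[of _ m]) simp
    qed
    finally show ?thesis .
  qed
  show ?thesis using T F by (cases b) auto
qed

lemma elems_eq: "elems = (\<lambda>i. s (Suc i) - 1) ` {..<k}"
proof (intro set_eqI iffI)
  fix x assume "x \<in> elems"
  then obtain i where i: "i \<le> Suc k" "s i = Suc x" "x < N" by (auto simp: elems_def)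
  then obtain j where "i = Suc j" using first by (cases i) auto
  moreover have "i \<noteq> Suc k" using i last by auto
  ultimately show "x \<in> (\<lambda>i. s (Suc i) - 1) ` {..<k}" using i by (auto intro!: image_eqI[of _ _ j])
next
  fix x assume "x \<in> (\<lambda>i. s (Suc i) - 1) ` {..<k}"
  then obtain i where i: "i < k" "x = s (Suc i) - 1" by auto
  have "0 < s (Suc i)" using less[of 0 "Suc i"] first i(1) by simp
  moreover have "s (Suc i) < Suc N" using less[of "Suc i" "Suc k"] last i(1) by simp
  ultimately show "x \<in> elems" using i unfolding elems_def by (intro CollectI exI[of _ "Suc i"]) auto
qed

lemma card_elems: "card elems = k"
proof -
  have "inj_on (\<lambda>i. s (Suc i) - 1) {..<k}"
  proof (rule inj_onI)
    fix i j assume ij: "i \<in> {..<k}" "j \<in> {..<k}" "s (Suc i) - 1 = s (Suc j) - 1"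
    have "0 < s (Suc i)" "0 < s (Suc j)" using less[of 0 "Suc i"] less[of 0 "Suc j"] first ij by auto
    then have "s (Suc i) = s (Suc j)" using ij(3) by simp
    then show "i = j" using less[of "Suc i" "Suc j"] less[of "Suc j" "Suc i"] ij
      by (cases i j rule: linorder_cases) auto
  qed
  then show ?thesis unfolding elems_eq by (simp add: card_image)
qed

end

lemma set_base_vals:
  "set (base_vals gs) = {0, Suc (length gs)} \<union> Suc ` {i. i < length gs \<and> gs ! i = InputG}"
  by (auto simp: base_vals_def gate_at_nth tag_0_iff)

lemma var_in_base: "i \<le> Suc k \<Longrightarrow> var i \<in> set (base_vars k)"
  by (auto simp: base_vars_def simp del: upt_Suc)

lemma set_base_vars: "set (base_vars k) = var ` {..Suc k}"
  by (auto simp: base_vars_def less_Suc_eq_le simp del: upt_Suc)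

lemma clauses_sound:
  assumes wf: "wf_gates gs" "out < length gs" and chk: "chk gs d 2 out"
    and f: "sat_cnf f (clauses d gs out k)"
  shows "weighted_sat (gs, out) k"
proof -
  let ?U = "base_vals gs"
  have c: "sat_cnf f (dom_clauses k ?U)" "sat_cnf f (end_clauses k (length gs))" "sat_cnf f (ord_clauses k ?U)"
    "sat_cnf f (hom_clauses (lvl d (base_vars k)) (lvl d (map encode ?U)))"
    "sat_cnf f (guess_clauses (rep2 d (k, ?U, gs) True out))"
    using f by (simp_all add: clauses_def sat_cnf_append)
  have "\<exists>a\<in>set ?U. f (var i) = encode a" if "i \<le> Suc k" for i
    using c(1) that by (auto simp: dom_clauses_def sat_cnf_def sat_clause_def less_Suc_eq_le simp del: upt_Suc)
  then obtain s where s: "\<And>i. i \<le> Suc k \<Longrightarrow> s i \<in> set ?U \<and> f (var i) = encode (s i)" by metis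
  have dom: "f v \<in> set (map encode ?U)" if "v \<in> set (base_vars k)" for v
    using that s by (auto simp: set_base_vars)
  have hom: "f (Node v w) = Node (f v) (f w)"
    if "v \<in> set (lvl d (base_vars k))" "w \<in> set (lvl d (base_vars k))" for v w
    using that by (intro hom_sound1[OF c(4)] hom_sound[OF c(4) dom]) simp_all
  have in_lvl: "var i \<in> set (lvl d (base_vars k))" if "i \<le> Suc k" for i
    using lvl_mono[of 0 d "base_vars k"] var_in_base[OF that] by auto
  interpret input_sequence f s k "length gs" ?U
  proof
    show "f (var i) = encode (s i)" "s i \<in> set ?U" if "i \<le> Suc k" for i using s that by simp_all
    show pair: "f (Node (var i) (var (Suc i))) = Node (encode (s i)) (encode (s (Suc i)))" if "i \<le> k" for i
      using hom[of "var i" "var (Suc i)"] in_lvl[of i] in_lvl[of "Suc i"] s that by simp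
    have "f (var 0) = encode (0::nat)" "f (var (Suc k)) = encode (Suc (length gs))"
      using c(2) by (auto simp: end_clauses_def sat_cnf_def sat_clause_def)
    then show "s 0 = 0" "s (Suc k) = Suc (length gs)"
      using s[of 0] s[of "Suc k"] encode_eq_iff by (metis le0, metis order_refl)
    show "s i < s (Suc i)" if i: "i \<le> k" for i
    proof -
      obtain a b :: nat where "a < b" "f (Node (var i) (var (Suc i))) = Node (encode a) (encode b)"
        using c(3) i
        by (simp add: ord_clauses_def sat_cnf_def sat_clause_concat sat_clause_map ball_upt_Suc del: upt_Suc) blast
      then show ?thesis using pair[OF i] by (simp add: encode_eq_iff)
    qed
  qed
  interpret circuit_reps gs elems f k ?U d
    by unfold_locales (use wf hom lit in auto)
  have "sat_dcnf f (rep2 d (k, ?U, gs) True out)" using guess_sound[OF c(5)] .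
  then have out: "node_vals gs elems ! out" using rep2_val[OF assms(2) chk, of True] by simp
  moreover have "elems \<subseteq> inputs (gs, out)"
  proof
    fix x assume "x \<in> elems"
    then obtain i where "i \<le> Suc k" "s i = Suc x" "x < length gs" by (auto simp: elems_def)
    \<comment> \<open>For \<open>x < length gs\<close> the value \<open>Suc x\<close> is neither
      sentinel, hence it was listed on account of an input node.\<close>
    then have "Suc x \<in> set ?U" using s[of i] by simp
    then show "x \<in> inputs (gs, out)" using \<open>x < length gs\<close> by (auto simp: set_base_vals inputs_def)
  qed
  ultimately show ?thesis using card_elems by (auto simp: weighted_sat_def)
qed

section \<open>The assignment obtained from a satisfying set of inputs\<close>

primrec spine :: "data \<Rightarrow> nat" where
  "spine Leaf = 0"
| "spine (Node a b) = Suc (spine b)"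

lemma spine_encode [simp]: "spine (encode (n::nat)) = n"
  by (induction n) auto

text \<open>The test \<open>a = Leaf\<close> recognizes a base variable \<open>var i\<close>, whose
  index \<open>spine\<close> reads off. Pair variables never have \<open>Leaf\<close> on the left,
  because the levels do not contain it; \<open>Leaf\<close> itself is the selector and gets
  \<open>q\<close>.\<close>

primrec ext :: "(nat \<Rightarrow> nat) \<Rightarrow> nat \<Rightarrow> data \<Rightarrow> data" where
  "ext s q Leaf = encode q"
| "ext s q (Node a b) = (if a = Leaf then encode (s (spine b)) else Node (ext s q a) (ext s q b))"

lemma ext_var [simp]: "ext s q (var i) = encode (s i)"
  by (simp add: var_def)

lemma lvl_not_Leaf: "v \<in> set (lvl j (base_vars k)) \<Longrightarrow> v \<noteq> Leaf"
  by (induction j) (auto simp: set_lvl_Suc base_vars_def var_def simp del: upt_Suc)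

lemma clauses_complete:
  assumes wf: "wf_gates gs" "out < length gs" and chk: "chk gs d 2 out"
    and sat: "weighted_sat (gs, out) k"
  shows "\<exists>f. sat_cnf f (clauses d gs out k)"
proof -
  let ?U = "base_vals gs" and ?N = "length gs"
  obtain S where S: "S \<subseteq> inputs (gs, out)" "card S = k" "node_vals gs S ! out"
    using sat by (auto simp: weighted_sat_def)
  have fin: "finite S" using S(1) by (rule finite_subset) (simp add: inputs_def)
  define xs where "xs = sorted_list_of_set S"
  have xs: "set xs = S" "length xs = k" "sorted_wrt (<) xs"
    using fin S(2) by (simp_all add: xs_def)
  define ys where "ys = 0 # map Suc xs @ [Suc ?N]"
  define s where "s i = ys ! i" for i
  have len: "length ys = k + 2" using xs by (simp add: ys_def)
  have Slt: "x < ?N" if "x \<in> S" for x using S(1) that by (auto simp: inputs_def)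
  have sorted: "sorted_wrt (<) ys"
    using xs Slt by (auto simp: ys_def sorted_wrt_append sorted_wrt_map)
  have U: "set ys \<subseteq> set ?U" using S(1) xs(1) by (auto simp: ys_def set_base_vals inputs_def)
  have sU: "s i \<in> set ?U" if "i \<le> Suc k" for i
    using that len U nth_mem[of i ys] by (auto simp: s_def)
  have s01: "s 0 = 0" "s (Suc k) = Suc ?N"
    using xs(2) by (simp_all add: s_def ys_def nth_append)
  have "s i < s (Suc i)" if "i \<le> k" for i
    unfolding s_def using that len by (intro sorted_wrt_nth_less[OF sorted]) simp_all
  note s = s01 this
  define R where "R = rep2 d (k, ?U, gs) True out"
  define f where "f q = ext s q" for q
  have hom: "f q (Node v w) = Node (f q v) (f q w)" if "v \<in> set (lvl j (base_vars k))" for q j v w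
    using lvl_not_Leaf[OF that] by (simp add: f_def)
  have dom: "f q v \<in> set (lvl j (map encode ?U))" if "v \<in> set (lvl j (base_vars k))" for q j v
    using that
  proof (induction j arbitrary: v)
    case 0
    then show ?case using sU by (auto simp: set_base_vars f_def)
  next
    case (Suc j)
    then show ?case using hom by (auto simp: set_lvl_Suc)
  qed
  have seq: "input_sequence (f q) s k ?N ?U" for q
    by unfold_locales (use s sU in \<open>auto simp: f_def var_def\<close>)
  have elems: "input_sequence.elems s k ?N = S"
  proof (intro set_eqI)
    fix x
    have "(\<exists>i\<le>Suc k. s i = Suc x) \<longleftrightarrow> Suc x \<in> set ys"
      by (auto simp: s_def in_set_conv_nth len less_Suc_eq_le)
    also have "\<dots> \<longleftrightarrow> x \<in> S \<or> x = ?N" using xs by (auto simp: ys_def)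
    finally show "x \<in> input_sequence.elems s k ?N \<longleftrightarrow> x \<in> S"
      using Slt by (auto simp: input_sequence.elems_def[OF seq])
  qed
  have reps: "circuit_reps gs S (f q) k ?U d" for q
    by unfold_locales (use wf hom input_sequence.lit[OF seq, of _ q] elems in auto)
  have "sat_dcnf (f q) R" for q
    unfolding R_def using circuit_reps.rep2_val[OF reps wf(2) chk order_refl, of q True] S(3) by simp
  \<comment> \<open>There is a circularity to avoid: the selector should name a satisfied disjunct,
    while satisfaction is judged under an assignment that includes the selector. The assignments
    \<open>f 0\<close> and \<open>f q0\<close> differ only at \<open>Leaf\<close>, which does not
    occur in \<open>R\<close>, so \<open>q0\<close> found with \<open>f 0\<close> remains
    valid.\<close>
  then obtain q0 where q0: "q0 < length R" "sat_cnf (f 0) (R ! q0)"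
    unfolding sat_dcnf_def by (metis in_set_conv_nth)
  have "sat_clause (f q0) D \<longleftrightarrow> sat_clause (f 0) D" if "D \<in> set (R ! q0)" for D
  proof -
    have "fst ` set D \<subseteq> small_vars d k"
      using rep2_vars[of "R ! q0" d k ?U gs True out D] q0(1) that by (auto simp: R_def)
    moreover have "f q0 v = f 0 v" if "v \<in> set (lvl j (base_vars k))" for j v
      using that
    proof (induction j arbitrary: v)
      case 0
      then show ?case by (auto simp: set_base_vars f_def)
    next
      case (Suc j)
      then show ?case using hom by (auto simp: set_lvl_Suc)
    qed
    ultimately show ?thesis unfolding sat_clause_def small_vars_def by force
  qed
  then have "sat_cnf (f q0) (R ! q0)" using q0(2) by (simp add: sat_cnf_def)
  then have "sat_cnf (f q0) (guess_clauses R)"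
    using q0(1) by (intro guess_complete) (simp_all add: f_def)
  moreover have "sat_cnf (f q0) (hom_clauses (lvl d (base_vars k)) (lvl d (map encode ?U)))"
    by (intro hom_complete dom hom)
  moreover have "sat_cnf (f q0) (dom_clauses k ?U)"
    using sU by (auto simp: dom_clauses_def sat_cnf_def sat_clause_def f_def less_Suc_eq_le simp del: upt_Suc)
  moreover have "sat_cnf (f q0) (end_clauses k ?N)"
    using s by (auto simp: end_clauses_def sat_cnf_def sat_clause_def f_def)
  moreover have "sat_cnf (f q0) (ord_clauses k ?U)"
  proof -
    have "\<exists>a\<in>set ?U. \<exists>c\<in>set ?U. a < c \<and> f q0 (Node (var i) (var (Suc i))) = Node (encode a) (encode c)" if "i \<le> k" for i
      using that s(3)[of i] sU[of i] sU[of "Suc i"] input_sequence.pair[OF seq, of i] by auto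
    then show ?thesis
      by (simp add: ord_clauses_def sat_cnf_def sat_clause_concat sat_clause_map ball_upt_Suc del: upt_Suc) blast
  qed
  ultimately show ?thesis unfolding clauses_def R_def[symmetric] sat_cnf_append by blast
qed

lemma clauses_vars:
  "fst ` set (concat (clauses d gs out k)) \<subseteq> insert Leaf (small_vars d k)"
proof -
  let ?U = "base_vals gs"
  have b: "set (base_vars k) \<subseteq> small_vars d k" "set (lvl d (base_vars k)) \<subseteq> small_vars d k"
    using lvl_mono[of 0 "Suc d" "base_vars k"] lvl_mono[of d "Suc d" "base_vars k"]
    by (auto simp: small_vars_def)
  have vs: "var i \<in> small_vars d k" if "i \<le> Suc k" for i
    using var_in_base[OF that] b(1) by blast
  have p: "Node v w \<in> small_vars d k" if "v \<in> set (lvl d (base_vars k))" "w \<in> set (lvl d (base_vars k))" for v w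
    using that by (auto simp: small_vars_def set_lvl_Suc)
  have in_lvl: "var i \<in> set (lvl d (base_vars k))" if "i \<le> Suc k" for i
    using lvl_mono[of 0 d "base_vars k"] var_in_base[OF that] by auto
  have "fst ` set D \<subseteq> insert Leaf (small_vars d k)" if "D \<in> set (clauses d gs out k)" for D
  proof -
    consider "D \<in> set (dom_clauses k ?U)" | "D \<in> set (end_clauses k (length gs))"
      | "D \<in> set (ord_clauses k ?U)" | "D \<in> set (hom_clauses (lvl d (base_vars k)) (lvl d (map encode ?U)))"
      | "D \<in> set (guess_clauses (rep2 d (k, ?U, gs) True out))"
      using \<open>D \<in> set (clauses d gs out k)\<close> by (auto simp: clauses_def)
    then show ?thesis
    proof cases
      case 1
      then show ?thesis
        using vs by (auto simp: dom_clauses_def less_Suc_eq_le simp del: upt_Suc)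
    next
      case 2
      then show ?thesis using vs[of 0] vs[of "Suc k"] by (auto simp: end_clauses_def)
    next
      case 3
      then show ?thesis using in_lvl p by (auto simp: ord_clauses_def less_Suc_eq_le simp del: upt_Suc)
    next
      case 4
      then show ?thesis using p b(2) by (auto simp: hom_clauses_def)
    next
      case 5
      then show ?thesis by (rule guess_vars[OF rep2_vars, rotated 2])
    qed
  qed
  then show ?thesis by (simp only: set_concat image_UN UN_subset_iff) blast
qed


section \<open>Happy vertices in labelled graphs\<close>

text \<open>Vertices are named by labels: vertex \<open>i\<close> carries the label \<open>L ! i\<close>. The relation \<open>adj\<close> orients every edge,
  and \<open>col\<close> precolours the vertices satisfying \<open>pre\<close>.\<close>

definition lab_instance ::
  "'a \<Rightarrow> 'a list \<Rightarrow> ('a \<Rightarrow> 'a \<Rightarrow> bool) \<Rightarrow> nat \<Rightarrow> ('a \<Rightarrow> bool) \<Rightarrow> ('a \<Rightarrow> nat) \<Rightarrow> nat \<Rightarrow> mhv_instance" where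
  "lab_instance z L adj l pre col k =
     (length L,
      concat (map (\<lambda>i. map (\<lambda>j. (i, j)) (filter (\<lambda>j. adj (nth_or z L i) (nth_or z L j)) [0..<length L])) [0..<length L]),
      l,
      map (\<lambda>i. (i, col (nth_or z L i))) (filter (\<lambda>i. pre (nth_or z L i)) [0..<length L]),
      k)"

locale labelled_graph =
  fixes z :: 'a and L :: "'a list" and adj :: "'a \<Rightarrow> 'a \<Rightarrow> bool" and l :: nat
    and pre :: "'a \<Rightarrow> bool" and col :: "'a \<Rightarrow> nat" and k :: nat
  assumes dist: "distinct L"
    and irrefl: "x \<in> set L \<Longrightarrow> \<not> adj x x"
    and col: "x \<in> set L \<Longrightarrow> pre x \<Longrightarrow> col x \<in> {1..l}"
begin

abbreviation "inst \<equiv> lab_instance z L adj l pre col k"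
abbreviation "n \<equiv> length L"

definition pos :: "'a \<Rightarrow> nat" where "pos x = (SOME i. i < n \<and> L ! i = x)"

lemma pos: "x \<in> set L \<Longrightarrow> pos x < n \<and> L ! pos x = x"
  unfolding pos_def in_set_conv_nth by (rule someI_ex)

lemma pos_nth: "i < n \<Longrightarrow> pos (L ! i) = i"
  using pos[of "L ! i"] nth_eq_iff_index_eq[OF dist] by auto

lemma edges: "snd (mhv_graph inst) = {{i, j} | i j. i < n \<and> j < n \<and> adj (L ! i) (L ! j)}"
  by (fastforce simp: mhv_graph_def lab_instance_def)

lemma vertices: "fst (mhv_graph inst) = {..<n}"
  by (simp add: mhv_graph_def lab_instance_def)

lemma edge_iff: "{i, j} \<in> snd (mhv_graph inst) \<longleftrightarrow> i < n \<and> j < n \<and> (adj (L ! i) (L ! j) \<or> adj (L ! j) (L ! i))"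
  unfolding edges by (auto simp: doubleton_eq_iff)

lemma colouring: "map_of (map (\<lambda>i. (i, col (nth_or z L i))) (filter (\<lambda>i. pre (nth_or z L i)) [0..<n])) i =
    (if i < n \<and> pre (L ! i) then Some (col (L ! i)) else None)"
proof -
  have "map_of (map (\<lambda>i. (i, g i)) xs) i = (if i \<in> set xs then Some (g i) else None)" for g :: "nat \<Rightarrow> nat" and xs
    by (induction xs) auto
  then show ?thesis by auto
qed

lemma wf: "mhv_wf inst"
proof -
  have "simple_graph (mhv_graph inst)"
  proof -
    have "\<exists>u\<in>{..<n}. \<exists>v\<in>{..<n}. u \<noteq> v \<and> e = {u, v}" if e: "e \<in> snd (mhv_graph inst)" for e
    proof -
      obtain i j where "i < n" "j < n" "adj (L ! i) (L ! j)" "e = {i, j}" using e unfolding edges by blast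
      moreover from this have "i \<noteq> j" using irrefl by auto
      ultimately show ?thesis by auto
    qed
    then show ?thesis unfolding simple_graph_def using vertices by (simp add: case_prod_beta)
  qed
  then show ?thesis
    using col by (auto simp: mhv_wf_def lab_instance_def[of z L adj l pre col k] colouring ran_def comp_def
      split: if_splits)
qed

definition happy_label :: "('a \<Rightarrow> nat) \<Rightarrow> 'a \<Rightarrow> bool" where
  "happy_label c x \<longleftrightarrow> (\<forall>y\<in>set L. adj x y \<or> adj y x \<longrightarrow> c y = c x)"

lemma card_happy:
  "card {v \<in> {..<n}. happy (mhv_graph inst) c v} = card {x \<in> set L. happy_label (\<lambda>x. c (pos x)) x}"
proof (rule bij_betw_same_card[of "(!) L"])
  have "happy (mhv_graph inst) c v \<longleftrightarrow> happy_label (\<lambda>x. c (pos x)) (L ! v)" if "v < n" for v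
    using that pos_nth unfolding happy_def edge_iff happy_label_def all_set_conv_all_nth by auto
  then show "bij_betw ((!) L) {v \<in> {..<n}. happy (mhv_graph inst) c v} {x \<in> set L. happy_label (\<lambda>x. c (pos x)) x}"
    using dist by (auto simp: bij_betw_def inj_on_def nth_eq_iff_index_eq in_set_conv_nth)
qed

lemma yes_iff:
  "mhv_yes inst \<longleftrightarrow> (\<exists>c. (\<forall>x\<in>set L. c x \<in> {1..l}) \<and> (\<forall>x\<in>set L. pre x \<longrightarrow> c x = col x) \<and>
     k \<le> card {x \<in> set L. happy_label c x})"
proof -
  let ?p = "\<lambda>i. if i < n \<and> pre (L ! i) then Some (col (L ! i)) else None"
  have p: "map_of (map (\<lambda>i. (i, col (nth_or z L i))) (filter (\<lambda>i. pre (nth_or z L i)) [0..<n])) = ?p"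
    using colouring by blast
  have "mhv_yes inst \<longleftrightarrow> max_happy_vertices (mhv_graph inst) l ?p k"
    unfolding p[symmetric] mhv_yes_def by (simp add: lab_instance_def)
  also have "\<dots> \<longleftrightarrow> (\<exists>c. (\<forall>v<n. c v \<in> {1..l}) \<and> (\<forall>v<n. pre (L ! v) \<longrightarrow> col (L ! v) = c v) \<and>
      k \<le> card {x \<in> set L. happy_label (\<lambda>x. c (pos x)) x})"
  proof -
    have "dom ?p = {v. v < n \<and> pre (L ! v)}" by (auto simp: dom_def)
    then show ?thesis
      unfolding max_happy_vertices_def vertices card_happy by (auto simp: Ball_def)
  qed
  also have "\<dots> \<longleftrightarrow> (\<exists>c. (\<forall>x\<in>set L. c x \<in> {1..l}) \<and> (\<forall>x\<in>set L. pre x \<longrightarrow> c x = col x) \<and>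
      k \<le> card {x \<in> set L. happy_label c x})" (is "?A \<longleftrightarrow> ?B")
  proof
    assume ?A
    then obtain c where c: "\<forall>v<n. c v \<in> {1..l}" "\<forall>v<n. pre (L ! v) \<longrightarrow> col (L ! v) = c v"
      "k \<le> card {x \<in> set L. happy_label (\<lambda>x. c (pos x)) x}" by blast
    then show ?B using pos by (intro exI[of _ "\<lambda>x. c (pos x)"]) fastforce
  next
    assume ?B
    then obtain c where c: "\<forall>x\<in>set L. c x \<in> {1..l}" "\<forall>x\<in>set L. pre x \<longrightarrow> c x = col x"
      "k \<le> card {x \<in> set L. happy_label c x}" by blast
    have "{x \<in> set L. happy_label c x} = {x \<in> set L. happy_label (\<lambda>x. c (L ! pos x)) x}"
      using pos by (auto simp: happy_label_def)
    then show ?A using c by (intro exI[of _ "\<lambda>v. c (L ! v)"]) auto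
  qed
  finally show ?thesis .
qed

text \<open>The map \<open>ctr\<close> sends every remaining label to the centre of its star, the
  centres being its fixed points. Its fibres form the partition, and since the only remaining edges
  join a label to its centre, each fibre is a star.\<close>

lemma distance_le:
  assumes X: "X \<subseteq> set L"
    and ctr: "\<And>x. x \<in> set L - X \<Longrightarrow> ctr x \<in> set L - X \<and> ctr (ctr x) = ctr x"
    and adj: "\<And>x y. x \<in> set L - X \<Longrightarrow> y \<in> set L - X \<Longrightarrow> adj x y \<longleftrightarrow> x \<noteq> y \<and> x = ctr y"
  shows "distance_to disjoint_union_of_stars (mhv_graph inst) \<le> card X"
proof -
  define D where "D = pos ` X"
  have "inj_on pos X" by (rule inj_onI) (metis X pos subsetD)
  then have cardD: "card D = card X" by (simp add: D_def card_image)
  have D: "D \<subseteq> {..<n}" using X pos by (auto simp: D_def)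
  define V where "V = {..<n} - D"
  have V: "i \<in> V \<longleftrightarrow> i < n \<and> L ! i \<in> set L - X" for i
    unfolding V_def D_def using pos_nth pos X by (auto simp: image_iff subset_iff)
  define E where "E = {e \<in> snd (mhv_graph inst). e \<inter> D = {}}"
  define q where "q i = pos (ctr (L ! i))" for i
  have q: "q i \<in> V" "q (q i) = q i" "L ! q i = ctr (L ! i)" if "i \<in> V" for i
    using that ctr[of "L ! i"] pos[of "ctr (L ! i)"] by (auto simp: V q_def)
  have E: "e \<in> E \<longleftrightarrow> (\<exists>i\<in>V. q i \<noteq> i \<and> e = {q i, i})" for e
  proof
    assume "e \<in> E"
    then obtain i j where ij: "e = {i, j}" "i < n" "j < n" "adj (L ! i) (L ! j)" "i \<notin> D" "j \<notin> D"
      unfolding E_def edges by auto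
    then have "i \<in> V" "j \<in> V" by (auto simp: V_def)
    with ij(4) have "L ! i = ctr (L ! j)" "L ! i \<noteq> L ! j" using adj by (auto simp: V)
    then have "i = q j" "i \<noteq> j" using pos_nth[OF ij(2)] by (auto simp: q_def)
    with \<open>j \<in> V\<close> ij(1) show "\<exists>i\<in>V. q i \<noteq> i \<and> e = {q i, i}" by auto
  next
    assume "\<exists>i\<in>V. q i \<noteq> i \<and> e = {q i, i}"
    then obtain i where i: "i \<in> V" "q i \<noteq> i" "e = {q i, i}" by blast
    then have "L ! q i \<noteq> L ! i" using q(1)[of i] dist by (simp add: V nth_eq_iff_index_eq)
    then have "adj (L ! q i) (L ! i)" using adj i(1) q(1,3)[OF i(1)] by (simp add: V)
    moreover have "q i < n" "i < n" "q i \<notin> D" "i \<notin> D" using i(1) q(1)[OF i(1)] by (auto simp: V_def)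
    ultimately show "e \<in> E" unfolding E_def edges i(3) by blast
  qed
  define B where "B c = {i \<in> V. q i = c}" for c
  have "partition_on V (B ` q ` V)"
    unfolding partition_on_def disjoint_def B_def by auto
  moreover have "\<forall>e\<in>E. \<exists>Y\<in>B ` q ` V. e \<subseteq> Y"
  proof
    fix e assume "e \<in> E"
    then obtain i where i: "i \<in> V" "e = {q i, i}" unfolding E by blast
    then have "e \<subseteq> B (q i)" using q(1,2)[OF i(1)] by (simp add: B_def)
    then show "\<exists>Y\<in>B ` q ` V. e \<subseteq> Y" using i(1) by blast
  qed
  moreover have "star (Y, {e \<in> E. e \<subseteq> Y})" if "Y \<in> B ` q ` V" for Y
  proof -
    obtain c where c: "c \<in> V" "q c = c" "Y = B c" using \<open>Y \<in> B ` q ` V\<close> q by auto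
    have "{e \<in> E. e \<subseteq> Y} = (\<lambda>v. {c, v}) ` (Y - {c})"
    proof (intro set_eqI iffI)
      fix e assume "e \<in> {e \<in> E. e \<subseteq> Y}"
      then obtain i where "i \<in> V" "q i \<noteq> i" "e = {q i, i}" "e \<subseteq> Y" by (auto simp: E)
      then show "e \<in> (\<lambda>v. {c, v}) ` (Y - {c})" using c by (auto simp: B_def)
    next
      fix e assume "e \<in> (\<lambda>v. {c, v}) ` (Y - {c})"
      then obtain v where v: "v \<in> V" "q v = c" "v \<noteq> c" "e = {c, v}" using c(3) by (auto simp: B_def)
      then have "e \<in> E" unfolding E by (intro bexI[of _ v]) auto
      then show "e \<in> {e \<in> E. e \<subseteq> Y}" using v c by (auto simp: B_def)
    qed
    moreover have "finite Y" "c \<in> Y" using c by (auto simp: B_def V_def)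
    ultimately show ?thesis by (auto simp: star_def)
  qed
  moreover have "finite V" by (simp add: V_def)
  ultimately have "disjoint_union_of_stars (V, E)" unfolding disjoint_union_of_stars_def by blast
  moreover have "delete_vertices (mhv_graph inst) D = (V, E)"
    by (simp add: delete_vertices_def vertices V_def E_def)
  ultimately have "\<exists>D\<subseteq>fst (mhv_graph inst). card D = card X \<and>
      disjoint_union_of_stars (delete_vertices (mhv_graph inst) D)"
    using D cardD by (intro exI[of _ D]) (simp add: vertices)
  then show ?thesis unfolding distance_to_def by (rule Least_le)
qed

end


section \<open>From many-valued clauses to happy vertices\<close>

text \<open>Labels are triples. \<open>(0, 0, 0)\<close> and \<open>(0, 1, 0)\<close> are two precoloured vertices of different colours that make
  all their neighbours unhappy, \<open>(1, t, 0)\<close> is the \<open>t\<close>-th variable, \<open>(2, q, 0)\<close> is the centre of the star of the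
  \<open>q\<close>-th clause, and \<open>(3, q, a)\<close> is the leaf of that star for the \<open>a\<close>-th atom. The leaf has the colour of its atom and is
  adjacent to the variable of its atom. The centre has one colour, hence at most one leaf of a star is happy.\<close>

type_synonym label = "nat \<times> nat \<times> nat"

definition atoms :: "atom list list \<Rightarrow> atom list" where "atoms Cs = remdups (concat Cs)"

definition vars :: "atom list list \<Rightarrow> data list" where "vars Cs = remdups (map fst (concat Cs))"

definition labels :: "atom list list \<Rightarrow> label list" where
  "labels Cs = remdups ([(0, 0, 0), (0, 1, 0)] @ map (\<lambda>t. (1, t, 0)) [0..<length (vars Cs)] @
     map (\<lambda>q. (2, q, 0)) [0..<length Cs] @
     concat (map (\<lambda>q. map (\<lambda>a. (3, q, a))
       (filter (\<lambda>a. nth_or (Leaf, Leaf) (atoms Cs) a \<in> set (nth_or [] Cs q)) [0..<length (atoms Cs)])) [0..<length Cs]))"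

text \<open>The two anchors avoid the leaves, which must be able to become happy. They are adjacent
  to each other, so neither of them is ever happy.\<close>

definition adj :: "atom list list \<Rightarrow> label \<Rightarrow> label \<Rightarrow> bool" where
  "adj Cs u v \<longleftrightarrow>
     fst u = 0 \<and> (fst v = 1 \<or> fst v = 2 \<or> fst v = 0 \<and> fst (snd u) = 0 \<and> fst (snd v) = 1) \<or>
     fst u = 1 \<and> fst v = 3 \<and> nth_or Leaf (vars Cs) (fst (snd u)) = fst (nth_or (Leaf, Leaf) (atoms Cs) (snd (snd v))) \<or>
     fst u = 2 \<and> fst v = 3 \<and> fst (snd u) = fst (snd v)"

definition pre :: "label \<Rightarrow> bool" where "pre u \<longleftrightarrow> fst u = 0 \<or> fst u = 3"

text \<open>The colour of a leaf depends on its atom and not on its clause, so one colour of a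
  variable vertex suits all leaves stating that value in any star. The offset 3 skips the anchor
  colours 1 and 2.\<close>

definition col :: "label \<Rightarrow> nat" where
  "col u = (if fst u = 0 then Suc (fst (snd u)) else 3 + snd (snd u))"

definition clauses_mhv :: "atom list list \<Rightarrow> mhv_instance" where
  "clauses_mhv Cs = lab_instance (0, 0, 0) (labels Cs) (adj Cs) (length (atoms Cs) + 3) pre col (length Cs)"

lemma set_labels:
  "set (labels Cs) = {(0, 0, 0), (0, 1, 0)} \<union> {(1, t, 0) | t. t < length (vars Cs)} \<union> {(2, q, 0) | q. q < length Cs} \<union>
     {(3, q, a) | q a. q < length Cs \<and> a < length (atoms Cs) \<and> atoms Cs ! a \<in> set (Cs ! q)}"
  by (auto simp: labels_def image_iff)

lemma labelled_graph_clauses: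
  "labelled_graph (labels Cs) (adj Cs) (length (atoms Cs) + 3) pre col"
proof
  show "distinct (labels Cs)" by (simp add: labels_def)
  show "\<not> adj Cs x x" for x by (auto simp: adj_def)
  show "col x \<in> {1..length (atoms Cs) + 3}" if "x \<in> set (labels Cs)" for x
    using that by (auto simp: set_labels col_def)
qed

lemma clauses_mhv_wf: "mhv_wf (clauses_mhv Cs)"
  unfolding clauses_mhv_def by (rule labelled_graph.wf[OF labelled_graph_clauses])

lemma clauses_mhv_distance:
  "distance_to disjoint_union_of_stars (mhv_graph (clauses_mhv Cs)) \<le> card (fst ` set (concat Cs)) + 2"
proof -
  let ?X = "{(0, 0, 0), (0, 1, 0)} \<union> (\<lambda>t. (1, t, 0)) ` {..<length (vars Cs)} :: label set"
  \<comment> \<open>Centre and leaves of a star share the clause index in their second component,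
    which therefore determines the centre.\<close>
  define ctr where "ctr u = (2 :: nat, fst (snd u), 0 :: nat)" for u :: label
  have R: "set (labels Cs) - ?X = {(2, q, 0) | q. q < length Cs} \<union>
     {(3, q, a) | q a. q < length Cs \<and> a < length (atoms Cs) \<and> atoms Cs ! a \<in> set (Cs ! q)}"
    by (auto simp: set_labels)
  have "distance_to disjoint_union_of_stars (mhv_graph (clauses_mhv Cs)) \<le> card ?X"
    unfolding clauses_mhv_def
  proof (rule labelled_graph.distance_le[OF labelled_graph_clauses, where ctr = ctr])
    show "?X \<subseteq> set (labels Cs)" by (auto simp: set_labels)
    show "ctr x \<in> set (labels Cs) - ?X \<and> ctr (ctr x) = ctr x" if "x \<in> set (labels Cs) - ?X" for x
      using that unfolding R by (auto simp: ctr_def)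
    show "adj Cs x y \<longleftrightarrow> x \<noteq> y \<and> x = ctr y" if "x \<in> set (labels Cs) - ?X" "y \<in> set (labels Cs) - ?X" for x y
      using that unfolding R by (auto simp: ctr_def adj_def)
  qed
  also have "card ?X \<le> 2 + length (vars Cs)"
    by (rule order.trans[OF card_Un_le add_le_mono])
      (simp_all add: card_insert_if order.trans[OF card_image_le])
  also have "length (vars Cs) = card (fst ` set (concat Cs))"
    by (simp add: vars_def length_remdups_card_conv)
  finally show ?thesis by simp
qed

lemma clauses_mhv_yes: "mhv_yes (clauses_mhv Cs) \<longleftrightarrow> (\<exists>f. sat_cnf f Cs)"
proof -
  let ?A = "atoms Cs" and ?T = "vars Cs" and ?L = "labels Cs" and ?l = "length (atoms Cs) + 3"
  interpret labelled_graph "(0, 0, 0)" ?L "adj Cs" ?l pre col "length Cs"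
    by (rule labelled_graph_clauses)
  have dA: "distinct ?A" and dT: "distinct ?T" by (simp_all add: atoms_def vars_def)
  have A: "set ?A = set (concat Cs)" and T: "set ?T = fst ` set (concat Cs)" by (simp_all add: atoms_def vars_def)
  have w: "(0, 0, 0) \<in> set ?L" "(0, 1, 0) \<in> set ?L" by (auto simp: set_labels)
  have "(\<exists>c. (\<forall>x\<in>set ?L. c x \<in> {1..?l}) \<and> (\<forall>x\<in>set ?L. pre x \<longrightarrow> c x = col x) \<and>
      length Cs \<le> card {x \<in> set ?L. happy_label c x}) \<longleftrightarrow> (\<exists>f. sat_cnf f Cs)" (is "?M \<longleftrightarrow> ?F")
  proof
    assume ?M
    then obtain c where c: "\<forall>x\<in>set ?L. pre x \<longrightarrow> c x = col x" "length Cs \<le> card {x \<in> set ?L. happy_label c x}"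
      by blast
    let ?H = "{x \<in> set ?L. happy_label c x}"
    have cw: "c (0, 0, 0) = 1" "c (0, 1, 0) = 2" using c(1) w by (auto simp: pre_def col_def)
    have H: "fst x = 3" if "x \<in> ?H" for x
    proof (rule ccontr)
      assume "fst x \<noteq> 3"
      with that have x: "x = (0, 0, 0) \<or> x = (0, 1, 0) \<or> fst x = 1 \<or> fst x = 2" by (auto simp: set_labels)
      have hx: "happy_label c x" using \<open>x \<in> ?H\<close> by simp
      have h: "c y = c x" if "y \<in> set ?L" "adj Cs x y \<or> adj Cs y x" for y
        using hx that unfolding happy_label_def by blast
      \<comment> \<open>Each label other than a leaf is an anchor or adjacent to both anchors. If it
        were happy, the colours 1 and 2 would coincide.\<close>
      have "adj Cs (0, 0, 0) x \<or> x = (0, 0, 0)" "adj Cs (0, 1, 0) x \<or> adj Cs x (0, 1, 0) \<or> x = (0, 1, 0)"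
        using x unfolding adj_def by (elim disjE; simp)+
      then have "c (0, 0, 0) = c x" "c (0, 1, 0) = c x" using h w by metis+
      then show False using cw by simp
    qed
    have H': "q < length Cs \<and> a < length ?A \<and> ?A ! a \<in> set (Cs ! q)" if "(3, q, a) \<in> ?H" for q a
      using that by (auto simp: set_labels)
    have Hc: "c y = 3 + a" if "(3, q, a) \<in> ?H" "y \<in> set ?L" "adj Cs y (3, q, a)" for q a y
    proof -
      have "c y = c (3, q, a)" using that by (simp add: happy_label_def)
      also have "\<dots> = 3 + a" using c(1) that(1) by (auto simp: pre_def col_def)
      finally show ?thesis .
    qed
    let ?q = "\<lambda>x::label. fst (snd x)"
    \<comment> \<open>Two happy leaves of one star would force different colours on its centre. With
      at most one happy vertex per clause, the threshold \<open>length Cs\<close> requires one for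
      every clause.\<close>
    have "inj_on ?q ?H"
    proof (rule inj_onI)
      fix x y assume xy: "x \<in> ?H" "y \<in> ?H" "?q x = ?q y"
      then obtain q a b where x: "x = (3, q, a)" and y: "y = (3, q, b)"
        using H[OF xy(1)] H[OF xy(2)] by (metis prod.collapse)
      have "q < length Cs" using H' xy(1) x by blast
      then have "(2, q, 0) \<in> set ?L" by (auto simp: set_labels)
      then have "c (2, q, 0) = 3 + a" "c (2, q, 0) = 3 + b"
        using xy(1,2) unfolding x y by (auto intro!: Hc simp: adj_def)
      then show "x = y" using x y by simp
    qed
    then have "length Cs \<le> card (?q ` ?H)" using c(2) by (simp add: card_image)
    moreover have "?q ` ?H \<subseteq> {..<length Cs}"
    proof
      fix q assume "q \<in> ?q ` ?H"
      then obtain a where "(3, q, a) \<in> ?H" using H by (force simp: image_iff)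
      then show "q \<in> {..<length Cs}" using H' by blast
    qed
    ultimately have surj: "?q ` ?H = {..<length Cs}" by (intro card_seteq) simp_all
    define ti where "ti v = (SOME t. t < length ?T \<and> ?T ! t = v)" for v
    have ti: "ti v < length ?T \<and> ?T ! ti v = v" if "v \<in> set ?T" for v
      using that unfolding ti_def in_set_conv_nth by (rule someI_ex)
    \<comment> \<open>A variable vertex next to a happy leaf has colour \<open>3 + a\<close>;
      subtracting 3 recovers the index of the atom that states its value. Other variables get an
      arbitrary value.\<close>
    define f where "f v = snd (?A ! (c (1, ti v, 0) - 3))" for v
    have "sat_clause f (Cs ! q)" if "q < length Cs" for q
    proof -
      have "q \<in> ?q ` ?H" using that surj by simp
      then obtain a where a: "(3, q, a) \<in> ?H" using H by (force simp: image_iff)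
      have aA: "a < length ?A" "?A ! a \<in> set (Cs ! q)" using H'[OF a] by simp_all
      have "?A ! a \<in> set ?A" using aA(1) by simp
      then have "fst (?A ! a) \<in> set ?T" unfolding T A by simp
      note t = ti[OF this]
      have "(1, ti (fst (?A ! a)), 0) \<in> set ?L" using t by (simp add: set_labels)
      moreover have "adj Cs (1, ti (fst (?A ! a)), 0) (3, q, a)" using t aA(1) by (simp add: adj_def)
      ultimately have "c (1, ti (fst (?A ! a)), 0) = 3 + a" by (rule Hc[OF a])
      then have "f (fst (?A ! a)) = snd (?A ! a)" by (simp add: f_def)
      then show ?thesis using aA(2) by (auto simp: sat_clause_def)
    qed
    then show ?F unfolding sat_cnf_def by (metis in_set_conv_nth)
  next
    assume ?F
    then obtain f where f: "sat_cnf f Cs" by blast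
    have "\<exists>a<length ?A. ?A ! a \<in> set (Cs ! q) \<and> f (fst (?A ! a)) = snd (?A ! a)" if "q < length Cs" for q
    proof -
      have "sat_clause f (Cs ! q)" using f that by (simp add: sat_cnf_def)
      then obtain p where p: "p \<in> set (Cs ! q)" "f (fst p) = snd p" by (auto simp: sat_clause_def)
      then have "p \<in> set ?A" using that A by auto
      with p show ?thesis by (metis in_set_conv_nth)
    qed
    then obtain aq where aq: "\<And>q. q < length Cs \<Longrightarrow> aq q < length ?A \<and> ?A ! aq q \<in> set (Cs ! q) \<and>
        f (fst (?A ! aq q)) = snd (?A ! aq q)"
      by metis
    \<comment> \<open>The colour belongs to the atom that states the value of this variable under
      \<open>f\<close>; distinctness of the atom list makes its index unique. If no such atom
      occurs, 1 serves as some admissible colour.\<close>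
    define at where "at t = (if \<exists>a<length ?A. ?A ! a = (?T ! t, f (?T ! t))
      then 3 + (SOME a. a < length ?A \<and> ?A ! a = (?T ! t, f (?T ! t))) else 1)" for t
    have at: "at t = 3 + a" if "a < length ?A" "?A ! a = (?T ! t, f (?T ! t))" for t a
    proof -
      have "(SOME a. a < length ?A \<and> ?A ! a = (?T ! t, f (?T ! t))) = a"
        by (rule some_equality) (use that dA in \<open>auto simp: nth_eq_iff_index_eq[symmetric]\<close>)
      then show ?thesis using that by (auto simp: at_def)
    qed
    have at_range: "at t \<in> {1..?l}" for t
    proof (cases "\<exists>a<length ?A. ?A ! a = (?T ! t, f (?T ! t))")
      case True
      then obtain a where "a < length ?A" "?A ! a = (?T ! t, f (?T ! t))" by blast
      with at[OF this] show ?thesis by simp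
    next
      case False
      then have "at t = 1" unfolding at_def by (rule if_not_P)
      then show ?thesis by simp
    qed
    define c :: "label \<Rightarrow> nat" where
      "c u = (if fst u = 1 then at (fst (snd u)) else if fst u = 2 then 3 + aq (fst (snd u)) else col u)" for u
    have range: "\<forall>x\<in>set ?L. c x \<in> {1..?l}"
    proof
      fix x assume x: "x \<in> set ?L"
      consider "fst x = 1" | "fst x = 2" "fst (snd x) < length Cs" | "fst x \<noteq> 1" "fst x \<noteq> 2" "pre x"
        using x by (auto simp: set_labels pre_def)
      then show "c x \<in> {1..?l}"
      proof cases
        case 1
        then show ?thesis using at_range by (simp add: c_def)
      next
        case 2
        then show ?thesis using aq[OF 2(2)] by (simp add: c_def)
      next
        case 3
        then show ?thesis using col[OF x 3(3)] by (simp add: c_def)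
      qed
    qed
    have pre: "\<forall>x\<in>set ?L. pre x \<longrightarrow> c x = col x" by (auto simp: pre_def c_def)
    let ?g = "\<lambda>q. (3 :: nat, q, aq q)"
    have "?g q \<in> {x \<in> set ?L. happy_label c x}" if q: "q < length Cs" for q
    proof -
      have "?g q \<in> set ?L" using aq[OF q] q by (auto simp: set_labels)
      moreover have "c y = c (?g q)" if y: "y \<in> set ?L" "adj Cs (?g q) y \<or> adj Cs y (?g q)" for y
      proof -
        have "(\<exists>t<length ?T. y = (1, t, 0) \<and> ?T ! t = fst (?A ! aq q)) \<or> y = (2, q, 0)"
          using y aq[OF q] by (auto simp: adj_def set_labels)
        then have "c y = 3 + aq q"
        proof (elim disjE exE conjE)
          fix t assume t: "y = (1, t, 0)" "?T ! t = fst (?A ! aq q)"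
          then have "?A ! aq q = (?T ! t, f (?T ! t))" using aq[OF q] by (simp add: prod_eq_iff)
          then show ?thesis using at aq[OF q] t(1) by (simp add: c_def)
        qed (simp add: c_def)
        then show ?thesis by (simp add: c_def col_def)
      qed
      ultimately show ?thesis by (simp add: happy_label_def)
    qed
    then have "card {..<length Cs} \<le> card {x \<in> set ?L. happy_label c x}"
      by (intro card_inj_on_le[of ?g]) (auto simp: inj_on_def)
    then show ?M using range pre by (intro exI[of _ c]) simp
  qed
  then show ?thesis unfolding clauses_mhv_def yes_iff .
qed


section \<open>The reduction runs in polynomial time\<close>

lemma ptime_comp4:
  assumes "ptime (\<lambda>z. g (fst z) (fst (snd z)) (fst (snd (snd z))) (snd (snd (snd z))))"
    "ptime a" "ptime b" "ptime c" "ptime d"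
  shows "ptime (\<lambda>x. g (a x) (b x) (c x) (d x))"
  using ptime_comp3[OF assms(1,2,3) ptime_Pair[OF assms(4,5)]] by simp

lemma ptime_tag0: "ptime tag"
proof (rule ptime_left)
  show "encode (tag g) = left_of (encode g)" for g
    by (cases g) (simp_all add: encode_gate_def encode_nat_def)
qed
lemmas ptime_tag [ptime_intros] = ptime_comp[OF ptime_tag0]

lemma ptime_preds0: "ptime preds"
proof (rule ptime_cast)
  \<comment> \<open>The encoding of \<open>NotG\<close> holds a bare number, which has to be wrapped
    into a singleton list; in the other cases the right subtree is the list of in-neighbours
    already.\<close>
  let ?F = "\<lambda>g :: gate. if left_of (encode g) = encode (1::nat) then Node (right_of (encode g)) Leaf else right_of (encode g)"
  show "ptime ?F" by (intro ptime_intros)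
  show "encode (preds g) = encode (?F g)" for g
    by (cases g) (simp_all add: encode_gate_def encode_list_def encode_nat_def numeral_eq_Suc)
qed
lemmas ptime_preds [ptime_intros] = ptime_comp[OF ptime_preds0]

lemma ptime_gate_at0: "ptime (\<lambda>z. gate_at (fst z) (snd z))"
  unfolding gate_at_def by (intro ptime_intros)
lemmas ptime_gate_at [ptime_intros] = ptime_comp2[OF ptime_gate_at0]

text \<open>For each fixed \<open>d\<close> separately: the induction builds a different program and
  a different polynomial for every depth. The same pattern serves the representations and
  \<open>lvl\<close>.\<close>

lemma ptime_chk0: "ptime (\<lambda>z. chk (fst z) d (fst (snd z)) (snd (snd z)))"
proof (induction d)
  case 0
  show ?case unfolding chk.simps by (intro ptime_intros)
next
  case (Suc d)
  note IH = ptime_comp3[where g = "\<lambda>gs l i. chk gs d l i", OF Suc]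
  show ?case unfolding chk.simps by (intro ptime_intros IH)
qed
lemmas ptime_chk [ptime_intros] = ptime_comp3[where g = "\<lambda>gs l i. chk gs d l i" for d, OF ptime_chk0]

lemma ptime_var0: "ptime var"
  unfolding var_def by (intro ptime_intros)
lemmas ptime_var [ptime_intros] = ptime_comp[OF ptime_var0]

lemma ptime_lit0: "ptime (\<lambda>z. lit (fst z) (fst (snd z)) (fst (snd (snd z))) (snd (snd (snd z))))"
  unfolding lit_def by (intro ptime_intros)
lemmas ptime_lit [ptime_intros] = ptime_comp4[OF ptime_lit0]

lemma ptime_clause_prod0: "ptime (\<lambda>z. clause_prod (fst z) (snd z))"
  unfolding clause_prod_def by (intro ptime_intros)
lemmas ptime_clause_prod [ptime_intros] = ptime_comp2[OF ptime_clause_prod0]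

lemma ptime_cross_append0: "ptime (\<lambda>z. cross_append (fst z) (snd z :: 'a::tree_enc list list))"
  unfolding cross_append_def by (intro ptime_intros)
lemmas ptime_cross_append [ptime_intros] = ptime_comp2[OF ptime_cross_append0]

lemma ptime_rep0_0: "ptime (\<lambda>z. rep0 d (fst z) (fst (snd z)) (snd (snd z)))"
proof (induction d)
  case 0
  show ?case unfolding rep0.simps by (intro ptime_intros)
next
  case (Suc d)
  note IH = ptime_comp3[OF Suc]
  show ?case unfolding rep0.simps by (intro ptime_intros IH)
qed
lemmas ptime_rep0 = ptime_comp3[OF ptime_rep0_0]

lemma ptime_rep1_0: "ptime (\<lambda>z. rep1 d (fst z) (fst (snd z)) (snd (snd z)))"
proof (induction d)
  case 0
  show ?case unfolding rep1.simps by (intro ptime_intros)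
next
  case (Suc d)
  note IH = ptime_comp3[OF Suc]
  show ?case unfolding rep1.simps by (intro ptime_intros IH ptime_rep0)
qed
lemmas ptime_rep1 = ptime_comp3[OF ptime_rep1_0]

lemma ptime_rep2_0: "ptime (\<lambda>z. rep2 d (fst z) (fst (snd z)) (snd (snd z)))"
proof (induction d)
  case 0
  show ?case unfolding rep2.simps by (intro ptime_intros)
next
  case (Suc d)
  note IH = ptime_comp3[OF Suc]
  show ?case unfolding rep2.simps by (intro ptime_intros IH ptime_rep1)
qed
lemmas ptime_rep2 = ptime_comp3[OF ptime_rep2_0]

lemma ptime_base_vals0: "ptime base_vals"
  unfolding base_vals_def by (intro ptime_intros)
lemmas ptime_base_vals [ptime_intros] = ptime_comp[OF ptime_base_vals0]

lemma ptime_base_vars0: "ptime base_vars"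
  unfolding base_vars_def by (intro ptime_intros)
lemmas ptime_base_vars [ptime_intros] = ptime_comp[OF ptime_base_vars0]

lemma ptime_pair_up0: "ptime pair_up"
  unfolding pair_up_def by (intro ptime_intros)
lemmas ptime_pair_up [ptime_intros] = ptime_comp[OF ptime_pair_up0]

lemma ptime_lvl0: "ptime (lvl d)"
proof (induction d)
  case 0
  show ?case unfolding lvl.simps by (intro ptime_intros)
next
  case (Suc d)
  note IH = ptime_comp[OF Suc]
  show ?case unfolding lvl.simps by (intro ptime_intros IH)
qed
lemmas ptime_lvl [ptime_intros] = ptime_comp[OF ptime_lvl0]

lemma ptime_dom_clauses0: "ptime (\<lambda>z. dom_clauses (fst z) (snd z))"
  unfolding dom_clauses_def by (intro ptime_intros)
lemmas ptime_dom_clauses [ptime_intros] = ptime_comp2[OF ptime_dom_clauses0]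

lemma ptime_end_clauses0: "ptime (\<lambda>z. end_clauses (fst z) (snd z))"
  unfolding end_clauses_def by (intro ptime_intros)
lemmas ptime_end_clauses [ptime_intros] = ptime_comp2[OF ptime_end_clauses0]

lemma ptime_ord_clauses0: "ptime (\<lambda>z. ord_clauses (fst z) (snd z))"
  unfolding ord_clauses_def by (intro ptime_intros)
lemmas ptime_ord_clauses [ptime_intros] = ptime_comp2[OF ptime_ord_clauses0]

lemma ptime_hom_clauses0: "ptime (\<lambda>z. hom_clauses (fst z) (snd z))"
  unfolding hom_clauses_def by (intro ptime_intros)
lemmas ptime_hom_clauses [ptime_intros] = ptime_comp2[OF ptime_hom_clauses0]

lemma ptime_guess_clauses0: "ptime guess_clauses"
  unfolding guess_clauses_def by (intro ptime_intros)
lemmas ptime_guess_clauses [ptime_intros] = ptime_comp[OF ptime_guess_clauses0]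

lemma ptime_clauses0: "ptime (\<lambda>z. clauses d (fst z) (fst (snd z)) (snd (snd z)))"
  unfolding clauses_def by (intro ptime_intros ptime_rep2)
lemmas ptime_clauses [ptime_intros] = ptime_comp3[OF ptime_clauses0]

lemma ptime_atoms0: "ptime atoms"
  unfolding atoms_def by (intro ptime_intros)
lemmas ptime_atoms [ptime_intros] = ptime_comp[OF ptime_atoms0]

lemma ptime_vars0: "ptime vars"
  unfolding vars_def by (intro ptime_intros)
lemmas ptime_vars [ptime_intros] = ptime_comp[OF ptime_vars0]

lemma ptime_labels0: "ptime labels"
  unfolding labels_def by (intro ptime_intros)
lemmas ptime_labels [ptime_intros] = ptime_comp[OF ptime_labels0]

lemma ptime_adj0: "ptime (\<lambda>z. adj (fst z) (fst (snd z)) (snd (snd z)))"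
  unfolding adj_def by (intro ptime_intros)
lemmas ptime_adj [ptime_intros] = ptime_comp3[OF ptime_adj0]

lemma ptime_pre0: "ptime pre"
  unfolding pre_def by (intro ptime_intros)
lemmas ptime_pre [ptime_intros] = ptime_comp[OF ptime_pre0]

lemma ptime_col0: "ptime col"
  unfolding col_def by (intro ptime_intros)
lemmas ptime_col [ptime_intros] = ptime_comp[OF ptime_col0]

lemma ptime_clauses_mhv0: "ptime clauses_mhv"
  unfolding clauses_mhv_def lab_instance_def by (intro ptime_intros)
lemmas ptime_clauses_mhv [ptime_intros] = ptime_comp[OF ptime_clauses_mhv0]


section \<open>Recognizing encodings\<close>

text \<open>Every tree whatsoever encodes a list of trees, so arbitrary input can be traversed with
  the rules for lists.\<close>

primrec spine_list :: "data \<Rightarrow> data list" where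
  "spine_list Leaf = []"
| "spine_list (Node a b) = a # spine_list b"

lemma ptime_spine_list0: "ptime spine_list"
proof (rule ptime_cast_id)
  show "encode (spine_list x) = encode x" for x by (induction x) auto
qed
lemmas ptime_spine_list [ptime_intros] = ptime_comp[OF ptime_spine_list0]

definition is_nat :: "data \<Rightarrow> bool" where
  "is_nat x \<longleftrightarrow> (\<forall>y\<in>set (spine_list x). y = Leaf)"

lemma is_nat_iff: "is_nat x \<longleftrightarrow> x \<in> range (encode :: nat \<Rightarrow> data)"
proof
  show "is_nat x \<Longrightarrow> x \<in> range (encode :: nat \<Rightarrow> data)"
  proof (induction x)
    case Leaf
    then show ?case by (auto intro: image_eqI[of _ _ 0])
  next
    case (Node a b)
    then obtain n where "b = encode (n :: nat)" "a = Leaf" by (auto simp: is_nat_def)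
    then show ?case by (auto intro: image_eqI[of _ _ "Suc n"])
  qed
  have "is_nat (encode n)" for n :: nat by (induction n) (auto simp: is_nat_def)
  then show "x \<in> range (encode :: nat \<Rightarrow> data) \<Longrightarrow> is_nat x" by auto
qed

lemma spine_list_range:
  "(\<forall>y\<in>set (spine_list x). y \<in> range (encode :: 'a::tree_enc \<Rightarrow> data)) \<longleftrightarrow> x \<in> range (encode :: 'a list \<Rightarrow> data)"
proof
  show "\<forall>y\<in>set (spine_list x). y \<in> range (encode :: 'a \<Rightarrow> data) \<Longrightarrow> x \<in> range (encode :: 'a list \<Rightarrow> data)"
  proof (induction x)
    case Leaf
    then show ?case by (auto intro: image_eqI[of _ _ "[]"])
  next
    case (Node a b)
    then obtain y ys where "a = encode (y :: 'a)" "b = encode (ys :: 'a list)" by auto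
    then show ?case by (auto intro: image_eqI[of _ _ "y # ys"])
  qed
  have "\<forall>y\<in>set (spine_list (encode xs)). y \<in> range (encode :: 'a \<Rightarrow> data)" for xs :: "'a list"
    by (induction xs) auto
  then show "x \<in> range (encode :: 'a list \<Rightarrow> data) \<Longrightarrow> \<forall>y\<in>set (spine_list x). y \<in> range (encode :: 'a \<Rightarrow> data)"
    by auto
qed

lemma pair_range:
  "x \<in> range (encode :: 'a::tree_enc \<times> 'b::tree_enc \<Rightarrow> data) \<longleftrightarrow>
    x \<noteq> Leaf \<and> left_of x \<in> range (encode :: 'a \<Rightarrow> data) \<and> right_of x \<in> range (encode :: 'b \<Rightarrow> data)"
proof
  assume x: "x \<noteq> Leaf \<and> left_of x \<in> range (encode :: 'a \<Rightarrow> data) \<and> right_of x \<in> range (encode :: 'b \<Rightarrow> data)"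
  then obtain a b where "left_of x = encode (a :: 'a)" "right_of x = encode (b :: 'b)" by blast
  with x have "x = encode (a, b)" by (cases x) auto
  then show "x \<in> range (encode :: 'a \<times> 'b \<Rightarrow> data)" by blast
qed auto

definition is_gate :: "data \<Rightarrow> bool" where
  "is_gate x \<longleftrightarrow> x \<noteq> Leaf \<and>
     (left_of x = encode (0::nat) \<and> right_of x = Leaf \<or>
      left_of x = encode (1::nat) \<and> is_nat (right_of x) \<or>
      (left_of x = encode (2::nat) \<or> left_of x = encode (3::nat)) \<and> (\<forall>y\<in>set (spine_list (right_of x)). is_nat y))"

lemma is_gate_iff: "is_gate x \<longleftrightarrow> x \<in> range (encode :: gate \<Rightarrow> data)"
proof
  assume x: "is_gate x"
  then obtain a b where ab: "x = Node a b" by (cases x) (auto simp: is_gate_def)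
  have l: "(\<forall>y\<in>set (spine_list b). is_nat y) \<longleftrightarrow> b \<in> range (encode :: nat list \<Rightarrow> data)"
    unfolding is_nat_iff by (rule spine_list_range)
  from x consider "a = encode (0::nat)" "b = Leaf" | j :: nat where "a = encode (1::nat)" "b = encode j"
    | js :: "nat list" where "a = encode (2::nat)" "b = encode js"
    | js :: "nat list" where "a = encode (3::nat)" "b = encode js"
    unfolding ab is_gate_def left_of.simps right_of.simps l is_nat_iff by blast
  then show "x \<in> range (encode :: gate \<Rightarrow> data)"
  proof cases
    case 1
    then have "x = encode InputG" by (simp add: ab encode_gate_def encode_nat_def)
    then show ?thesis by blast
  next
    case (2 j)
    then have "x = encode (NotG j)" by (simp add: ab encode_gate_def encode_nat_def)
    then show ?thesis by blast
  next
    case (3 js)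
    then have "x = encode (AndG js)" by (simp add: ab encode_gate_def encode_nat_def encode_list_def)
    then show ?thesis by blast
  next
    case (4 js)
    then have "x = encode (OrG js)" by (simp add: ab encode_gate_def encode_nat_def encode_list_def)
    then show ?thesis by blast
  qed
next
  have l: "\<forall>y\<in>set (spine_list (encode js)). is_nat y" for js :: "nat list"
    unfolding is_nat_iff spine_list_range by blast
  assume "x \<in> range (encode :: gate \<Rightarrow> data)"
  then obtain g where g: "x = encode (g :: gate)" by blast
  have n: "is_nat (encode j)" for j :: nat unfolding is_nat_iff by blast
  show "is_gate x"
    using l n by (cases g) (simp_all add: g is_gate_def encode_gate_def encode_nat_def encode_list_def)
qed

definition is_wcs :: "data \<Rightarrow> bool" where
  "is_wcs x \<longleftrightarrow> x \<noteq> Leaf \<and>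
     (left_of x \<noteq> Leaf \<and> (\<forall>y\<in>set (spine_list (left_of (left_of x))). is_gate y) \<and> is_nat (right_of (left_of x))) \<and>
     is_nat (right_of x)"

lemma is_wcs_iff: "is_wcs x \<longleftrightarrow> x \<in> range (encode :: circuit \<times> nat \<Rightarrow> data)"
  unfolding is_wcs_def pair_range is_nat_iff is_gate_iff spine_list_range ..

lemma ptime_is_nat0: "ptime is_nat"
  unfolding is_nat_def by (intro ptime_intros)
lemmas ptime_is_nat [ptime_intros] = ptime_comp[OF ptime_is_nat0]

lemma ptime_is_gate0: "ptime is_gate"
  unfolding is_gate_def by (intro ptime_intros)
lemmas ptime_is_gate [ptime_intros] = ptime_comp[OF ptime_is_gate0]

lemma ptime_is_wcs: "ptime is_wcs"
  unfolding is_wcs_def by (intro ptime_intros)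

text \<open>On accepted trees decoding does nothing, as a value is represented by its own encoding;
  on all other trees it may return a fixed value.\<close>

lemma ptime_decode:
  assumes "ptime ok" "\<And>x. ok x \<Longrightarrow> x \<in> range (encode :: 'a::tree_enc \<Rightarrow> data)" "ptime (h :: 'a \<Rightarrow> 'b::tree_enc)"
  shows "ptime (\<lambda>x. if ok x then h (inv encode x) else c)"
proof -
  have "ptime (\<lambda>x. if ok x then inv encode x else undefined :: 'a)"
  proof (rule ptime_cast)
    show "ptime (\<lambda>x. if ok x then x else encode (undefined :: 'a))" by (intro ptime_intros assms(1))
    show "encode (if ok x then inv encode x else undefined :: 'a) =
        encode (if ok x then x else encode (undefined :: 'a))" for x
      using assms(2) by (simp add: f_inv_into_f)
  qed
  from ptime_comp[OF assms(3) this]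
  have "ptime (\<lambda>x. if ok x then h (if ok x then inv encode x else undefined) else c)"
    by (intro ptime_intros assms(1))
  then show ?thesis by (rule ptime_cong) simp
qed

lemma enc_wcs_eq: "enc_wcs = encode"
  by (simp add: enc_wcs_def encode_prod_def encode_list_def encode_nat_def encode_gate_def)

lemma enc_mhv_eq: "enc_mhv = encode"
  by (simp add: enc_mhv_def encode_prod_def encode_list_def encode_nat_def)

definition wcs_valid :: "nat \<Rightarrow> circuit \<times> nat \<Rightarrow> bool" where
  "wcs_valid d z \<longleftrightarrow> circuit_wf (fst z) \<and> chk (fst (fst z)) d 2 (snd (fst z))"

lemma ptime_wf_gates0: "ptime wf_gates"
proof -
  have "ptime (\<lambda>gs. (\<forall>i\<in>set [0..<length gs]. distinct (preds (gate_at gs i)) \<and> (\<forall>j\<in>set (preds (gate_at gs i)). j < i)) \<and>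
      (\<forall>g\<in>set gs. \<not> 2 \<le> tag g \<or> 2 \<le> length (preds g)))"
    by (intro ptime_intros)
  then show ?thesis by (rule ptime_cong) (auto simp: wf_gates_def gate_at_nth)
qed
lemmas ptime_wf_gates [ptime_intros] = ptime_comp[OF ptime_wf_gates0]

lemma ptime_wcs_valid0: "ptime (wcs_valid d)"
  unfolding wcs_valid_def circuit_wf_iff by (intro ptime_intros)
lemmas ptime_wcs_valid [ptime_intros] = ptime_comp[OF ptime_wcs_valid0]

text \<open>\<open>Leaf\<close> encodes no instance of Maximum Happy Vertices.\<close>

definition reduction :: "nat \<Rightarrow> data \<Rightarrow> data" where
  "reduction d x = (if is_wcs x then
     (let z = inv encode x :: circuit \<times> nat in
      if wcs_valid d z then encode (clauses_mhv (clauses d (fst (fst z)) (snd (fst z)) (snd z))) else Leaf)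
     else Leaf)"

lemma ptime_reduction: "ptime (reduction d)"
proof -
  have "ptime (\<lambda>z :: circuit \<times> nat.
      if wcs_valid d z then encode (clauses_mhv (clauses d (fst (fst z)) (snd (fst z)) (snd z))) else Leaf)"
    by (intro ptime_intros)
  from ptime_decode[OF ptime_is_wcs _ this, of Leaf] show ?thesis
    by (rule ptime_cong) (simp_all add: is_wcs_iff reduction_def Let_def)
qed

lemma reduction_encode:
  "reduction d (encode (C, k)) =
    (if wcs_valid d (C, k) then encode (clauses_mhv (clauses d (fst C) (snd C) k)) else Leaf)"
  by (simp add: reduction_def is_wcs_iff inv_f_f[OF inj_encode] del: encode_simps(1))

lemma reduction_other: "x \<notin> range (encode :: circuit \<times> nat \<Rightarrow> data) \<Longrightarrow> reduction d x = Leaf"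
  by (simp add: reduction_def is_wcs_iff)


section \<open>Composing reductions\<close>

text \<open>With this, the time and parameter bounds of a composed reduction are formed from those
  of the given one by polynomial operations.\<close>

lemma computable_comp:
  assumes "computable f" "ptime h"
  shows "computable (\<lambda>n. h (f n))"
proof -
  obtain c where c: "\<forall>n. \<exists>t. runs c (enc_nat n) t (enc_nat (f n))"
    using assms(1) by (auto simp: computable_def)
  obtain P0 K where P0: "runs c x t y \<and> S m = x \<and> (\<forall>r>m. S r = Leaf) \<longrightarrow> exec (P0 m) S (t + K) (S(m := y))" for x t y m S
    using runs_frame[of c] by blast
  obtain P p where P: "computes P p h" using assms(2) by (rule ptimeE)
  have "\<exists>t. runs (Seq (P0 0) (P 0)) (enc_nat n) t (enc_nat (h (f n)))" for n
  proof -
    let ?S = "(\<lambda>_. Leaf)(0 := enc_nat n)"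
    obtain t where t: "runs c (enc_nat n) t (enc_nat (f n))" using c by blast
    have e1: "exec (P0 0) ?S (t + K) (?S(0 := encode (f n)))"
      unfolding encode_nat_def by (rule P0[rule_format]) (use t in auto)
    obtain u where e2: "exec (P 0) (?S(0 := encode (f n))) u (?S(0 := encode (f n), 0 := encode (h (f n))))"
      using computesD[OF P, of "?S(0 := encode (f n))" 0 "f n"] by auto
    have "runs (Seq (P0 0) (P 0)) (enc_nat n) (t + K + u) (enc_nat (h (f n)))"
      unfolding runs_def
      by (intro exI conjI, rule exec.Seq[OF e1 e2]) (simp add: encode_nat_def)
    then show ?thesis ..
  qed
  then show ?thesis unfolding computable_def by blast
qed

lemma ptime_power: "ptime f \<Longrightarrow> ptime (\<lambda>x. f x ^ b :: nat)"
  unfolding power.simps by (induction b) (auto simp: power.simps intro: ptime_const ptime_mult)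

text \<open>The size of \<open>Q x\<close> is at most the size of \<open>x\<close> plus the running
  time, so a polynomial in it is a function of the parameter times a power of the input size.
  Monotonicity of \<open>h\<close> carries the bound \<open>g\<close> on the intermediate parameter
  through.\<close>

lemma fpt_reducible_comp_ptime:
  assumes AB: "fpt_reducible A B" and R: "ptime R"
    and iff: "\<And>x. x \<in> fst B \<longleftrightarrow> R x \<in> fst C"
    and h: "ptime h" "mono h" "\<And>x. snd C (R x) \<le> h (snd B x)"
  shows "fpt_reducible A C"
proof -
  obtain Q c f g a where Q: "computable f" "computable g"
    "\<And>x. \<exists>t \<le> f (snd A x) * dsize x ^ a. runs c x t (Q x)" "\<And>x. x \<in> fst A \<longleftrightarrow> Q x \<in> fst B"
    "\<And>x. snd B (Q x) \<le> g (snd A x)"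
    using AB unfolding fpt_reducible_def by blast
  obtain P0 K where P0: "runs c x t y \<and> S m = x \<and> (\<forall>r>m. S r = Leaf) \<longrightarrow> exec (P0 m) S (t + K) (S(m := y))" for x t y m S
    using runs_frame[of c] by blast
  obtain P p where P: "poly_bd p" "computes P p R" using R by (rule ptimeE)
  obtain b where b: "\<And>n. p n \<le> (n + 2) ^ b" using P(1) by (auto simp: poly_bd_def)
  \<comment> \<open>With \<open>n\<close> the input size and \<open>M = Suc m * n ^ Suc a\<close>,
    each of \<open>n\<close>, the first running time and 1 is at most \<open>M\<close>, so
    \<open>dsize (Q x) + 2\<close> is at most \<open>4 * M\<close>. The summands of \<open>F\<close>
    account for the first program, the clearing of its registers and the second program; the
    exponent \<open>e\<close> dominates both \<open>a\<close> and \<open>Suc a * b\<close>.\<close>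
  define F where "F m = Suc m + K + (4 * Suc m) ^ b" for m
  define e where "e = a + Suc a * b"
  have "\<exists>t \<le> F (f (snd A x)) * dsize x ^ e. runs (Seq (P0 0) (P 0)) x t (R (Q x))" for x
  proof -
    let ?S = "(\<lambda>_. Leaf)(0 := x)" and ?n = "dsize x" and ?m = "Suc (f (snd A x))"
    have n: "1 \<le> ?n" using dsize_pos[of x] by simp
    obtain t where t: "t \<le> f (snd A x) * ?n ^ a" "runs c x t (Q x)" using Q(3) by blast
    have e1: "exec (P0 0) ?S (t + K) (?S(0 := Q x))" by (rule P0[rule_format]) (use t(2) in auto)
    obtain u where u: "u \<le> p (dsize (Q x))" "exec (P 0) (?S(0 := Q x)) u (?S(0 := Q x, 0 := R (Q x)))"
      using computesD[OF P(2), of "?S(0 := Q x)" 0 "Q x"] by auto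
    have t': "t \<le> ?m * ?n ^ a" using t(1) by (simp add: trans_le_add2)
    have pos: "1 \<le> ?n ^ i" for i using n by simp
    have sz: "dsize (Q x) \<le> ?n + t"
    proof -
      obtain s where "exec c ?S t s" "s 0 = Q x" using t(2) by (auto simp: runs_def)
      with exec_size[OF this(1), of 0] show ?thesis by auto
    qed
    have "dsize (Q x) + 2 \<le> 4 * ?m * ?n ^ Suc a"
    proof -
      have "?n ^ a \<le> ?n ^ Suc a" "?n \<le> ?n ^ Suc a" "1 \<le> ?n ^ Suc a"
        using n pos by (simp_all add: power_increasing self_le_power)
      then have "t \<le> ?m * ?n ^ Suc a" "?n \<le> ?m * ?n ^ Suc a" "1 \<le> ?m * ?n ^ Suc a"
        using t' by (meson mult_le_mono2 order.trans, simp_all add: trans_le_add1)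
      then show ?thesis using sz by linarith
    qed
    then have "(dsize (Q x) + 2) ^ b \<le> (4 * ?m * ?n ^ Suc a) ^ b" by (rule power_mono) simp
    then have u': "u \<le> (4 * ?m) ^ b * ?n ^ (Suc a * b)"
      using u(1) b[of "dsize (Q x)"] by (simp only: power_mult_distrib power_mult)
    have "t + K + u \<le> ?m * ?n ^ e + K * ?n ^ e + (4 * ?m) ^ b * ?n ^ e"
    proof (intro add_le_mono)
      have "?n ^ a \<le> ?n ^ e" unfolding e_def by (rule power_increasing) (use n in auto)
      then show "t \<le> ?m * ?n ^ e" using t' by (meson mult_le_mono2 order.trans)
      show "K \<le> K * ?n ^ e" using pos[of e] by simp
      have "?n ^ (Suc a * b) \<le> ?n ^ e" unfolding e_def by (rule power_increasing) (use n in auto)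
      then show "u \<le> (4 * ?m) ^ b * ?n ^ e" using u' by (meson mult_le_mono2 order.trans)
    qed
    also have "\<dots> = F (f (snd A x)) * ?n ^ e" unfolding F_def by (simp only: distrib_right)
    finally have "t + K + u \<le> F (f (snd A x)) * ?n ^ e" .
    moreover have "runs (Seq (P0 0) (P 0)) x (t + K + u) (R (Q x))"
      unfolding runs_def by (intro exI conjI, rule exec.Seq[OF e1 u(2)]) simp
    ultimately show ?thesis by blast
  qed
  moreover have "computable (\<lambda>n. F (f n))"
    unfolding F_def by (rule computable_comp[OF Q(1)]) (intro ptime_intros ptime_power)
  moreover have "computable (\<lambda>n. h (g n))"
    by (rule computable_comp[OF Q(2) h(1)])
  moreover have "x \<in> fst A \<longleftrightarrow> R (Q x) \<in> fst C" for x using Q(4) iff by simp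
  moreover have "snd C (R (Q x)) \<le> h (g (snd A x))" for x
    using h(3)[of "Q x"] monoD[OF h(2) Q(5)[of x]] by (rule order.trans)
  ultimately show ?thesis
    unfolding fpt_reducible_def
    by (intro exI[of _ "\<lambda>x. R (Q x)"] exI[of _ "Seq (P0 0) (P 0)"] exI[of _ "\<lambda>n. F (f n)"]
        exI[of _ "\<lambda>n. h (g n)"] exI[of _ e]) blast
qed

lemma encoded_problem_encode:
  assumes "inj enc"
  shows "enc i \<in> fst (encoded_problem enc I Y \<kappa>) \<longleftrightarrow> i \<in> I \<and> Y i"
    and "snd (encoded_problem enc I Y \<kappa>) (enc i) = (if i \<in> I then \<kappa> i else 0)"
  using assms by (auto simp: encoded_problem_def inj_image_mem_iff inv_into_f_f inj_on_subset[OF assms])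

lemma encoded_problem_other:
  assumes "x \<notin> enc ` I"
  shows "x \<notin> fst (encoded_problem enc I Y \<kappa>)" "snd (encoded_problem enc I Y \<kappa>) x = 0"
  using assms by (auto simp: encoded_problem_def)

section \<open>Assembling the reduction\<close>

abbreviation "MHV_stars \<equiv> MHV_parameterized_by (distance_to disjoint_union_of_stars)"

lemma Leaf_MHV: "Leaf \<notin> fst MHV_stars" "snd MHV_stars Leaf = 0"
proof -
  have "Leaf \<notin> enc_mhv ` {i. mhv_wf i}" by (auto simp: enc_mhv_def enc_pair_def)
  from encoded_problem_other[OF this] show "Leaf \<notin> fst MHV_stars" "snd MHV_stars Leaf = 0"
    by (simp_all add: MHV_parameterized_by_def)
qed

text \<open>The 3 counts the selector variable \<open>Leaf\<close> and the two anchors. A list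
  length is used because it is evidently computable and monotone in \<open>k\<close>.\<close>

definition param_bound :: "nat \<Rightarrow> nat \<Rightarrow> nat" where
  "param_bound d k = length (lvl (Suc d) (base_vars k)) + 3"

lemma length_lvl_mono: "length X \<le> length Y \<Longrightarrow> length (lvl j X) \<le> length (lvl j Y)"
proof (induction j)
  case (Suc j)
  have "length (pair_up Z) = length Z * length Z" for Z
    by (simp add: pair_up_def length_concat comp_def sum_list_triv)
  with Suc show ?case by (simp add: lvl.simps(2) add_le_mono mult_le_mono)
qed simp

lemma mono_param_bound: "mono (param_bound d)"
  by (rule monoI) (simp add: param_bound_def base_vars_def length_lvl_mono)

lemma ptime_param_bound: "ptime (param_bound d)"
  unfolding param_bound_def by (intro ptime_intros)

lemma clauses_distance:
  "distance_to disjoint_union_of_stars (mhv_graph (clauses_mhv (clauses d gs out k))) \<le> param_bound d k"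
proof -
  have "card (fst ` set (concat (clauses d gs out k))) \<le> card (insert Leaf (small_vars d k))"
    by (rule card_mono[OF _ clauses_vars]) (simp add: small_vars_def)
  also have "\<dots> \<le> Suc (card (small_vars d k))" by (simp add: small_vars_def card_insert_if)
  also have "\<dots> \<le> Suc (length (lvl (Suc d) (base_vars k)))"
    by (simp add: small_vars_def card_length)
  finally show ?thesis
    using clauses_mhv_distance[of "clauses d gs out k"] by (simp add: param_bound_def)
qed

lemma wcs_valid_iff:
  "wcs_valid d (C, k) \<longleftrightarrow> (C, k) \<in> {(C, k). circuit_wf C \<and> weft_at_most 2 C \<and> depth_at_most d C}"
  using chk_circuit[of C d 2] by (auto simp: wcs_valid_def)

lemma reduction_correct:
  "x \<in> fst (WCS 2 d) \<longleftrightarrow> reduction d x \<in> fst MHV_stars"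
  "snd MHV_stars (reduction d x) \<le> param_bound d (snd (WCS 2 d) x)"
proof -
  have "(x \<in> fst (WCS 2 d) \<longleftrightarrow> reduction d x \<in> fst MHV_stars) \<and>
      snd MHV_stars (reduction d x) \<le> param_bound d (snd (WCS 2 d) x)"
  proof (cases "x \<in> range (encode :: circuit \<times> nat \<Rightarrow> data)")
    case False
    then have "x \<notin> fst (WCS 2 d)"
      unfolding WCS_def enc_wcs_eq by (intro encoded_problem_other) blast
    then show ?thesis using reduction_other[OF False] Leaf_MHV by simp
  next
    case True
    then obtain C k where x: "x = enc_wcs (C, k)" unfolding enc_wcs_eq by fast
    note R = reduction_encode[of d C k, folded enc_wcs_eq]
    have W: "x \<in> fst (WCS 2 d) \<longleftrightarrow> wcs_valid d (C, k) \<and> weighted_sat C k"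
      "snd (WCS 2 d) x = (if wcs_valid d (C, k) then k else 0)"
      unfolding WCS_def x encoded_problem_encode[OF inj_enc_wcs] wcs_valid_iff by simp_all
    show ?thesis
    proof (cases "wcs_valid d (C, k)")
      case False
      then show ?thesis using W R Leaf_MHV by (simp add: x)
    next
      case True
      let ?i = "clauses_mhv (clauses d (fst C) (snd C) k)"
      have wf: "wf_gates (fst C)" "snd C < length (fst C)" "chk (fst C) d 2 (snd C)"
        using True by (simp_all add: wcs_valid_def circuit_wf_iff)
      have Rx: "reduction d x = enc_mhv ?i" using R True by (simp add: x enc_mhv_eq)
      have "mhv_yes ?i \<longleftrightarrow> weighted_sat C k"
        using clauses_sound[OF wf] clauses_complete[OF wf] by (auto simp: clauses_mhv_yes)
      moreover have "enc_mhv ?i \<in> fst MHV_stars \<longleftrightarrow> mhv_yes ?i"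
        "snd MHV_stars (enc_mhv ?i) = distance_to disjoint_union_of_stars (mhv_graph ?i)"
        unfolding MHV_parameterized_by_def encoded_problem_encode[OF inj_enc_mhv]
        using clauses_mhv_wf by simp_all
      ultimately show ?thesis using W True clauses_distance Rx by simp
    qed
  qed
  then show "x \<in> fst (WCS 2 d) \<longleftrightarrow> reduction d x \<in> fst MHV_stars"
    "snd MHV_stars (reduction d x) \<le> param_bound d (snd (WCS 2 d) x)" by blast+
qed

theorem theorem4:
  "W_hard 2 (MHV_parameterized_by (distance_to disjoint_union_of_stars))"
  unfolding W_hard_def
proof
  fix A assume "A \<in> W 2"
  \<comment> \<open>The depth bound is the same for all instances of the target problem, so the
    program of the reduction may depend on it.\<close>
  then obtain d where "fpt_reducible A (WCS 2 d)" by (auto simp: W_def)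
  then show "fpt_reducible A MHV_stars"
    using ptime_reduction reduction_correct(1) ptime_param_bound mono_param_bound reduction_correct(2)
    by (rule fpt_reducible_comp_ptime)
qed

end
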